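(* Let $p\in\mathbb{N}$, $\mathbf{a},\mathbf{b}\in\mathbb{C}^p$ with $-\mathbf{b}\notin\mathbb{N}_0$, and choose a nonnegative integer $n>-\min(a,\Re(\psi))$ (in the definition of $\mathcal{G}_1$). Then $$\langle\mathcal{G}_1(\mathbf{a},\mathbf{b}),(1+zt)^{-\sigma}\rangle={}_{p+1}F_p\!\left(\begin{matrix}\sigma,\mathbf{a}\\\mathbf{b}\end{matrix}\,\Big|-z\right)$$ for all $z\in\mathbb{C}\setminus(-\infty,-1]$ and $\sigma\in\mathbb{C}$; $$\langle\mathcal{G}_1(\mathbf{a},\mathbf{b}),e^{-zt}\rangle={}_pF_p\!\left(\begin{matrix}\mathbf{a}\\\mathbf{b}\end{matrix}\,\Big|-z\right)$$ for all $z\in\mathbb{C}$; and, if $\mathbf{a}=(\hat{\mathbf{a}},1/2)$, $$\langle\mathcal{G}_1(\mathbf{a},\mathbf{b}),\cos(2\sqrt{zt})\rangle={}_{p-1}F_p\!\left(\begin{matrix}\hat{\mathbf{a}}\\\mathbf{b}\end{matrix}\,\Big|-z\right)$$ for all $z\in\mathbb{C}$ (the functional acting in the variable $t\in[0,1]$).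
   Context: $\mathbb{N}_0=\mathbb{N}\cup\{0\}$. For a vector $\mathbf{a}=(a_1,\dots,a_p)$: $\Gamma(\mathbf{a})=\prod_i\Gamma(a_i)$, $(\mathbf{a})_j=\prod_i(a_i)_j$, $\mathbf{a}+\mu=(a_1+\mu,\dots,a_p+\mu)$; conditions such as $-\mathbf{a}\notin\mathbb{N}_0$ are element-wise. $a=\min(\Re a_1,\dots,\Re a_p)$, $\psi=\sum_{k=1}^p(b_k-a_k)$. ${}_{p+1}F_p$ denotes the analytic continuation to $\mathbb{C}\setminus[1,\infty)$ in its argument. For $0<t<1$ and $-\mathbf{a}\notin\mathbb{N}_0$, $$\widehat{G}_n(t)=G^{p,1}_{p+1,p+1}\!\left(t\,\Big|\begin{array}{l}n,\mathbf{b}+n-1\\ \mathbf{a}+n-1,0\end{array}\right)=\frac{1}{2\pi i}\int_{\mathcal{L}}\frac{\Gamma(\mathbf{a}+n-1+s)\,\Gamma(1-n-s)}{\Gamma(\mathbf{b}+n-1+s)\,\Gamma(1-s)}\,t^{-s}\,ds,$$ where $\mathcal{L}$ is a left loop (starting and ending at $-\infty$, traversed counterclockwise) that leaves all the points $1-a_j-n-l$, $l\in\mathbb{N}_0$, on its left and all the points $1-n+k$, $k\in\mathbb{N}_0$, on its right. If some components of $\mathbf{a}$ are non-positive integers, $\widehat{G}_n(t)/\Gamma(\mathbf{a})$ denotes its extension by continuity in $\mathbf{a}$, namely $\frac{t^{n-1}}{(n-1)!}\sum_{j=0}^{n-1}\frac{(1-n)_j(\mathbf{a})_j}{\Gamma(\mathbf{b}+j)\,j!}t^{-j}$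 (and $0$ if $n=0$). $\mathcal{CB}^\infty[0,1]$ is the space of functions on $[0,1]$ having derivatives of all orders, all bounded on $[0,1]$. For a nonnegative integer $n>-\min(a,\Re(\psi))$ and $\varphi\in\mathcal{CB}^\infty[0,1]$, $$\langle\mathcal{G}_1(\mathbf{a},\mathbf{b}),\varphi\rangle=\sum_{k=0}^{n-1}\frac{(-1)^k\varphi^{(k)}(1)}{k!}\,{}_{p+1}F_p\!\left(\begin{matrix}\mathbf{a},-k\\\mathbf{b}\end{matrix}\,\Big|\,1\right)+\frac{(-1)^n\Gamma(\mathbf{b})}{\Gamma(\mathbf{a})}\int_0^1\widehat{G}_n(t)\varphi^{(n)}(t)\,dt$$ (the finite sum is empty if $n=0$; the value does not depend on the choice of $n$). *)

theory Defs
  imports "HOL-Complex_Analysis.Complex_Analysis"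
begin

text \<open>Parameter vectors are lists; the following are the products over all components.\<close>

definition Gamma_vec :: "complex list \<Rightarrow> complex" where
  "Gamma_vec a = (\<Prod>x\<leftarrow>a. Gamma x)"

definition poch_vec :: "complex list \<Rightarrow> nat \<Rightarrow> complex" where
  "poch_vec a j = (\<Prod>x\<leftarrow>a. pochhammer x j)"

definition shift :: "complex list \<Rightarrow> complex \<Rightarrow> complex list" where
  "shift a \<mu> = map (\<lambda>x. x + \<mu>) a"

definition psi :: "complex list \<Rightarrow> complex list \<Rightarrow> complex" where
  "psi a b = (\<Sum>k<length a. b ! k - a ! k)"

text \<open>The generalized hypergeometric series, with upper parameters \<open>a\<close> and lower parameters \<open>b\<close>.\<close>

definition hyp_series :: "complex list \<Rightarrow> complex list \<Rightarrow> complex \<Rightarrow> complex" where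
  "hyp_series a b z = (\<Sum>m. poch_vec a m / poch_vec b m * z ^ m / fact m)"

text \<open>Analytic continuation of the series (for one more upper than lower parameter) to the plane
  cut along \<open>[1, \<infinity>)\<close>. On this connected domain the continuation is unique, so the choice operator
  is harmless there.\<close>

definition hyp_cut_plane :: "complex set" where
  "hyp_cut_plane = - (of_real ` {1..})"

definition hyp_cont :: "complex list \<Rightarrow> complex list \<Rightarrow> complex \<Rightarrow> complex" where
  "hyp_cont a b = (SOME f. f holomorphic_on hyp_cut_plane \<and> (\<forall>z\<in>ball 0 1. f z = hyp_series a b z))"

text \<open>A left loop is given by its bounded middle part \<open>g\<close>: it comes in from \<open>-\<infinity>\<close> along the
  horizontal ray ending at the start of \<open>g\<close>, runs through \<open>g\<close>, and goes back to \<open>-\<infinity>\<close> along the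
  horizontal ray beginning at the end of \<open>g\<close>. It is cut off at distance \<open>R\<close> along the rays, and
  closed by a segment in order to speak of winding numbers.\<close>

definition loop_trunc :: "(real \<Rightarrow> complex) \<Rightarrow> real \<Rightarrow> real \<Rightarrow> complex" where
  "loop_trunc g R =
     linepath (pathstart g - of_real R) (pathstart g) +++ g +++
     linepath (pathfinish g) (pathfinish g - of_real R)"

definition loop_closed :: "(real \<Rightarrow> complex) \<Rightarrow> real \<Rightarrow> real \<Rightarrow> complex" where
  "loop_closed g R =
     loop_trunc g R +++ linepath (pathfinish g - of_real R) (pathstart g - of_real R)"

text \<open>The loop, traversed counterclockwise, leaves the points of \<open>A\<close> on its left (it winds around them
  once) and those of \<open>B\<close> on its right (it does not wind around them).\<close>

definition left_loop :: "(real \<Rightarrow> complex) \<Rightarrow> complex set \<Rightarrow> complex set \<Rightarrow> bool" where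
  "left_loop g A B \<longleftrightarrow>
     valid_path g \<and> Im (pathstart g) < Im (pathfinish g) \<and>
     (\<forall>R\<ge>0. path_image (loop_trunc g R) \<inter> (A \<union> B) = {}) \<and>
     (\<forall>w\<in>A. \<forall>\<^sub>F R in at_top. winding_number (loop_closed g R) w = 1) \<and>
     (\<forall>w\<in>B. \<forall>\<^sub>F R in at_top. winding_number (loop_closed g R) w = 0)"

definition loop_integral :: "(real \<Rightarrow> complex) \<Rightarrow> (complex \<Rightarrow> complex) \<Rightarrow> complex" where
  "loop_integral g f = Lim at_top (\<lambda>R. contour_integral (loop_trunc g R) f)"

definition G_left_points :: "nat \<Rightarrow> complex list \<Rightarrow> complex set" where
  "G_left_points n a = {1 - x - of_nat n - of_nat l | x l. x \<in> set a}"

definition G_right_points :: "nat \<Rightarrow> complex set" where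
  "G_right_points n = {1 - of_nat n + of_nat k | k. True}"

definition G_integrand :: "nat \<Rightarrow> complex list \<Rightarrow> complex list \<Rightarrow> real \<Rightarrow> complex \<Rightarrow> complex" where
  "G_integrand n a b t s =
     Gamma_vec (shift a (of_nat n - 1 + s)) * Gamma (1 - of_nat n - s) /
     (Gamma_vec (shift b (of_nat n - 1 + s)) * Gamma (1 - s)) * of_real t powr (- s)"

text \<open>For \<open>0 < t < 1\<close> all admissible loops give the same value. They exist iff no component of \<open>a\<close> is a
  non-positive integer.\<close>

definition G_hat :: "nat \<Rightarrow> complex list \<Rightarrow> complex list \<Rightarrow> real \<Rightarrow> complex" where
  "G_hat n a b t = 1 / (2 * of_real pi * \<i>) *
     loop_integral (SOME g. left_loop g (G_left_points n a) (G_right_points n)) (G_integrand n a b t)"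

text \<open>The quotient of \<open>G_hat n a b t\<close> by \<open>Gamma_vec a\<close>, extended by continuity in \<open>a\<close>.\<close>

definition G_hat_reg :: "nat \<Rightarrow> complex list \<Rightarrow> complex list \<Rightarrow> real \<Rightarrow> complex" where
  "G_hat_reg n a b t =
     (if \<forall>x\<in>set a. x \<notin> \<int>\<^sub>\<le>\<^sub>0 then G_hat n a b t / Gamma_vec a
      else if n = 0 then 0
      else of_real t ^ (n - 1) / fact (n - 1) *
        (\<Sum>j<n. pochhammer (1 - of_nat n) j * poch_vec a j /
               (Gamma_vec (shift b (of_nat j)) * fact j) / of_real t ^ j))"

text \<open>Derivatives of functions on \<open>[0,1]\<close> are one-sided at the end points.\<close>

definition deriv01 :: "(real \<Rightarrow> complex) \<Rightarrow> real \<Rightarrow> complex" where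
  "deriv01 \<phi> t = vector_derivative \<phi> (at t within {0..1})"

definition CB_infty :: "(real \<Rightarrow> complex) set" where
  "CB_infty = {\<phi>. \<forall>k. (deriv01 ^^ k) \<phi> differentiable_on {0..1} \<and>
                     bounded ((deriv01 ^^ k) \<phi> ` {0..1})}"

definition G1_pairing :: "nat \<Rightarrow> complex list \<Rightarrow> complex list \<Rightarrow> (real \<Rightarrow> complex) \<Rightarrow> complex" where
  "G1_pairing n a b \<phi> =
     (\<Sum>k<n. (-1) ^ k * (deriv01 ^^ k) \<phi> 1 / fact k * hyp_series (a @ [- of_nat k]) b 1) +
     (-1) ^ n * Gamma_vec b * (LBINT t:{0<..<1}. G_hat_reg n a b t * (deriv01 ^^ n) \<phi> t)"

end

theory Submission
  imports Defs "HOL-Real_Asymp.Real_Asymp"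
begin

text \<open>The functional sends \<open>t^m\<close> to \<open>(a)\<^sub>m / (b)\<^sub>m\<close> for every \<open>m\<close>; everything else is termwise application to
  power series and analytic continuation.

  To find these moments, write the Meijer function as the integral of \<open>F s * t powr (- s)\<close> over a left loop, where
  \<open>F s = (-1)^n \<Gamma>(a + n - 1 + s) / (\<Gamma>(b + n - 1 + s) (s)\<^sub>n)\<close> is \<open>mellin_kernel\<close>. A quotient of Gamma functions is
  comparable with a power of \<open>s\<close> as long as \<open>s\<close> keeps a fixed distance from the poles
  (\<open>gamma_ratio_bound\<close>), so \<open>F s\<close> is at most of the order \<open>\<bar>s\<bar> powr (- Re \<psi> - n)\<close> there, and the exponent is negative
  by the choice of \<open>n\<close>. Two consequences follow from the residue theorem. Whatever admissible loop is chosen,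
  the integral is the sum of the residues at the poles on its left (\<open>loop_integral_eq_residue_series\<close>). And
  the sum of the residues at \<^emph>\<open>all\<close> poles of \<open>F\<close>, that is, at those points and at \<open>0, -1, \<dots>, 1 - n\<close>, is the inverse
  Mellin transform of \<open>F\<close>: its integral against \<open>t^k\<close> over \<open>(0,1)\<close> is \<open>F (k + 1)\<close> (\<open>residue_series_mellin\<close>). This
  needs the poles to lie to the left of \<open>1\<close>, which for those of \<open>\<Gamma>(a + n - 1 + s)\<close> is the condition that \<open>n\<close> exceeds \<open>- Re x\<close> for
  all components \<open>x\<close> of \<open>a\<close>.

  The residues at \<open>0, \<dots>, 1 - n\<close> add up to \<open>- \<Gamma>(a)\<close> times a polynomial in \<open>t\<close>, called \<open>G_poly\<close>. It is the very
  polynomial that stands for the kernel, the quotient of the Meijer function by \<open>\<Gamma>(a)\<close>, when a component of \<open>a\<close> is a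
  non-positive integer. Hence in all
  cases the kernel is \<open>G_poly\<close> plus a function whose moments are given by the Pochhammer symbols \<open>(a)\<^sub>m / (b)\<^sub>m\<close> with
  \<open>m \<ge> n\<close> (\<open>G_hat_reg_moments\<close>); in the degenerate case these vanish. Integrating \<open>G_poly\<close> against the \<open>n\<close>-th
  derivative by parts cancels the terms with the derivatives at \<open>1\<close> in the definition of the functional
  and leaves the Taylor polynomial at \<open>0\<close> with weights \<open>(a)\<^sub>j / (b)\<^sub>j\<close>, \<open>j < n\<close> (\<open>G1_pairing_eq\<close>). Together this evaluates
  the functional on every power series with radius of convergence greater than \<open>1\<close>
  (\<open>G1_pairing_power_series\<close>).

  The exponential function and \<open>cos (2 * csqrt (z * t))\<close> are entire in \<open>t\<close>, so for them this is the assertion. For the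
  binomial function it is the assertion with \<open>\<bar>z\<bar> < 1\<close>. Since the functional depends holomorphically on \<open>z\<close> in the
  cut plane, the identity theorem extends it to the continued hypergeometric function.\<close>

section \<open>Quotients of Gamma functions\<close>

text \<open>The square of a substitute for \<open>1 + \<bar>s\<bar>\<close> that is smooth along horizontal lines. The imaginary part enters through
  \<open>Y = 1 + \<bar>Im s\<bar>\<close>, which does not change when \<open>s\<close> is shifted by an integer, so the estimates below telescope.\<close>

definition msize :: "complex \<Rightarrow> real" where
  "msize s = (1 + \<bar>Im s\<bar>)\<^sup>2 + (Re s)\<^sup>2"

lemma msize_ge_1: "1 \<le> msize s"
proof -
  have "1 \<le> (1 + \<bar>Im s\<bar>)\<^sup>2" by (simp add: one_le_power)
  then show ?thesis unfolding msize_def by (smt (verit) zero_le_power2)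
qed

text \<open>The next two lemmas turn the sums over \<open>k\<close> that arise from the product formula for \<open>\<Gamma>\<close> into telescoping
  sums. Errors of the order \<open>Y / (Y\<^sup>2 + v\<^sup>2)\<close> are absorbed by increments of \<open>arctan\<close>, which add up to at most \<open>\<pi>\<close> however many
  steps are taken.\<close>

lemma arctan_step:
  fixes Y v :: real
  assumes "Y \<ge> 1"
  shows "Y / (Y\<^sup>2 + v\<^sup>2) \<le> 4 * (arctan ((v + 1) / Y) - arctan (v / Y))"
proof -
  have "((\<lambda>x. arctan (x / Y)) has_real_derivative Y / (Y\<^sup>2 + x\<^sup>2)) (at x)" for x
    using assms by (auto intro!: derivative_eq_intros simp: field_simps power2_eq_square)
  then obtain x where x: "v < x" "x < v + 1"
    and eq: "arctan ((v + 1) / Y) - arctan (v / Y) = Y / (Y\<^sup>2 + x\<^sup>2)"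
    using MVT2[of v "v + 1" "\<lambda>x. arctan (x / Y)" "\<lambda>x. Y / (Y\<^sup>2 + x\<^sup>2)"] by auto
  have Y1: "1 \<le> Y\<^sup>2" using assms by (simp add: one_le_power)
  have xx: "x\<^sup>2 \<le> 2 * v\<^sup>2 + 2"
  proof -
    have "(x - v)\<^sup>2 \<le> 1" using x by (simp add: power_le_one)
    moreover have "0 \<le> (x - 2 * v)\<^sup>2" by simp
    ultimately show ?thesis by (simp add: power2_eq_square algebra_simps)
  qed
  have "Y\<^sup>2 + x\<^sup>2 \<le> 4 * (Y\<^sup>2 + v\<^sup>2)"
    using xx Y1 by (smt (verit) zero_le_power2)
  then have "Y / (4 * (Y\<^sup>2 + v\<^sup>2)) \<le> Y / (Y\<^sup>2 + x\<^sup>2)"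
    using assms Y1 by (intro divide_left_mono mult_pos_pos) (auto intro: add_pos_nonneg)
  moreover have "Y / Z = 4 * (Y / (4 * Z))" for Z by simp
  ultimately show ?thesis unfolding eq by (metis mult_left_mono zero_le_numeral)
qed

lemma ln_step:
  fixes Y v :: real
  assumes "Y \<ge> 1"
  shows "\<bar>(ln (Y\<^sup>2 + (v + 1)\<^sup>2) / 2 - ln (Y\<^sup>2 + v\<^sup>2) / 2) - v / (Y\<^sup>2 + v\<^sup>2)\<bar> \<le> 3 * (Y / (Y\<^sup>2 + v\<^sup>2))"
proof -
  have pos: "0 < Y\<^sup>2 + x\<^sup>2" for x using assms by (simp add: add_pos_nonneg)
  have "((\<lambda>x. ln (Y\<^sup>2 + x\<^sup>2) / 2) has_real_derivative x / (Y\<^sup>2 + x\<^sup>2)) (at x)" for x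
  proof -
    have "((\<lambda>x. ln (Y\<^sup>2 + x\<^sup>2)) has_real_derivative (2 * x) / (Y\<^sup>2 + x\<^sup>2)) (at x)"
      by (auto intro!: derivative_eq_intros simp: pos)
    moreover have "2 * x / m / 2 = x / m" for m :: real by simp
    ultimately show ?thesis using DERIV_cdivide[of _ _ _ _ 2] by metis
  qed
  then obtain x where x: "v < x" "x < v + 1"
    and eq: "ln (Y\<^sup>2 + (v + 1)\<^sup>2) / 2 - ln (Y\<^sup>2 + v\<^sup>2) / 2 = x / (Y\<^sup>2 + x\<^sup>2)"
    using MVT2[of v "v + 1" "\<lambda>x. ln (Y\<^sup>2 + x\<^sup>2) / 2" "\<lambda>x. x / (Y\<^sup>2 + x\<^sup>2)"] by auto
  have Y1: "1 \<le> Y\<^sup>2" using assms by (simp add: one_le_power)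
  have d: "x / (Y\<^sup>2 + x\<^sup>2) - v / (Y\<^sup>2 + v\<^sup>2) = (x - v) * (Y\<^sup>2 - x * v) / ((Y\<^sup>2 + x\<^sup>2) * (Y\<^sup>2 + v\<^sup>2))"
  proof -
    have "x * (Y\<^sup>2 + v\<^sup>2) - v * (Y\<^sup>2 + x\<^sup>2) = (x - v) * (Y\<^sup>2 - x * v)"
      by (simp add: power2_eq_square algebra_simps)
    then show ?thesis
      using pos[of x] pos[of v] by (metis diff_frac_eq less_irrefl)
  qed
  have "\<bar>x * v\<bar> \<le> 2 * x\<^sup>2 + 1"
  proof -
    have "\<bar>v\<bar> \<le> \<bar>x\<bar> + 1" using x by linarith
    then have "\<bar>x\<bar> * \<bar>v\<bar> \<le> \<bar>x\<bar> * (\<bar>x\<bar> + 1)" by (intro mult_left_mono) auto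
    moreover have "\<bar>x\<bar> * (\<bar>x\<bar> + 1) \<le> 2 * x\<^sup>2 + 1"
      using zero_le_power2[of "\<bar>x\<bar> - 1"] by (simp add: power2_eq_square algebra_simps)
    ultimately show ?thesis by (simp add: abs_mult)
  qed
  then have "\<bar>Y\<^sup>2 - x * v\<bar> \<le> 3 * (Y\<^sup>2 + x\<^sup>2)" using Y1 by (smt (verit) zero_le_power2)
  moreover have "\<bar>x - v\<bar> \<le> 1" using x by simp
  ultimately have "\<bar>x - v\<bar> * \<bar>Y\<^sup>2 - x * v\<bar> \<le> 1 * (3 * (Y\<^sup>2 + x\<^sup>2))" by (intro mult_mono) auto
  then have "\<bar>(x - v) * (Y\<^sup>2 - x * v)\<bar> / ((Y\<^sup>2 + x\<^sup>2) * (Y\<^sup>2 + v\<^sup>2))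
      \<le> (3 * (Y\<^sup>2 + x\<^sup>2)) / ((Y\<^sup>2 + x\<^sup>2) * (Y\<^sup>2 + v\<^sup>2))"
    using pos by (intro divide_right_mono) (auto simp: abs_mult less_imp_le)
  also have "\<dots> = 3 / (Y\<^sup>2 + v\<^sup>2)"
  proof -
    have "(3 * A) / (A * B) = 3 / B" if "A \<noteq> 0" for A B :: real using that by simp
    then show ?thesis using pos[of x] by (metis less_irrefl)
  qed
  also have "\<dots> \<le> 3 * (Y / (Y\<^sup>2 + v\<^sup>2))" using assms pos[of v] by (simp add: divide_right_mono)
  finally have "\<bar>(x - v) * (Y\<^sup>2 - x * v)\<bar> / ((Y\<^sup>2 + x\<^sup>2) * (Y\<^sup>2 + v\<^sup>2)) \<le> 3 * (Y / (Y\<^sup>2 + v\<^sup>2))" .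
  moreover have "\<bar>(x - v) * (Y\<^sup>2 - x * v) / ((Y\<^sup>2 + x\<^sup>2) * (Y\<^sup>2 + v\<^sup>2))\<bar>
      = \<bar>(x - v) * (Y\<^sup>2 - x * v)\<bar> / ((Y\<^sup>2 + x\<^sup>2) * (Y\<^sup>2 + v\<^sup>2))"
    using pos[of x] pos[of v] by (simp add: abs_mult)
  ultimately show ?thesis unfolding eq d by simp
qed

text \<open>A bound for \<open>\<bar>1 + x\<bar>\<close> that is exact to first order and needs no smallness of \<open>x\<close>.\<close>

lemma norm_one_plus_le_exp: "norm (1 + x :: complex) \<le> exp (Re x + (norm x)\<^sup>2 / 2)"
proof -
  have "(norm (1 + x))\<^sup>2 = 1 + (2 * Re x + (norm x)\<^sup>2)"
    by (simp only: cmod_power2) (simp add: power2_eq_square algebra_simps)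
  also have "\<dots> \<le> exp (2 * Re x + (norm x)\<^sup>2)" by (rule exp_ge_add_one_self)
  also have "\<dots> = (exp (Re x + (norm x)\<^sup>2 / 2))\<^sup>2"
    by (simp add: power2_eq_square flip: exp_add)
  finally show ?thesis by (rule power2_le_imp_le) simp
qed

lemma sqrt_msize_le:
  assumes "\<delta> > 0" "\<delta> \<le> norm (\<alpha> + s)"
  shows "sqrt (msize s) \<le> ((1 + 2 * norm \<alpha>) / \<delta> + 2) * norm (\<alpha> + s)"
proof -
  have "sqrt (msize s) \<le> (1 + \<bar>Im s\<bar>) + \<bar>Re s\<bar>" unfolding msize_def
    by (intro real_le_lsqrt) (auto simp: power2_sum)
  also have "\<dots> \<le> 1 + 2 * norm s"
    using abs_Re_le_cmod[of s] abs_Im_le_cmod[of s] by simp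
  also have "\<dots> \<le> (1 + 2 * norm \<alpha>) + 2 * norm (\<alpha> + s)"
    using norm_triangle_ineq4[of "\<alpha> + s" \<alpha>] by simp
  also have "\<dots> \<le> (1 + 2 * norm \<alpha>) / \<delta> * norm (\<alpha> + s) + 2 * norm (\<alpha> + s)"
  proof -
    have "(1 + 2 * norm \<alpha>) / \<delta> * \<delta> \<le> (1 + 2 * norm \<alpha>) / \<delta> * norm (\<alpha> + s)"
      using assms by (intro mult_left_mono) auto
    then show ?thesis using assms by simp
  qed
  finally show ?thesis by (simp add: algebra_simps)
qed

text \<open>One factor of the product. Since \<open>(\<beta> + u) / (\<alpha> + u) = 1 + x\<close> with \<open>x = (\<beta> - \<alpha>) / (\<alpha> + u)\<close> and \<open>1 / (\<alpha> + u)\<close> differs from the real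
  number \<open>v / (Y\<^sup>2 + v\<^sup>2)\<close> by an error that \<open>arctan\<close> absorbs, only the real part of \<open>\<beta> - \<alpha>\<close> matters to first order. This is where
  the distance \<open>\<delta>\<close> from the pole enters.\<close>

lemma gamma_ratio_step:
  fixes \<alpha> \<beta> :: complex and \<delta> :: real
  assumes "\<delta> > 0"
  shows "\<exists>K\<ge>0. \<forall>u. \<delta> \<le> norm (\<alpha> + u) \<longrightarrow>
    norm ((\<beta> + u) / (\<alpha> + u)) \<le>
      exp (Re (\<beta> - \<alpha>) * (ln (msize (u + 1)) / 2 - ln (msize u) / 2)
        + K * (arctan (Re (u + 1) / (1 + \<bar>Im u\<bar>)) - arctan (Re u / (1 + \<bar>Im u\<bar>))))"
proof -
  define c where "c = \<beta> - \<alpha>"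
  (* K1 compares the size of u with the distance from the pole; K2 collects the second-order errors. *)
  define K1 where "K1 = (1 + 2 * norm \<alpha>) / \<delta> + 2"
  define K2 where "K2 = norm c * (K1 * (2 + norm \<alpha>)) + (norm c * K1)\<^sup>2 / 2"
  define K where "K = 4 * (K2 + 3 * \<bar>Re c\<bar>)"
  have K1: "K1 \<ge> 0" using assms by (simp add: K1_def)
  have K2: "K2 \<ge> 0" using K1 by (simp add: K2_def)
  have "norm ((\<beta> + u) / (\<alpha> + u)) \<le> exp (Re c * (ln (msize (u + 1)) / 2 - ln (msize u) / 2)
        + K * (arctan (Re (u + 1) / (1 + \<bar>Im u\<bar>)) - arctan (Re u / (1 + \<bar>Im u\<bar>))))"
    if du: "\<delta> \<le> norm (\<alpha> + u)" for u
  proof -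
    define Y v M where "Y = 1 + \<bar>Im u\<bar>" and "v = Re u" and "M = msize u"
    have Y: "Y \<ge> 1" by (simp add: Y_def)
    have M: "M = Y\<^sup>2 + v\<^sup>2" by (simp add: M_def msize_def Y_def v_def)
    have Mpos: "M \<ge> 1" using msize_ge_1 by (simp add: M_def)
    have M1: "msize (u + 1) = Y\<^sup>2 + (v + 1)\<^sup>2" by (simp add: msize_def Y_def v_def)
    have nz: "\<alpha> + u \<noteq> 0" using du assms by auto
    have vM: "\<bar>v\<bar> \<le> sqrt M" and YM: "Y \<le> sqrt M"
      using Y by (auto simp: M intro: real_le_rsqrt)
    have sM: "sqrt M \<le> K1 * norm (\<alpha> + u)"
      using sqrt_msize_le[OF assms du] by (simp add: M_def K1_def)
    have sMpos: "sqrt M > 0" using Mpos by simp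
    have inv: "1 / norm (\<alpha> + u) \<le> K1 / sqrt M"
      using sM sMpos nz by (simp add: field_simps)
    have e: "1 / (\<alpha> + u) - of_real (v / M) = (of_real M - of_real v * (\<alpha> + u)) / (of_real M * (\<alpha> + u))"
      using nz Mpos by (simp add: field_simps)
    have num: "norm (of_real M - of_real v * (\<alpha> + u)) \<le> (2 + norm \<alpha>) * Y * sqrt M"
    proof -
      have "of_real M - of_real v * (\<alpha> + u) = of_real (Y\<^sup>2) - of_real v * (\<alpha> + \<i> * of_real (Im u))"
        by (simp add: complex_eq_iff M v_def power2_eq_square algebra_simps)
      also have "norm \<dots> \<le> norm (of_real (Y\<^sup>2) :: complex) + norm (of_real v * (\<alpha> + \<i> * of_real (Im u)))"
        by (rule norm_triangle_ineq4)
      also have "\<dots> \<le> Y\<^sup>2 + \<bar>v\<bar> * (norm \<alpha> + \<bar>Im u\<bar>)"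
        using norm_triangle_ineq[of \<alpha> "\<i> * of_real (Im u)"]
        by (simp only: norm_mult norm_of_real norm_ii mult_1 abs_of_nonneg[OF zero_le_power2])
           (intro add_left_mono mult_left_mono, auto)
      also have "\<dots> \<le> Y * sqrt M + sqrt M * (norm \<alpha> * Y + Y)"
      proof (intro add_mono mult_mono vM)
        show "Y\<^sup>2 \<le> Y * sqrt M" using YM Y by (simp add: power2_eq_square)
        show "norm \<alpha> \<le> norm \<alpha> * Y" using Y by (simp add: mult_le_cancel_left1)
        show "\<bar>Im u\<bar> \<le> Y" by (simp add: Y_def)
      qed (use sMpos in auto)
      also have "\<dots> = (2 + norm \<alpha>) * Y * sqrt M" by (simp add: algebra_simps)
      finally show ?thesis .
    qed
    have diff: "norm (1 / (\<alpha> + u) - of_real (v / M)) \<le> K1 * (2 + norm \<alpha>) * (Y / M)"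
    proof -
      have "norm (1 / (\<alpha> + u) - of_real (v / M))
          = norm (of_real M - of_real v * (\<alpha> + u)) * (1 / norm (\<alpha> + u)) / M"
        unfolding e using Mpos by (simp add: norm_divide norm_mult)
      also have "\<dots> \<le> ((2 + norm \<alpha>) * Y * sqrt M) * (K1 / sqrt M) / M"
        using num inv Mpos Y by (intro divide_right_mono mult_mono) auto
      also have "\<dots> = K1 * (2 + norm \<alpha>) * (Y / M)" using sMpos by simp
      finally show ?thesis .
    qed
    define x where "x = c / (\<alpha> + u)"
    have x1: "(\<beta> + u) / (\<alpha> + u) = 1 + x" using nz by (simp add: x_def c_def field_simps)
    have "Re x - Re c * (v / M) = Re (c * (1 / (\<alpha> + u) - of_real (v / M)))"
      by (simp add: x_def algebra_simps)
    also have "\<dots> \<le> norm (c * (1 / (\<alpha> + u) - of_real (v / M)))" by (rule complex_Re_le_cmod)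
    also have "\<dots> \<le> norm c * (K1 * (2 + norm \<alpha>) * (Y / M))"
      unfolding norm_mult by (intro mult_left_mono diff) auto
    finally have rex: "Re x \<le> Re c * (v / M) + norm c * (K1 * (2 + norm \<alpha>)) * (Y / M)"
      by (simp add: algebra_simps)
    have nx: "(norm x)\<^sup>2 \<le> (norm c * K1)\<^sup>2 * (Y / M)"
    proof -
      have "norm x = norm c * (1 / norm (\<alpha> + u))" by (simp add: x_def norm_divide)
      also have "\<dots> \<le> norm c * (K1 / sqrt M)" by (intro mult_left_mono inv) auto
      finally have "(norm x)\<^sup>2 \<le> (norm c * (K1 / sqrt M))\<^sup>2" by (intro power_mono) auto
      also have "\<dots> = (norm c * K1)\<^sup>2 * (1 / M)" using Mpos by (simp add: power_mult_distrib power_divide)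
      also have "\<dots> \<le> (norm c * K1)\<^sup>2 * (Y / M)" using Y Mpos by (intro mult_left_mono divide_right_mono) auto
      finally show ?thesis .
    qed
    have "Re x + (norm x)\<^sup>2 / 2 \<le> Re c * (v / M) + K2 * (Y / M)"
      using rex nx by (simp add: K2_def algebra_simps)
    also have "\<dots> \<le> Re c * (ln (msize (u + 1)) / 2 - ln (msize u) / 2) + (K2 + 3 * \<bar>Re c\<bar>) * (Y / M)"
    proof -
      define D where "D = ln (msize (u + 1)) / 2 - ln (msize u) / 2"
      have "\<bar>D - v / M\<bar> \<le> 3 * (Y / M)"
        using ln_step[OF Y, of v] unfolding D_def M1 M_def[symmetric] by (simp add: M)
      then have "\<bar>Re c * (D - v / M)\<bar> \<le> \<bar>Re c\<bar> * (3 * (Y / M))"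
        unfolding abs_mult by (intro mult_left_mono) auto
      then have "Re c * (v / M) \<le> Re c * D + \<bar>Re c\<bar> * (3 * (Y / M))" by (simp add: algebra_simps abs_le_iff)
      then show ?thesis unfolding D_def by (simp add: algebra_simps)
    qed
    also have "\<dots> \<le> Re c * (ln (msize (u + 1)) / 2 - ln (msize u) / 2)
        + (K2 + 3 * \<bar>Re c\<bar>) * (4 * (arctan ((v + 1) / Y) - arctan (v / Y)))"
      using arctan_step[OF Y, of v] K2 by (intro add_left_mono mult_left_mono) (auto simp: M)
    finally have "exp (Re x + (norm x)\<^sup>2 / 2) \<le> exp (Re c * (ln (msize (u + 1)) / 2 - ln (msize u) / 2)
        + K * (arctan (Re (u + 1) / (1 + \<bar>Im u\<bar>)) - arctan (Re u / (1 + \<bar>Im u\<bar>))))"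
      by (simp add: K_def Y_def v_def algebra_simps)
    then show ?thesis unfolding x1 using norm_one_plus_le_exp[of x] by linarith
  qed
  moreover have "K \<ge> 0" using K2 by (simp add: K_def)
  ultimately show ?thesis unfolding c_def by blast
qed

lemma gamma_ratio_product_limit:
  fixes \<alpha> \<beta> s :: complex
  shows "(\<lambda>N. (\<Prod>k\<le>N. (\<beta> + (s + of_nat k)) / (\<alpha> + (s + of_nat k))) * exp ((\<alpha> - \<beta>) * of_real (ln (of_nat N))))
           \<longlonglongrightarrow> Gamma (\<alpha> + s) * rGamma (\<beta> + s)"
proof -
  have "(\<lambda>N. Gamma_series (\<alpha> + s) N * rGamma_series (\<beta> + s) N) \<longlonglongrightarrow> Gamma (\<alpha> + s) * rGamma (\<beta> + s)"
    by (intro tendsto_intros)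
  also have "(\<lambda>N. Gamma_series (\<alpha> + s) N * rGamma_series (\<beta> + s) N) =
      (\<lambda>N. (\<Prod>k\<le>N. (\<beta> + (s + of_nat k)) / (\<alpha> + (s + of_nat k))) * exp ((\<alpha> - \<beta>) * of_real (ln (of_nat N))))"
  proof
    fix N
    let ?e = "exp (s * of_real (ln (real N)))"
    have "exp ((\<alpha> + s) * of_real (ln (real N))) / exp ((\<beta> + s) * of_real (ln (real N)))
        = exp ((\<alpha> - \<beta>) * of_real (ln (real N)))"
      by (simp add: algebra_simps flip: exp_diff)
    then show "Gamma_series (\<alpha> + s) N * rGamma_series (\<beta> + s) N =
      (\<Prod>k\<le>N. (\<beta> + (s + of_nat k)) / (\<alpha> + (s + of_nat k))) * exp ((\<alpha> - \<beta>) * of_real (ln (of_nat N)))"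
      by (simp add: Gamma_series_def rGamma_series_def pochhammer_Suc_prod prod_dividef
          atLeast0AtMost add.assoc mult.commute field_simps)
  qed
  finally show ?thesis .
qed

text \<open>The quotient is the limit of the product in \<open>gamma_ratio_product_limit\<close>. The bounds for its factors telescope, and the
  logarithmic term at the upper end cancels the normalising power of \<open>N\<close>. In contrast to Stirling's formula in a sector, the
  result is uniform up to the negative real axis, which is where the loops run.\<close>

lemma gamma_ratio_bound:
  fixes \<alpha> \<beta> :: complex and \<delta> :: real
  assumes "\<delta> > 0"
  shows "\<exists>C>0. \<forall>s. (\<forall>l. \<delta> \<le> norm (\<alpha> + s + of_nat l)) \<longrightarrow>
    norm (Gamma (\<alpha> + s) * rGamma (\<beta> + s)) \<le> C * msize s powr (Re (\<alpha> - \<beta>) / 2)"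
proof -
  obtain K where K: "K \<ge> 0" and step: "\<And>u. \<delta> \<le> norm (\<alpha> + u) \<Longrightarrow>
    norm ((\<beta> + u) / (\<alpha> + u)) \<le>
      exp (Re (\<beta> - \<alpha>) * (ln (msize (u + 1)) / 2 - ln (msize u) / 2)
        + K * (arctan (Re (u + 1) / (1 + \<bar>Im u\<bar>)) - arctan (Re u / (1 + \<bar>Im u\<bar>))))"
    using gamma_ratio_step[OF assms, of \<alpha> \<beta>] by blast
  have "norm (Gamma (\<alpha> + s) * rGamma (\<beta> + s)) \<le> exp (K * pi) * msize s powr (Re (\<alpha> - \<beta>) / 2)"
    if ds: "\<forall>l. \<delta> \<le> norm (\<alpha> + s + of_nat l)" for s
  proof -
    define L where "L = (\<lambda>k::nat. ln (msize (s + of_nat k)) / 2)"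
    define \<theta> where "\<theta> = (\<lambda>k::nat. arctan (Re (s + of_nat k) / (1 + \<bar>Im s\<bar>)))"
    define c where "c = Re (\<beta> - \<alpha>)"
    define P where "P = (\<lambda>N. (\<Prod>k\<le>N. (\<beta> + (s + of_nat k)) / (\<alpha> + (s + of_nat k))))"
    have prod: "norm (P N) \<le> exp (c * (L (Suc N) - L 0) + K * pi)" for N
    proof -
      have "norm (P N) \<le> (\<Prod>k\<le>N. exp (c * (L (Suc k) - L k) + K * (\<theta> (Suc k) - \<theta> k)))"
        unfolding P_def prod_norm[symmetric]
      proof (intro prod_mono conjI)
        fix k
        have "\<delta> \<le> norm (\<alpha> + (s + of_nat k))" using ds by (simp add: add.assoc)
        from step[OF this]
        show "norm ((\<beta> + (s + of_nat k)) / (\<alpha> + (s + of_nat k)))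
            \<le> exp (c * (L (Suc k) - L k) + K * (\<theta> (Suc k) - \<theta> k))"
          by (simp add: L_def \<theta>_def c_def add.assoc add.commute[of 1])
      qed auto
      also have "\<dots> = exp (\<Sum>k\<le>N. c * (L (Suc k) - L k) + K * (\<theta> (Suc k) - \<theta> k))"
        by (simp add: exp_sum)
      also have "(\<Sum>k\<le>N. c * (L (Suc k) - L k) + K * (\<theta> (Suc k) - \<theta> k))
          = c * (L (Suc N) - L 0) + K * (\<theta> (Suc N) - \<theta> 0)"
        by (induction N) (simp_all add: algebra_simps)
      also have "\<dots> \<le> c * (L (Suc N) - L 0) + K * pi"
        using arctan_bounded[of "Re (s + of_nat (Suc N)) / (1 + \<bar>Im s\<bar>)"]
          arctan_bounded[of "Re (s + of_nat 0) / (1 + \<bar>Im s\<bar>)"] K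
        by (intro add_left_mono mult_left_mono) (auto simp: \<theta>_def)
      finally show ?thesis by simp
    qed
    have lim1: "(\<lambda>N. L (Suc N) - ln (real N)) \<longlonglongrightarrow> 0"
    proof -
      define Y v where "Y = 1 + \<bar>Im s\<bar>" and "v = Re s"
      have "(\<lambda>N::nat. ln (Y\<^sup>2 + (v + real (Suc N))\<^sup>2) / 2 - ln (real N)) \<longlonglongrightarrow> 0"
        by real_asymp
      then show ?thesis by (simp add: L_def msize_def Y_def v_def)
    qed
    have l1: "(\<lambda>N. norm (P N * exp ((\<alpha> - \<beta>) * of_real (ln (of_nat N))))) \<longlonglongrightarrow> norm (Gamma (\<alpha> + s) * rGamma (\<beta> + s))"
      unfolding P_def by (intro tendsto_norm gamma_ratio_product_limit)
    have l2: "(\<lambda>N. exp (c * (L (Suc N) - ln (real N)) + (K * pi - c * L 0))) \<longlonglongrightarrow> exp (c * 0 + (K * pi - c * L 0))"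
      by (intro tendsto_intros lim1)
    have l3: "norm (P N * exp ((\<alpha> - \<beta>) * of_real (ln (of_nat N)))) \<le> exp (c * (L (Suc N) - ln (real N)) + (K * pi - c * L 0))" for N
    proof -
      have "norm (P N * exp ((\<alpha> - \<beta>) * of_real (ln (of_nat N)))) = norm (P N) * exp (- c * ln (real N))"
        by (simp add: norm_mult c_def)
      also have "\<dots> \<le> exp (c * (L (Suc N) - L 0) + K * pi) * exp (- c * ln (real N))"
        by (intro mult_right_mono prod) auto
      finally show ?thesis by (simp add: algebra_simps flip: exp_add)
    qed
    have "norm (Gamma (\<alpha> + s) * rGamma (\<beta> + s)) \<le> exp (c * 0 + (K * pi - c * L 0))"
      by (rule LIMSEQ_le[OF l1 l2]) (use l3 in blast)
    also have "\<dots> = exp (K * pi) * msize s powr (Re (\<alpha> - \<beta>) / 2)"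
    proof -
      have "c * 0 + (K * pi - c * L 0) = K * pi + Re (\<alpha> - \<beta>) / 2 * ln (msize s)"
        by (simp add: L_def c_def field_simps)
      then show ?thesis using msize_ge_1[of s] by (simp only: exp_add) (simp add: powr_def)
    qed
    finally show ?thesis .
  qed
  then show ?thesis by (intro exI[of _ "exp (K * pi)"]) auto
qed

section \<open>Discrete sets and left loops\<close>

definition locally_finite_set :: "complex set \<Rightarrow> bool" where
  "locally_finite_set S \<longleftrightarrow> (\<forall>z r. finite (S \<inter> cball z r))"

lemma locally_finite_set_subset: "locally_finite_set S \<Longrightarrow> T \<subseteq> S \<Longrightarrow> locally_finite_set T"
  unfolding locally_finite_set_def by (meson Int_mono finite_subset order_refl)

lemma locally_finite_set_closed:
  assumes "locally_finite_set S" shows "closed S"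
proof -
  have "\<not> x islimpt S" for x
  proof
    assume "x islimpt S"
    then have "infinite (S \<inter> ball x 1)" by (simp add: islimpt_eq_infinite_ball)
    moreover have "finite (S \<inter> cball x 1)" using assms by (simp add: locally_finite_set_def)
    then have "finite (S \<inter> ball x 1)" by (rule finite_subset[rotated]) auto
    ultimately show False by simp
  qed
  then show ?thesis by (simp add: closed_limpt)
qed

text \<open>The radius works for every centre, in the set or not.\<close>

lemma locally_finite_set_isolated:
  assumes "locally_finite_set S"
  obtains r where "r > 0" "\<And>w. w \<in> S \<Longrightarrow> w \<noteq> z \<Longrightarrow> r < dist z w"
proof -
  have "finite (S \<inter> cball z 1)" using assms by (simp add: locally_finite_set_def)
  then obtain d where d: "d > 0" "\<forall>x\<in>S \<inter> cball z 1. x \<noteq> z \<longrightarrow> d \<le> dist z x"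
    using finite_set_avoid by blast
  show ?thesis
  proof (rule that[of "min d 1 / 2"])
    show "min d 1 / 2 < dist z w" if "w \<in> S" "w \<noteq> z" for w
      using d that by (cases "dist z w \<le> 1") (auto simp: min_def)
  qed (use d in auto)
qed

lemma locally_finite_set_countable:
  assumes "locally_finite_set S" shows "countable S"
proof -
  have "S = (\<Union>n::nat. S \<inter> cball 0 (real n))"
    by (auto simp: real_arch_simple)
  moreover have "countable (\<Union>n::nat. S \<inter> cball 0 (real n))"
    using assms by (intro countable_UN) (auto simp: locally_finite_set_def intro: countable_finite)
  ultimately show ?thesis by simp
qed

lemma integer_translates_locally_finite:
  assumes "finite T"
  shows "locally_finite_set {d + of_int k | d k. d \<in> T}"
  unfolding locally_finite_set_def
proof (intro allI)
  fix z :: complex and r :: real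
  have "finite ((\<lambda>k. d + of_int k) ` {- \<lceil>norm d + norm z + r\<rceil>..\<lceil>norm d + norm z + r\<rceil>})" for d :: complex
    by simp
  then have "finite (\<Union>d\<in>T. (\<lambda>k. d + of_int k) ` {- \<lceil>norm d + norm z + r\<rceil>..\<lceil>norm d + norm z + r\<rceil>})"
    using assms by blast
  moreover have "{d + of_int k | d k. d \<in> T} \<inter> cball z r \<subseteq>
     (\<Union>d\<in>T. (\<lambda>k. d + of_int k) ` {- \<lceil>norm d + norm z + r\<rceil>..\<lceil>norm d + norm z + r\<rceil>})"
  proof
    fix w assume "w \<in> {d + of_int k | d k. d \<in> T} \<inter> cball z r"
    then obtain d k where w: "d \<in> T" "w = d + of_int k" "dist z w \<le> r" by auto
    have "\<bar>real_of_int k\<bar> = norm (w - d)" using w by simp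
    also have "\<dots> = norm ((w - z) + z - d)" by simp
    also have "\<dots> \<le> norm (w - z) + norm z + norm d" by norm
    also have "\<dots> \<le> norm d + norm z + r" using w by (simp add: dist_norm norm_minus_commute)
    finally have "k \<in> {- \<lceil>norm d + norm z + r\<rceil>..\<lceil>norm d + norm z + r\<rceil>}"
      by (simp add: abs_le_iff) linarith
    then show "w \<in> (\<Union>d\<in>T. (\<lambda>k. d + of_int k) ` {- \<lceil>norm d + norm z + r\<rceil>..\<lceil>norm d + norm z + r\<rceil>})"
      using w by blast
  qed
  ultimately show "finite ({d + of_int k | d k. d \<in> T} \<inter> cball z r)"
    by (rule finite_subset[rotated])
qed

text \<open>The complement of a discrete set is connected. So one can walk from \<open>z0\<close> to a small circle around each of the given points
  and back the same way, and only the circles count for the winding numbers.\<close>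

lemma loop_around_finite_set:
  assumes S: "locally_finite_set S" and z0: "z0 \<notin> S" and "finite P" "P \<subseteq> S"
  shows "\<exists>\<gamma>. valid_path \<gamma> \<and> pathstart \<gamma> = z0 \<and> pathfinish \<gamma> = z0 \<and> path_image \<gamma> \<subseteq> - S \<and>
    (\<forall>w\<in>S. winding_number \<gamma> w = (if w \<in> P then 1 else 0))"
  using assms(3,4)
proof (induction P rule: finite_induct)
  case empty
  then show ?case using z0 by (intro exI[of _ "linepath z0 z0"] conjI ballI)
      (auto simp del: linepath_trivial intro!: winding_number_trivial)
next
  case (insert w P)
  then obtain \<gamma> where \<gamma>: "valid_path \<gamma>" "pathstart \<gamma> = z0" "pathfinish \<gamma> = z0" "path_image \<gamma> \<subseteq> - S"
    "\<And>v. v \<in> S \<Longrightarrow> winding_number \<gamma> v = (if v \<in> P then 1 else 0)" by auto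
  obtain r where r: "r > 0" "\<And>v. v \<in> S \<Longrightarrow> v \<noteq> w \<Longrightarrow> r < dist w v"
    using locally_finite_set_isolated[OF S] by blast
  have circ: "path_image (circlepath w r) \<subseteq> - S"
    using r by (auto simp: sphere_def) force
  have conn: "connected (- S)"
    using locally_finite_set_countable[OF S]
    by (intro path_connected_imp_connected path_connected_complement_countable) auto
  have "w + of_real r \<notin> S"
    using circ by (metis ComplD pathstart_circlepath pathstart_in_path_image subsetD)
  then obtain p where p: "polynomial_function p" "path_image p \<subseteq> - S" "pathstart p = z0" "pathfinish p = w + of_real r"
    using connected_open_polynomial_connected[of "- S" z0 "w + of_real r"] conn
      locally_finite_set_closed[OF S] z0 by (auto simp: open_Compl)
  have vp: "valid_path p" using p(1) by (rule valid_path_polynomial_function)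
  let ?\<gamma> = "\<gamma> +++ (p +++ (circlepath w r +++ reversepath p))"
  have "winding_number ?\<gamma> v = (if v \<in> insert w P then 1 else 0)" if v: "v \<in> S" for v
  proof -
    have nin: "v \<notin> path_image \<gamma>" "v \<notin> path_image p" "v \<notin> path_image (circlepath w r)"
      using v \<gamma>(4) p(2) circ by auto
    have "winding_number ?\<gamma> v = winding_number \<gamma> v + (winding_number p v
        + (winding_number (circlepath w r) v + winding_number (reversepath p) v))"
      using nin vp \<gamma>(1,2,3) p(3,4)
      by (subst winding_number_join winding_number_reversepath; simp add: valid_path_imp_path not_in_path_image_join)+
    also have "winding_number (reversepath p) v = - winding_number p v"
      using vp nin by (intro winding_number_reversepath) (auto simp: valid_path_imp_path)
    also have "winding_number (circlepath w r) v = (if v = w then 1 else 0)"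
    proof (cases "v = w")
      case False
      then have "v \<notin> cball w r" using r(2)[OF v] by auto
      then have "winding_number (circlepath w r) v = 0"
        using r by (intro winding_number_zero_outside[of _ "cball w r"]) auto
      then show ?thesis using False by simp
    qed (use r in \<open>simp add: winding_number_circlepath_centre\<close>)
    finally show ?thesis using \<gamma>(5)[OF v] insert.hyps by auto
  qed
  moreover have "path_image ?\<gamma> \<subseteq> - S"
    using \<gamma>(4) p(2) circ path_image_join_subset by (auto simp: path_image_join \<gamma>(3) p(3,4))
  ultimately show ?case
    using \<gamma>(1,2,3) p(3,4) vp by (intro exI[of _ ?\<gamma>]) auto
qed

lemma winding_number_rectpath_split:
  assumes "z \<notin> path_image (rectpath a c)"
  shows "winding_number (rectpath a c) z =
    winding_number (linepath a (Complex (Re c) (Im a))) z + winding_number (linepath (Complex (Re c) (Im a)) c) z +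
    winding_number (linepath c (Complex (Re a) (Im c))) z + winding_number (linepath (Complex (Re a) (Im c)) a) z"
  using assms unfolding rectpath_def Let_def
  by (subst winding_number_join; simp add: path_image_join not_in_path_image_join)+

text \<open>Far to the left a vertical segment suffices, because it has only points of \<open>A\<close> to its left. The finitely many points of
  \<open>A\<close> that it misses may be interspersed with those of \<open>B\<close> in any manner; they are collected by a closed detour, started at
  the upper end of the segment, that winds around precisely these points.\<close>

lemma left_loop_exists:
  fixes T :: "complex set" and A B :: "complex set" and X :: real
  assumes T: "finite T" and A: "A = {d - of_nat l | d l. d \<in> T}"
    and B: "\<And>w. w \<in> B \<Longrightarrow> X < Re w"
    and lf: "locally_finite_set (A \<union> B)" and disj: "A \<inter> B = {}"
  shows "\<exists>g. left_loop g A B"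
proof -
  have "countable (Re ` A)"
    using locally_finite_set_countable[OF lf] by (intro countable_image) (auto intro: countable_subset)
  (* the abscissa of the vertical segment: to the left of B, and not that of a point of A *)
  then obtain x where x: "x \<in> {X - 1<..<X}" "x \<notin> Re ` A"
    using real_interval_avoid_countable_set[of "X - 1" X "Re ` A"] by auto
  have "bounded ((\<lambda>d. \<bar>Im d\<bar>) ` T)" using T by (intro finite_imp_bounded) auto
  then obtain h0 where "\<forall>y\<in>(\<lambda>d. \<bar>Im d\<bar>) ` T. norm y \<le> h0" unfolding bounded_iff by blast
  then have h0: "\<And>d. d \<in> T \<Longrightarrow> \<bar>Im d\<bar> \<le> h0" by auto
  define h where "h = max h0 0 + 1"
  have h: "h > 0" "\<And>w. w \<in> A \<Longrightarrow> \<bar>Im w\<bar> < h"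
    using h0 unfolding A h_def by fastforce+
  define p q where "p = Complex x (- h)" and "q = Complex x h"
  have segs: "w \<notin> closed_segment (p - of_real R) p" "w \<notin> closed_segment p q" "w \<notin> closed_segment q (q - of_real R)"
    if w: "w \<in> A \<union> B" and R: "R \<ge> 0" for w R
  proof -
    have s1: "Im z = - h \<and> Re z \<le> x" if "z \<in> closed_segment (p - of_real R) p" for z
      using that R by (auto simp: p_def closed_segment_same_Im closed_segment_eq_real_ivl split: if_splits)
    have s2: "Re z = x" if "z \<in> closed_segment p q" for z
      using that by (auto simp: p_def q_def closed_segment_same_Re)
    have s3: "Im z = h \<and> Re z \<le> x" if "z \<in> closed_segment q (q - of_real R)" for z
      using that R by (auto simp: q_def closed_segment_same_Im closed_segment_eq_real_ivl split: if_splits)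
    show "w \<notin> closed_segment (p - of_real R) p" using s1[of w] w h x B by fastforce
    show "w \<notin> closed_segment p q" using s2[of w] w x B by fastforce
    show "w \<notin> closed_segment q (q - of_real R)" using s3[of w] w h x B by fastforce
  qed
  define P where "P = {w \<in> A. x < Re w}"
  have "finite P"
  proof -
    have "P \<subseteq> (\<Union>d\<in>T. (\<lambda>l. d - of_nat l) ` {..nat \<lceil>Re d - x\<rceil>})"
    proof
      fix w assume "w \<in> P"
      then obtain d l where "d \<in> T" "w = d - of_nat l" "x < Re d - real l" by (auto simp: P_def A)
      moreover from this have "l \<le> nat \<lceil>Re d - x\<rceil>" by linarith
      ultimately show "w \<in> (\<Union>d\<in>T. (\<lambda>l. d - of_nat l) ` {..nat \<lceil>Re d - x\<rceil>})" by blast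
    qed
    then show ?thesis using T by (auto intro: finite_subset)
  qed
  have "q \<notin> A \<union> B" using segs(2)[of q 0] by auto
  then obtain \<gamma> where \<gamma>: "valid_path \<gamma>" "pathstart \<gamma> = q" "pathfinish \<gamma> = q" "path_image \<gamma> \<subseteq> - (A \<union> B)"
    "\<And>w. w \<in> A \<union> B \<Longrightarrow> winding_number \<gamma> w = (if w \<in> P then 1 else 0)"
    using loop_around_finite_set[OF lf _ \<open>finite P\<close>, of q] by (metis P_def Un_iff mem_Collect_eq subsetI)
  define g where "g = linepath p q +++ \<gamma>"
  have g: "valid_path g" "pathstart g = p" "pathfinish g = q" using \<gamma> by (auto simp: g_def)
  have img: "path_image (loop_trunc g R) \<inter> (A \<union> B) = {}" if "R \<ge> 0" for R
    using segs[OF _ that] \<gamma>(2,3,4) unfolding loop_trunc_def g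
    by (auto simp: path_image_join g g_def)
  have wn: "winding_number (loop_closed g R) w = winding_number (rectpath (p - of_real R) q) w + winding_number \<gamma> w"
    if w: "w \<in> A \<union> B" and R: "R \<ge> 0" "Re w \<noteq> x - R" for w R
  proof -
    have c: "Complex (Re q) (Im (p - of_real R)) = p" "Complex (Re (p - of_real R)) (Im q) = q - of_real R"
      by (auto simp: p_def q_def complex_eq_iff)
    have n4: "w \<notin> closed_segment (q - of_real R) (p - of_real R)"
      using R(2) by (auto simp: p_def q_def closed_segment_same_Re)
    have n5: "w \<notin> path_image \<gamma>" using w \<gamma>(4) by auto
    note n = segs[OF w R(1)] n4 n5
    have "w \<notin> path_image (rectpath (p - of_real R) q)"
      using n unfolding rectpath_def Let_def c by (simp add: not_in_path_image_join)
    from winding_number_rectpath_split[OF this]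
    have rect: "winding_number (rectpath (p - of_real R) q) w = winding_number (linepath (p - of_real R) p) w
      + winding_number (linepath p q) w + winding_number (linepath q (q - of_real R)) w
      + winding_number (linepath (q - of_real R) (p - of_real R)) w" unfolding c .
    have "winding_number (loop_closed g R) w = (winding_number (linepath (p - of_real R) p) w
      + ((winding_number (linepath p q) w + winding_number \<gamma> w) + winding_number (linepath q (q - of_real R)) w))
      + winding_number (linepath (q - of_real R) (p - of_real R)) w"
      unfolding loop_closed_def loop_trunc_def g g_def using n \<gamma>(1,2,3)
      by (subst winding_number_join; simp add: not_in_path_image_join valid_path_imp_path)+
    then show ?thesis unfolding rect by simp
  qed
  have "\<forall>\<^sub>F R in at_top. winding_number (loop_closed g R) w = 1" if w: "w \<in> A" for w
    using eventually_gt_at_top[of "max 0 (x - Re w)"]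
  proof eventually_elim
    case (elim R)
    have "winding_number (rectpath (p - of_real R) q) w = (if w \<in> P then 0 else 1)"
    proof (cases "w \<in> P")
      case True
      then show ?thesis using elim h
        by (subst winding_number_rectpath_outside) (auto simp: p_def q_def P_def in_cbox_complex_iff)
    next
      case False
      have "Re w \<noteq> x" using w x by auto
      then have "Re w < x" using False w by (auto simp: P_def)
      then show ?thesis using elim h(2)[OF w] False
        by (subst winding_number_rectpath) (auto simp: p_def q_def in_box_complex_iff)
    qed
    then show ?case using wn[of w R] elim w \<gamma>(5)[of w] by auto
  qed
  moreover have "\<forall>\<^sub>F R in at_top. winding_number (loop_closed g R) w = 0" if w: "w \<in> B" for w
    using eventually_gt_at_top[of "0::real"]
  proof eventually_elim
    case (elim R)
    have "x < Re w" using B[OF w] x by simp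
    then have "winding_number (rectpath (p - of_real R) q) w = 0"
      using elim h by (subst winding_number_rectpath_outside) (auto simp: p_def q_def in_cbox_complex_iff)
    moreover have "w \<notin> P" using disj w by (auto simp: P_def)
    ultimately show ?case using wn[of w R] elim w \<gamma>(5)[of w] \<open>x < Re w\<close> by auto
  qed
  ultimately have "left_loop g A B"
    unfolding left_loop_def using img g h by (auto simp: p_def q_def)
  then show ?thesis by blast
qed

section \<open>Residue sums over translated poles\<close>

text \<open>The residue theorem for a function whose poles are the points of finitely many progressions \<open>d, d - 1, d - 2, \<dots>\<close> and
  finitely many others. The sum is written as a series although a given loop winds around finitely many of the
  poles only, so that Tannery's theorem applies to sequences of loops.\<close>

lemma contour_integral_residue_series:
  fixes T P :: "complex set" and f :: "complex \<Rightarrow> complex"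
  assumes T: "finite T" and inj: "inj_on (\<lambda>(d, l). d - of_nat l) (T \<times> (UNIV :: nat set))"
    and A: "A = {d - of_nat l | d l. d \<in> T}" and P: "finite P" "A \<inter> P = {}"
    and hol: "f holomorphic_on - (A \<union> P)"
    and \<gamma>: "valid_path \<gamma>" "pathfinish \<gamma> = pathstart \<gamma>" "path_image \<gamma> \<inter> (A \<union> P) = {}"
  shows "contour_integral \<gamma> f = 2 * pi * \<i> *
    ((\<Sum>l. \<Sum>d\<in>T. winding_number \<gamma> (d - of_nat l) * residue f (d - of_nat l)) +
     (\<Sum>p\<in>P. winding_number \<gamma> p * residue f p))"
proof -
  have "bounded (path_image \<gamma>)" using \<gamma>(1) by (simp add: bounded_path_image valid_path_imp_path)
  then obtain \<rho> where \<rho>: "path_image \<gamma> \<subseteq> ball 0 \<rho>" by (meson bounded_subset_ballD)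
  have out: "winding_number \<gamma> z = 0" if "z \<notin> ball 0 \<rho>" for z
    using \<gamma> \<rho> that by (intro winding_number_zero_outside[of _ "ball 0 \<rho>"]) (auto simp: valid_path_imp_path)
  obtain m where m: "\<And>d. d \<in> T \<Longrightarrow> norm d \<le> m"
    using finite_imp_bounded[OF T] unfolding bounded_iff by blast
  (* from the L-th members on, the progressions have left the disc that contains the loop *)
  define L where "L = nat \<lceil>\<rho> + m\<rceil>"
  have far: "d - of_nat l \<notin> ball 0 \<rho>" if "d \<in> T" "l \<ge> L" for d l
  proof -
    have "\<rho> + m \<le> real l" using that(2) unfolding L_def by linarith
    moreover have "real l \<le> norm (d - of_nat l) + norm d"
      using norm_triangle_ineq4[of d "d - of_nat l"] by simp
    ultimately show ?thesis using m[OF that(1)] by simp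
  qed
  let ?e = "\<lambda>(d, l). d - of_nat l :: complex"
  define Q where "Q = ?e ` (T \<times> {..<L})"
  have "finite (Q \<union> P)" using T P by (simp add: Q_def)
  have QA: "Q \<subseteq> A" by (auto simp: Q_def A)
  have AQ: "A \<inter> ball 0 \<rho> \<subseteq> Q"
  proof
    fix w assume w: "w \<in> A \<inter> ball 0 \<rho>"
    then obtain d l where dl: "d \<in> T" "w = d - of_nat l" by (auto simp: A)
    then have "l < L" using far w by (meson IntD2 not_le)
    then show "w \<in> Q" using dl by (auto simp: Q_def)
  qed
  have "contour_integral \<gamma> f = 2 * pi * \<i> * (\<Sum>p\<in>Q \<union> P. winding_number \<gamma> p * residue f p)"
  proof (rule Residue_theorem[where S = "ball 0 \<rho>"])
    show "f holomorphic_on ball 0 \<rho> - (Q \<union> P)"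
      using AQ by (intro holomorphic_on_subset[OF hol]) auto
    show "path_image \<gamma> \<subseteq> ball 0 \<rho> - (Q \<union> P)" using \<rho> \<gamma>(3) QA by blast
  qed (use \<gamma> out \<open>finite (Q \<union> P)\<close> in auto)
  also have "(\<Sum>p\<in>Q \<union> P. winding_number \<gamma> p * residue f p)
      = (\<Sum>p\<in>Q. winding_number \<gamma> p * residue f p) + (\<Sum>p\<in>P. winding_number \<gamma> p * residue f p)"
    using T P QA by (intro sum.union_disjoint) (auto simp: Q_def)
  also have "(\<Sum>p\<in>Q. winding_number \<gamma> p * residue f p)
      = (\<Sum>d\<in>T. \<Sum>l<L. winding_number \<gamma> (d - of_nat l) * residue f (d - of_nat l))"
    unfolding Q_def
  proof (subst sum.reindex)
    show "inj_on ?e (T \<times> {..<L})" by (rule inj_on_subset[OF inj]) auto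
  qed (simp only: sum.cartesian_product o_def case_prod_unfold)
  also have "\<dots> = (\<Sum>l<L. \<Sum>d\<in>T. winding_number \<gamma> (d - of_nat l) * residue f (d - of_nat l))"
    by (rule sum.swap)
  also have "\<dots> = (\<Sum>l. \<Sum>d\<in>T. winding_number \<gamma> (d - of_nat l) * residue f (d - of_nat l))"
    by (rule suminf_finite[symmetric]) (auto intro!: sum.neutral simp: out[OF far])
  finally show ?thesis .
qed

text \<open>Tannery's theorem for a sequence of loops that eventually winds once around each pole of the progressions. The bound on the
  winding numbers is only required for late members, where it is uniform in the loop.\<close>

lemma contour_integrals_tendsto_residue_series:
  fixes T P :: "complex set" and f :: "complex \<Rightarrow> complex" and \<gamma> :: "nat \<Rightarrow> real \<Rightarrow> complex"
  assumes T: "finite T" and inj: "inj_on (\<lambda>(d, l). d - of_nat l) (T \<times> (UNIV :: nat set))"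
    and A: "A = {d - of_nat l | d l. d \<in> T}" and P: "finite P" "A \<inter> P = {}"
    and hol: "f holomorphic_on - (A \<union> P)"
    and \<gamma>: "\<And>N. valid_path (\<gamma> N)" "\<And>N. pathfinish (\<gamma> N) = pathstart (\<gamma> N)"
      "\<And>N. path_image (\<gamma> N) \<inter> (A \<union> P) = {}"
    and wA: "\<And>w. w \<in> A \<Longrightarrow> (\<lambda>N. winding_number (\<gamma> N) w) \<longlonglongrightarrow> 1"
    and wP: "\<And>p. p \<in> P \<Longrightarrow> (\<lambda>N. winding_number (\<gamma> N) p) \<longlonglongrightarrow> \<omega> p"
    and bd: "\<And>N d l. d \<in> T \<Longrightarrow> l \<ge> L \<Longrightarrow> norm (winding_number (\<gamma> N) (d - of_nat l)) \<le> M"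
    and summ: "\<And>d. d \<in> T \<Longrightarrow> summable (\<lambda>l. norm (residue f (d - of_nat l)))"
  shows "(\<lambda>N. contour_integral (\<gamma> N) f) \<longlonglongrightarrow>
    2 * pi * \<i> * ((\<Sum>l. \<Sum>d\<in>T. residue f (d - of_nat l)) + (\<Sum>p\<in>P. \<omega> p * residue f p))"
proof -
  define a where "a = (\<lambda>l N. \<Sum>d\<in>T. winding_number (\<gamma> N) (d - of_nat l) * residue f (d - of_nat l))"
  have "(\<lambda>N. suminf (\<lambda>l. a l N)) \<longlonglongrightarrow> (\<Sum>l. \<Sum>d\<in>T. residue f (d - of_nat l))"
  proof -
    have lim: "(\<lambda>N. a l N) \<longlonglongrightarrow> (\<Sum>d\<in>T. residue f (d - of_nat l))" for l
    proof -
      have "(\<lambda>N. a l N) \<longlonglongrightarrow> (\<Sum>d\<in>T. 1 * residue f (d - of_nat l))"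
        unfolding a_def by (intro tendsto_intros wA) (auto simp: A)
      then show ?thesis by simp
    qed
    have "summable (\<lambda>l. \<Sum>d\<in>T. M * norm (residue f (d - of_nat l)))"
      by (intro summable_sum summable_mult summ)
    moreover have "eventually (\<lambda>(l, N). norm (a l N) \<le> (\<Sum>d\<in>T. M * norm (residue f (d - of_nat l))))
        (sequentially \<times>\<^sub>F sequentially)"
      unfolding eventually_prod_sequentially
    proof (intro exI[of _ L] allI impI, clarify)
      fix N l assume "l \<ge> L"
      then show "norm (a l N) \<le> (\<Sum>d\<in>T. M * norm (residue f (d - of_nat l)))"
        unfolding a_def using bd by (intro order_trans[OF norm_sum] sum_mono) (auto simp: norm_mult intro: mult_right_mono)
    qed
    ultimately show ?thesis using tannerys_theorem[of a, OF lim] by auto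
  qed
  moreover have "(\<lambda>N. \<Sum>p\<in>P. winding_number (\<gamma> N) p * residue f p) \<longlonglongrightarrow> (\<Sum>p\<in>P. \<omega> p * residue f p)"
    by (intro tendsto_sum tendsto_mult_right wP)
  ultimately have lim: "(\<lambda>N. 2 * pi * \<i> * (suminf (\<lambda>l. a l N) + (\<Sum>p\<in>P. winding_number (\<gamma> N) p * residue f p))) \<longlonglongrightarrow>
    2 * pi * \<i> * ((\<Sum>l. \<Sum>d\<in>T. residue f (d - of_nat l)) + (\<Sum>p\<in>P. \<omega> p * residue f p))"
    by (intro tendsto_mult_left[of _ _ _ "2 * pi * \<i>"] tendsto_add)
  show ?thesis
    using lim unfolding a_def using contour_integral_residue_series[OF T inj A P hol \<gamma>] by simp
qed

text \<open>Good positions of the closing segment of a loop exist only for a discrete sequence of radii; this lemma passes from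
  the sequence to the full limit.\<close>

lemma tendsto_at_top_from_unit_steps:
  fixes V :: "real \<Rightarrow> complex" and R0 :: real
  assumes lim: "(\<lambda>N. V (R0 + real N)) \<longlonglongrightarrow> L" and e: "e \<longlonglongrightarrow> 0"
    and step: "\<And>N R. R0 + real N \<le> R \<Longrightarrow> R \<le> R0 + real N + 1 \<Longrightarrow> norm (V R - V (R0 + real N)) \<le> e N"
  shows "(V \<longlongrightarrow> L) at_top"
proof -
  define n where "n = (\<lambda>R. nat \<lfloor>R - R0\<rfloor>)"
  have n: "filterlim n sequentially at_top"
    unfolding filterlim_at_top
  proof
    fix Z
    show "\<forall>\<^sub>F R in at_top. Z \<le> n R"
      using eventually_ge_at_top[of "R0 + real Z"]
      by eventually_elim (auto simp: n_def le_nat_floor)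
  qed
  have "((\<lambda>R. V R - V (R0 + real (n R))) \<longlongrightarrow> 0) at_top"
  proof (rule Lim_null_comparison)
    show "((\<lambda>R. e (n R)) \<longlongrightarrow> 0) at_top" by (rule filterlim_compose[OF e n])
    show "\<forall>\<^sub>F R in at_top. norm (V R - V (R0 + real (n R))) \<le> e (n R)"
      using eventually_ge_at_top[of R0]
    proof eventually_elim
      case (elim R)
      then show ?case unfolding n_def by (intro step) linarith+
    qed
  qed
  moreover have "((\<lambda>R. V (R0 + real (n R))) \<longlongrightarrow> L) at_top"
    by (rule filterlim_compose[OF lim n])
  ultimately show ?thesis using tendsto_add by fastforce
qed

text \<open>The setting for the Mellin transforms: \<open>F\<close> has poles in finitely many left progressions, with pairwise distinct
  members, and in a finite set \<open>B\<close>, all to the left of the line \<open>Re s = 1\<close>, and decays uniformly at any fixed distance from them.\<close>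

locale translated_poles =
  fixes T A B :: "complex set" and F :: "complex \<Rightarrow> complex" and \<epsilon> :: real
  assumes finite_T: "finite T" and inj_T: "inj_on (\<lambda>(d, l). d - of_nat l) (T \<times> (UNIV :: nat set))"
    and A_eq: "A = {d - of_nat l | d l. d \<in> T}"
    and finite_B: "finite B" and disj: "A \<inter> B = {}"
    and Re_T: "\<And>d. d \<in> T \<Longrightarrow> Re d < 1" and Re_B: "\<And>b. b \<in> B \<Longrightarrow> Re b < 1"
    and hol: "F holomorphic_on - (A \<union> B)" and eps: "\<epsilon> > 0"
    and bound: "\<And>\<delta>. \<delta> > 0 \<Longrightarrow> \<exists>C\<ge>0. \<forall>s. (\<forall>w\<in>A \<union> B. \<delta> \<le> dist s w) \<longrightarrow> norm (F s) \<le> C * (1 + norm s) powr (- \<epsilon>)"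
begin

text \<open>All integer translates of the poles. This set is still discrete, and a distance from it is invariant under
  integer shifts.\<close>

definition pole_translates where "pole_translates = {u + of_int k | u k. u \<in> T \<union> B}"

lemma poles_subset_translates: "A \<union> B \<subseteq> pole_translates"
proof
  fix w assume "w \<in> A \<union> B"
  then consider d l where "d \<in> T" "w = d - of_nat l" | "w \<in> B" by (auto simp: A_eq)
  then show "w \<in> pole_translates"
  proof cases
    case 1
    then show ?thesis unfolding pole_translates_def by (intro CollectI exI[of _ d] exI[of _ "- int l"]) auto
  next
    case 2
    then show ?thesis unfolding pole_translates_def by (intro CollectI exI[of _ w] exI[of _ "0::int"]) auto
  qed
qed

lemma T_subset_A: "d \<in> T \<Longrightarrow> d \<in> A"
  unfolding A_eq by (metis (mono_tags, lifting) diff_zero mem_Collect_eq of_nat_0)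

lemma pole_translates_locally_finite: "locally_finite_set pole_translates"
  unfolding pole_translates_def using finite_T finite_B by (intro integer_translates_locally_finite) auto

lemma pole_translates_shift: "w \<in> pole_translates \<Longrightarrow> w + of_nat N \<in> pole_translates"
  unfolding pole_translates_def by clarify (metis add.assoc of_int_add of_int_of_nat_eq)

lemma closed_poles: "closed (A \<union> B)"
  using pole_translates_locally_finite poles_subset_translates locally_finite_set_closed locally_finite_set_subset by blast

lemma F_bounded:
  assumes "\<delta> > 0"
  obtains C where "C \<ge> 0" "\<And>s. (\<And>w. w \<in> A \<union> B \<Longrightarrow> \<delta> \<le> dist s w) \<Longrightarrow> norm (F s) \<le> C"
proof -
  obtain C where C: "C \<ge> 0" "\<And>s. (\<forall>w\<in>A \<union> B. \<delta> \<le> dist s w) \<Longrightarrow> norm (F s) \<le> C * (1 + norm s) powr (- \<epsilon>)"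
    using bound[OF assms] by blast
  show ?thesis
  proof (rule that[OF C(1)])
    fix s assume "\<And>w. w \<in> A \<union> B \<Longrightarrow> \<delta> \<le> dist s w"
    then have "norm (F s) \<le> C * (1 + norm s) powr (- \<epsilon>)" using C(2) by blast
    also have "\<dots> \<le> C * 1 powr (- \<epsilon>)"
      using C(1) eps by (intro mult_left_mono powr_mono2') auto
    finally show "norm (F s) \<le> C" by simp
  qed
qed

text \<open>Discs of one common size around the poles that are disjoint from each other and stay to the left of \<open>1\<close>. Differences of
  poles lie in a discrete set, which gives the size.\<close>

lemma separation:
  obtains r \<kappa> where "r > 0" "\<kappa> < 1" "\<And>u. u \<in> A \<union> B \<Longrightarrow> Re u + 2 * r \<le> \<kappa>"
    "\<And>u w. u \<in> A \<union> B \<Longrightarrow> w \<in> A \<union> B \<Longrightarrow> u \<noteq> w \<Longrightarrow> 2 * r \<le> dist u w"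
proof -
  define D where "D = {e + of_int k | e k. e \<in> (\<lambda>(u, v). u - v) ` ((T \<union> B) \<times> (T \<union> B))}"
  have "locally_finite_set D"
    unfolding D_def using finite_T finite_B by (intro integer_translates_locally_finite) auto
  then obtain r0 where r0: "r0 > 0" "\<And>w. w \<in> D \<Longrightarrow> w \<noteq> 0 \<Longrightarrow> r0 < dist 0 w"
    using locally_finite_set_isolated by blast
  have UD: "u - w \<in> D" if uw: "u \<in> pole_translates" "w \<in> pole_translates" for u w
  proof -
    obtain u' k w' j where "u' \<in> T \<union> B" "w' \<in> T \<union> B" "u = u' + of_int k" "w = w' + of_int j"
      using uw unfolding pole_translates_def by blast
    then show ?thesis unfolding D_def
      by (intro CollectI exI[of _ "u' - w'"] exI[of _ "k - j"]) auto
  qed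
  then have sep: "r0 \<le> dist u w" if "u \<in> A \<union> B" "w \<in> A \<union> B" "u \<noteq> w" for u w
  proof -
    have "u - w \<in> D" by (rule UD) (use that poles_subset_translates in auto)
    then have "r0 < norm (u - w)" using r0(2)[of "u - w"] that by simp
    then show ?thesis by (simp add: dist_norm)
  qed
  define m where "m = Max (insert 0 (Re ` (T \<union> B)))"
  have fin: "finite (insert 0 (Re ` (T \<union> B)))" using finite_T finite_B by simp
  have m1: "m < 1" unfolding m_def using fin Re_T Re_B by (subst Max_less_iff) auto
  have m: "Re u \<le> m" if "u \<in> A \<union> B" for u
  proof -
    have "Re v \<le> m" if "v \<in> T \<union> B" for v unfolding m_def using that fin by (intro Max_ge) auto
    then show ?thesis using that unfolding A_eq by force
  qed
  (* small enough for the discs of radius 2 * r to stay to the left of 1 as well *)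
  define r where "r = min (r0 / 2) ((1 - m) / 4)"
  show ?thesis
  proof (rule that[of r "m + 2 * r"])
    show "r > 0" using r0 m1 by (simp add: r_def)
    show "m + 2 * r < 1" using m1 by (simp add: r_def min_def field_simps)
    show "Re u + 2 * r \<le> m + 2 * r" if "u \<in> A \<union> B" for u using m[OF that] by simp
    show "2 * r \<le> dist u w" if "u \<in> A \<union> B" "w \<in> A \<union> B" "u \<noteq> w" for u w
      using sep[OF that] by (simp add: r_def)
  qed
qed

context
  fixes r \<kappa> :: real
  assumes r: "r > 0" and \<kappa>: "\<kappa> < 1" "\<And>u. u \<in> A \<union> B \<Longrightarrow> Re u + 2 * r \<le> \<kappa>"
    and sep: "\<And>u w. u \<in> A \<union> B \<Longrightarrow> w \<in> A \<union> B \<Longrightarrow> u \<noteq> w \<Longrightarrow> 2 * r \<le> dist u w"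
begin

lemma circle_avoids_poles:
  assumes "u \<in> A \<union> B" "norm (s - u) = r" "w \<in> A \<union> B"
  shows "r \<le> dist s w"
proof (cases "u = w")
  case False
  have "2 * r \<le> dist u w" by (rule sep) (use assms False in auto)
  also have "\<dots> \<le> r + dist s w"
    using dist_triangle[of u w s] assms(2) by (simp add: dist_norm norm_minus_commute)
  finally show ?thesis by simp
qed (use assms in \<open>simp add: dist_norm\<close>)

lemma residue_circle:
  assumes u: "u \<in> A \<union> B" and h: "h holomorphic_on ball u (2 * r)"
  shows "((\<lambda>s. F s * h s) has_contour_integral 2 * pi * \<i> * residue (\<lambda>s. F s * h s) u) (circlepath u r)"
proof (rule base_residue[of "ball u (2 * r)"])
  have "w \<notin> A \<union> B" if "w \<in> ball u (2 * r) - {u}" for w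
  proof
    assume "w \<in> A \<union> B"
    then have "2 * r \<le> dist u w" using that by (intro sep[OF u]) auto
    then show False using that by simp
  qed
  then have "ball u (2 * r) - {u} \<subseteq> - (A \<union> B)" by blast
  then show "(\<lambda>s. F s * h s) holomorphic_on ball u (2 * r) - {u}"
    by (intro holomorphic_intros holomorphic_on_subset[OF hol] holomorphic_on_subset[OF h]) auto
qed (use r in auto)

lemma norm_residue_le:
  assumes u: "u \<in> A \<union> B" and h: "h holomorphic_on ball u (2 * r)"
    and M: "M \<ge> 0" "\<And>s. norm (s - u) = r \<Longrightarrow> norm (F s * h s) \<le> M"
  shows "norm (residue (\<lambda>s. F s * h s) u) \<le> M * r"
proof -
  have "norm (2 * pi * \<i> * residue (\<lambda>s. F s * h s) u) \<le> M * (2 * pi * r)"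
    using has_contour_integral_bound_circlepath[OF residue_circle[OF u h] M(1) r M(2)] .
  then show ?thesis by (simp add: norm_mult)
qed

text \<open>On the circle around \<open>d - l\<close> the number \<open>\<bar>s\<bar>\<close> is of the order of \<open>l\<close>, so the bound becomes one in \<open>l\<close>.\<close>

lemma F_on_circles:
  obtains K where "K \<ge> 0" "\<And>d l s. d \<in> T \<Longrightarrow> norm (s - (d - of_nat l)) = r \<Longrightarrow> norm (F s) \<le> K * (1 + real l) powr (- \<epsilon>)"
proof -
  obtain C where C: "C \<ge> 0" "\<And>s. (\<forall>w\<in>A \<union> B. r \<le> dist s w) \<Longrightarrow> norm (F s) \<le> C * (1 + norm s) powr (- \<epsilon>)"
    using bound[OF r] by blast
  obtain m where m: "\<And>d. d \<in> T \<Longrightarrow> norm d \<le> m"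
    using finite_imp_bounded[OF finite_T] unfolding bounded_iff by blast
  define D where "D = 2 + max 0 m + r"
  have D: "D > 0" using r by (simp add: D_def)
  show ?thesis
  proof (rule that[of "C * D powr \<epsilon>"])
    fix d l s assume d: "d \<in> T" and s: "norm (s - (d - of_nat l)) = r"
    have dl: "d - of_nat l \<in> A \<union> B" using d by (auto simp: A_eq)
    have "real l = norm (d + (s - (d - of_nat l)) - s)" by simp
    also have "\<dots> \<le> norm d + norm (s - (d - of_nat l)) + norm s" by norm
    finally have "1 + real l \<le> 1 + (max 0 m + r) + norm s" using s m[OF d] by simp
    also have "\<dots> \<le> D + D * norm s"
      using r by (intro add_mono) (simp_all add: D_def mult_le_cancel_right1)
    also have "\<dots> = D * (1 + norm s)" by (simp add: algebra_simps)
    finally have "(1 + real l) / D \<le> 1 + norm s" using D by (simp add: field_simps)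
    then have "(1 + norm s) powr (- \<epsilon>) \<le> ((1 + real l) / D) powr (- \<epsilon>)"
      using eps D by (intro powr_mono2') auto
    also have "\<dots> = (1 + real l) powr (- \<epsilon>) * D powr \<epsilon>"
      by (subst powr_divide) (use D in \<open>auto simp: powr_minus divide_inverse\<close>)
    finally have "C * (1 + norm s) powr (- \<epsilon>) \<le> C * ((1 + real l) powr (- \<epsilon>) * D powr \<epsilon>)"
      using C(1) by (rule mult_left_mono)
    moreover have "norm (F s) \<le> C * (1 + norm s) powr (- \<epsilon>)"
      using C(2) circle_avoids_poles[OF dl s] by blast
    ultimately show "norm (F s) \<le> C * D powr \<epsilon> * (1 + real l) powr (- \<epsilon>)" by (simp add: algebra_simps)
  qed (use C in auto)
qed

lemma norm_residue_powr_le: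
  obtains K where "K \<ge> 0"
    "\<And>d l t. d \<in> T \<Longrightarrow> 0 < t \<Longrightarrow> t < 1 \<Longrightarrow>
      norm (residue (\<lambda>s. F s * of_real t powr (- s)) (d - of_nat l)) \<le> K * (1 + real l) powr (- \<epsilon>) * t powr (real l - \<kappa>)"
proof -
  obtain K where K: "K \<ge> 0" "\<And>d l s. d \<in> T \<Longrightarrow> norm (s - (d - of_nat l)) = r \<Longrightarrow> norm (F s) \<le> K * (1 + real l) powr (- \<epsilon>)"
    by (rule F_on_circles) blast
  show ?thesis
  proof (rule that[of "K * r"])
    fix d l and t :: real assume d: "d \<in> T" and t: "0 < t" "t < 1"
    have dl: "d - of_nat l \<in> A \<union> B" using d by (auto simp: A_eq)
    have "d \<in> A" using d by (rule T_subset_A)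
    have "norm (residue (\<lambda>s. F s * of_real t powr (- s)) (d - of_nat l))
        \<le> K * (1 + real l) powr (- \<epsilon>) * t powr (real l - \<kappa>) * r"
    proof (rule norm_residue_le[OF dl])
      show "(\<lambda>s. of_real t powr (- s)) holomorphic_on ball (d - of_nat l) (2 * r)"
        using t by (intro holomorphic_intros) auto
      fix s assume s: "norm (s - (d - of_nat l)) = r"
      have "Re s - (Re d - real l) \<le> r" using s complex_Re_le_cmod[of "s - (d - of_nat l)"] by simp
      then have "real l - \<kappa> \<le> - Re s" using \<kappa>(2)[of d] \<open>d \<in> A\<close> r by simp
      then have "t powr (- Re s) \<le> t powr (real l - \<kappa>)" using t by (intro powr_mono') auto
      then show "norm (F s * of_real t powr (- s)) \<le> K * (1 + real l) powr (- \<epsilon>) * t powr (real l - \<kappa>)"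
        unfolding norm_mult using K(2)[OF d s] K(1) t
        by (intro mult_mono) (auto simp: norm_powr_real_powr)
    qed (use K in auto)
    then show "norm (residue (\<lambda>s. F s * of_real t powr (- s)) (d - of_nat l))
        \<le> K * r * (1 + real l) powr (- \<epsilon>) * t powr (real l - \<kappa>)" by (simp add: algebra_simps)
  qed (use K r in auto)
qed

end

lemma summable_residue_powr:
  assumes "d \<in> T" "0 < t" "t < 1"
  shows "summable (\<lambda>l. norm (residue (\<lambda>s. F s * of_real t powr (- s)) (d - of_nat l)))"
proof -
  obtain r \<kappa> where sep: "r > 0" "\<kappa> < 1" "\<And>u. u \<in> A \<union> B \<Longrightarrow> Re u + 2 * r \<le> \<kappa>"
    "\<And>u w. u \<in> A \<union> B \<Longrightarrow> w \<in> A \<union> B \<Longrightarrow> u \<noteq> w \<Longrightarrow> 2 * r \<le> dist u w" by (rule separation) blast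
  obtain K where K: "K \<ge> 0" "\<And>d l t. d \<in> T \<Longrightarrow> 0 < t \<Longrightarrow> t < 1 \<Longrightarrow>
      norm (residue (\<lambda>s. F s * of_real t powr (- s)) (d - of_nat l)) \<le> K * (1 + real l) powr (- \<epsilon>) * t powr (real l - \<kappa>)"
    by (rule norm_residue_powr_le[OF sep]) blast+
  show ?thesis
  proof (rule summable_comparison_test')
    show "summable (\<lambda>l. K * t powr (- \<kappa>) * t ^ l)"
      using assms by (intro summable_mult summable_geometric) auto
    fix l
    have "norm (residue (\<lambda>s. F s * of_real t powr (- s)) (d - of_nat l)) \<le> K * (1 + real l) powr (- \<epsilon>) * t powr (real l - \<kappa>)"
      using K(2) assms by blast
    also have "\<dots> \<le> K * 1 * t powr (real l - \<kappa>)"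
      using K(1) eps powr_mono2'[of "- \<epsilon>" 1 "1 + real l"] by (intro mult_right_mono mult_left_mono) auto
    also have "\<dots> = K * t powr (- \<kappa>) * t ^ l"
      using assms by (simp add: powr_diff powr_realpow powr_minus divide_inverse)
    finally show "norm (norm (residue (\<lambda>s. F s * of_real t powr (- s)) (d - of_nat l))) \<le> K * t powr (- \<kappa>) * t ^ l"
      by simp
  qed
qed

end

section \<open>Loop integrals as residue sums\<close>

context translated_poles
begin

text \<open>A horizontal ray to the left that avoids the poles cannot have the height of a progression, as it would run into one
  of its points. So it keeps a distance from all of them.\<close>

lemma ray_distance:
  assumes e: "\<And>x. x \<ge> 0 \<Longrightarrow> e - of_real x \<notin> A \<union> B"
  obtains \<delta> where "\<delta> > 0" "\<And>x w. x \<ge> 0 \<Longrightarrow> w \<in> A \<union> B \<Longrightarrow> \<delta> \<le> dist (e - of_real x) w"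
proof -
  have ht: "Im e \<noteq> Im d" if d: "d \<in> T" for d
  proof
    assume eq: "Im e = Im d"
    obtain l :: nat where l: "Re d - Re e \<le> real l" using real_arch_simple by blast
    define x where "x = Re e - Re d + real l"
    have "e - of_real x = d - of_nat l" using eq by (simp add: complex_eq_iff x_def)
    moreover have "d - of_nat l \<in> A" using d by (auto simp: A_eq)
    ultimately show False using e[of x] l by (simp add: x_def del: of_real_add of_real_diff)
  qed
  obtain \<delta>1 where \<delta>1: "\<delta>1 > 0" "\<And>y. y \<in> Im ` T \<Longrightarrow> y \<noteq> Im e \<Longrightarrow> \<delta>1 \<le> dist (Im e) y"
    using finite_set_avoid[of "Im ` T" "Im e"] finite_T by auto
  define ray where "ray = {z. Im z = Im e \<and> Re z \<le> Re e}"
  have "closed ray" unfolding ray_def by (intro closed_Collect_conj closed_Collect_eq closed_Collect_le continuous_intros)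
  have "ray \<inter> B = {}"
  proof -
    have "z \<notin> B" if "z \<in> ray" for z
    proof -
      have "e - of_real (Re e - Re z) = z" using that by (simp add: complex_eq_iff ray_def)
      then show ?thesis using e[of "Re e - Re z"] that by (auto simp: ray_def)
    qed
    then show ?thesis by blast
  qed
  then obtain \<delta>2 where \<delta>2: "\<delta>2 > 0" "\<And>z w. w \<in> B \<Longrightarrow> z \<in> ray \<Longrightarrow> \<delta>2 \<le> dist w z"
    using separate_compact_closed[of B ray] finite_B \<open>closed ray\<close> by (metis finite_imp_compact inf_commute)
  show ?thesis
  proof (rule that[of "min \<delta>1 \<delta>2"])
    fix x w assume x: "(x::real) \<ge> 0" and w: "w \<in> A \<union> B"
    show "min \<delta>1 \<delta>2 \<le> dist (e - of_real x) w"
    proof (cases "w \<in> B")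
      case True
      have "\<delta>2 \<le> dist w (e - of_real x)" using x by (intro \<delta>2(2) True) (auto simp: ray_def)
      then show ?thesis by (simp add: dist_commute)
    next
      case False
      then obtain d l where dl: "d \<in> T" "w = d - of_nat l" using w by (auto simp: A_eq)
      have "\<delta>1 \<le> \<bar>Im e - Im d\<bar>" using \<delta>1(2)[of "Im d"] ht[OF dl(1)] dl(1) by (auto simp: dist_real_def)
      also have "\<dots> = \<bar>Im (e - of_real x - w)\<bar>" by (simp add: dl)
      also have "\<dots> \<le> dist (e - of_real x) w" unfolding dist_norm by (rule abs_Im_le_cmod)
      finally show ?thesis by simp
    qed
  qed (use \<delta>1 \<delta>2 in auto)
qed

text \<open>At the height of a given progression lies at most one point of the closing segment, so that only countably many
  positions hit an integer translate of a pole. Any other position works for all translates at once by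
  compactness.\<close>

lemma closing_segment_distance:
  assumes pq: "Im p < Im q"
  obtains R0 \<delta> where "R0 > 0" "\<delta> > 0"
    "\<And>N s w. s \<in> closed_segment (q - of_real (R0 + real N)) (p - of_real (R0 + real N)) \<Longrightarrow> w \<in> A \<union> B \<Longrightarrow> \<delta> \<le> dist s w"
proof -
  (* the unshifted segment reaches the height of u at the parameter \<tau> u and the abscissa x u *)
  define \<tau> where "\<tau> = (\<lambda>u. (Im q - Im u) / (Im q - Im p))"
  define x where "x = (\<lambda>u. (1 - \<tau> u) * Re q + \<tau> u * Re p)"
  define S where "S = (\<lambda>(u, k). x u - Re u - of_int k) ` ((T \<union> B) \<times> (UNIV :: int set))"
  have "countable S"
    unfolding S_def using finite_T finite_B by (intro countable_image countable_SIGMA) (auto intro: countable_finite)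
  then obtain R0 where R0: "R0 \<in> {0<..<1}" "R0 \<notin> S"
    using real_interval_avoid_countable_set[of 0 1 S] by auto
  define K where "K = closed_segment (q - of_real R0) (p - of_real R0)"
  have KU: "K \<inter> pole_translates = {}"
  proof (rule ccontr)
    assume "K \<inter> pole_translates \<noteq> {}"
    then obtain u k where uk: "u \<in> T \<union> B" "u + of_int k \<in> K" unfolding pole_translates_def by blast
    then obtain v where v: "u + of_int k = (1 - v) *\<^sub>R (q - of_real R0) + v *\<^sub>R (p - of_real R0)"
      unfolding K_def in_segment by blast
    have "Im u = (1 - v) * Im q + v * Im p" using arg_cong[OF v, of Im] by simp
    then have "Im q - Im u = v * (Im q - Im p)" by (simp add: algebra_simps)
    then have "v = \<tau> u" using pq by (simp add: \<tau>_def)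
    moreover have "Re u + of_int k = (1 - v) * (Re q - R0) + v * (Re p - R0)" using arg_cong[OF v, of Re] by simp
    ultimately have "R0 = x u - Re u - of_int k" by (simp add: x_def algebra_simps)
    then have "R0 = (\<lambda>(u, k). x u - Re u - of_int k) (u, k)" by simp
    then have "R0 \<in> S" unfolding S_def by (rule image_eqI) (use uk(1) in simp)
    then show False using R0(2) by simp
  qed
  have "compact K" by (simp add: K_def)
  moreover have "closed pole_translates" using pole_translates_locally_finite by (rule locally_finite_set_closed)
  ultimately obtain \<delta> where \<delta>: "\<delta> > 0" "\<And>z w. z \<in> K \<Longrightarrow> w \<in> pole_translates \<Longrightarrow> \<delta> \<le> dist z w"
    using separate_compact_closed[OF _ _ KU] by auto
  show ?thesis
  proof (rule that[of R0 \<delta>])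
    fix N s w
    assume s: "s \<in> closed_segment (q - of_real (R0 + real N)) (p - of_real (R0 + real N))" and w: "w \<in> A \<union> B"
    have e: "of_nat N + (z - of_real (R0 + real N)) = z - of_real R0" for z :: complex by simp
    have "of_nat N + s \<in> closed_segment (of_nat N + (q - of_real (R0 + real N))) (of_nat N + (p - of_real (R0 + real N)))"
      using s by (simp only: closed_segment_translation_eq)
    then have "s + of_nat N \<in> K" unfolding e K_def by (simp only: add.commute[of s])
    moreover have "w + of_nat N \<in> pole_translates" using w poles_subset_translates by (intro pole_translates_shift) auto
    ultimately have "\<delta> \<le> dist (s + of_nat N) (w + of_nat N)" using \<delta>(2) by blast
    then show "\<delta> \<le> dist s w" by (simp add: dist_norm)
  qed (use R0 \<delta> in auto)
qed

text \<open>The residue theorem applies to the closed truncations, and the closing segments contribute less and less, because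
  \<open>t powr (- s)\<close> decays to the left. Admissibility says that the winding numbers converge, but not uniformly in the poles. A
  uniform bound comes from geometry: seen from a point far to the left, each of the four pieces of the
  truncated loop lies in a half-plane and so makes less than half a turn.\<close>

theorem loop_integral_eq_residue_series:
  assumes loop: "left_loop g A B'" and BB: "B \<subseteq> B'" and t: "0 < t" "t < 1"
    and f: "\<And>s. s \<notin> A \<union> B' \<Longrightarrow> f s = F s * of_real t powr (- s)"
  shows "loop_integral g f = 2 * pi * \<i> *
    (\<Sum>l. \<Sum>d\<in>T. residue (\<lambda>s. F s * of_real t powr (- s)) (d - of_nat l))"
proof -
  define h where "h = (\<lambda>s. F s * of_real t powr (- s))"
  define p q where "p = pathstart g" and "q = pathfinish g"
  have g: "valid_path g" "Im p < Im q"
    and img: "\<And>R. R \<ge> 0 \<Longrightarrow> path_image (loop_trunc g R) \<inter> (A \<union> B') = {}"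
    and wA: "\<And>w. w \<in> A \<Longrightarrow> \<forall>\<^sub>F R in at_top. winding_number (loop_closed g R) w = 1"
    and wB: "\<And>w. w \<in> B' \<Longrightarrow> \<forall>\<^sub>F R in at_top. winding_number (loop_closed g R) w = 0"
    using loop unfolding left_loop_def p_def q_def by auto
  have hol_h: "h holomorphic_on - (A \<union> B)"
    unfolding h_def using t by (intro holomorphic_intros hol) auto
  have open_U: "open (- (A \<union> B))" using closed_poles by (rule open_Compl)
  have trunc: "loop_trunc g R = linepath (p - of_real R) p +++ g +++ linepath q (q - of_real R)" for R
    by (simp add: loop_trunc_def p_def q_def)
  have image: "closed_segment (p - of_real R) p \<union> path_image g \<union> closed_segment q (q - of_real R) = path_image (loop_trunc g R)" for R
    unfolding trunc by (simp add: path_image_join p_def q_def Un_assoc)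
  have avoid: "closed_segment (p - of_real R) p \<inter> (A \<union> B) = {}" "path_image g \<inter> (A \<union> B) = {}"
    "closed_segment q (q - of_real R) \<inter> (A \<union> B) = {}" if "R \<ge> 0" for R
    using img[OF that] BB unfolding image[symmetric] by blast+
  have rays: "p - of_real x \<notin> A \<union> B" "q - of_real x \<notin> A \<union> B" if "x \<ge> 0" for x
    using avoid[OF that] by (auto simp: disjoint_iff)
  obtain \<delta>p where \<delta>p: "\<delta>p > 0" "\<And>x w. x \<ge> 0 \<Longrightarrow> w \<in> A \<union> B \<Longrightarrow> \<delta>p \<le> dist (p - of_real x) w"
    by (rule ray_distance[of p]) (use rays in auto)
  obtain \<delta>q where \<delta>q: "\<delta>q > 0" "\<And>x w. x \<ge> 0 \<Longrightarrow> w \<in> A \<union> B \<Longrightarrow> \<delta>q \<le> dist (q - of_real x) w"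
    by (rule ray_distance[of q]) (use rays in auto)
  obtain R0 \<delta>0 where R0: "R0 > 0" and \<delta>0: "\<delta>0 > 0"
    "\<And>N s w. s \<in> closed_segment (q - of_real (R0 + real N)) (p - of_real (R0 + real N)) \<Longrightarrow> w \<in> A \<union> B \<Longrightarrow> \<delta>0 \<le> dist s w"
    using closing_segment_distance[OF g(2)] by metis
  define \<delta> where "\<delta> = min \<delta>p (min \<delta>q \<delta>0)"
  have \<delta>: "\<delta> > 0" using \<delta>p \<delta>q \<delta>0 by (simp add: \<delta>_def)
  obtain C where C: "C \<ge> 0" "\<And>s. (\<And>w. w \<in> A \<union> B \<Longrightarrow> \<delta> \<le> dist s w) \<Longrightarrow> norm (F s) \<le> C"
    using F_bounded[OF \<delta>] by metis
  define M where "M = max (Re p) (Re q)"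
  have h_bound: "norm (h s) \<le> C * t powr (x - M)"
    if s: "\<And>w. w \<in> A \<union> B \<Longrightarrow> \<delta> \<le> dist s w" "Re s \<le> M - x" for s x
  proof -
    have "norm (h s) = norm (F s) * t powr (- Re s)" using t by (simp add: h_def norm_mult norm_powr_real_powr)
    also have "\<dots> \<le> C * t powr (x - M)"
      using C s t by (intro mult_mono powr_mono') auto
    finally show ?thesis .
  qed
  define V where "V = (\<lambda>R. contour_integral (loop_trunc g R) h)"
  define close where "close = (\<lambda>R. linepath (q - of_real R) (p - of_real R))"
  have integrable: "h contour_integrable_on \<gamma>" if "valid_path \<gamma>" "path_image \<gamma> \<inter> (A \<union> B) = {}" for \<gamma>
    using that by (intro contour_integrable_holomorphic_simple[OF hol_h open_U]) auto
  have cont: "continuous_on S h" if "S \<inter> (A \<union> B) = {}" for S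
    using that by (intro continuous_on_subset[OF holomorphic_on_imp_continuous_on[OF hol_h]]) auto
  have V: "V R = contour_integral (linepath (p - of_real R) p) h + contour_integral g h
      + contour_integral (linepath q (q - of_real R)) h" if "R \<ge> 0" for R
    unfolding V_def trunc using avoid[OF that] g(1)
    by (subst contour_integral_join; (intro integrable)?; simp add: path_image_join p_def q_def Un_Int_distrib2 Int_Un_distrib2)+
  (* moving the ends of both rays by at most 1 changes the integral by an exponentially small amount *)
  have step: "norm (V R - V (R0 + real N)) \<le> 2 * (C * t powr (R0 + real N - M))"
    if R: "R0 + real N \<le> R" "R \<le> R0 + real N + 1" for N R
  proof -
    define R1 where "R1 = R0 + real N"
    have R1: "R1 \<ge> 0" "R1 \<le> R" "R \<le> R1 + 1" using R R0 by (auto simp: R1_def)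
    have mem: "p - of_real R1 \<in> closed_segment (p - of_real R) p" "q - of_real R1 \<in> closed_segment q (q - of_real R)"
      using R1 by (auto simp: closed_segment_same_Im closed_segment_eq_real_ivl)
    have "contour_integral (linepath (p - of_real R) p) h =
        contour_integral (linepath (p - of_real R) (p - of_real R1)) h + contour_integral (linepath (p - of_real R1) p) h"
      using R1 avoid(1)[of R] by (intro contour_integral_split_linepath cont mem) auto
    moreover have "contour_integral (linepath q (q - of_real R)) h =
        contour_integral (linepath q (q - of_real R1)) h + contour_integral (linepath (q - of_real R1) (q - of_real R)) h"
      using R1 avoid(3)[of R] by (intro contour_integral_split_linepath cont mem) auto
    ultimately have "V R - V R1 = contour_integral (linepath (p - of_real R) (p - of_real R1)) h
        + contour_integral (linepath (q - of_real R1) (q - of_real R)) h"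
      using R1 by (simp add: V)
    moreover have piece: "norm (contour_integral (linepath (e - of_real x) (e - of_real y)) h) \<le> C * t powr (R1 - M)"
      if e: "\<And>x w. x \<ge> 0 \<Longrightarrow> w \<in> A \<union> B \<Longrightarrow> \<delta> \<le> dist (e - of_real x) w" "Re e \<le> M"
        and xy: "R1 \<le> x" "R1 \<le> y" "\<bar>x - y\<bar> \<le> 1" for e x y
    proof -
      have seg: "\<exists>v\<ge>R1. s = e - of_real v" if "s \<in> closed_segment (e - of_real x) (e - of_real y)" for s
        using that xy by (intro exI[of _ "Re e - Re s"])
          (auto simp: closed_segment_same_Im closed_segment_eq_real_ivl complex_eq_iff split: if_splits)
      have far: "w \<notin> A \<union> B" if "s = e - of_real v" "v \<ge> R1" "w = s" for s v w
        using e(1)[of v w] that R1 \<delta> by auto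
      have "norm (contour_integral (linepath (e - of_real x) (e - of_real y)) h)
          \<le> (C * t powr (R1 - M)) * norm ((e - of_real y) - (e - of_real x))"
      proof (rule contour_integral_bound_linepath)
        show "h contour_integrable_on linepath (e - of_real x) (e - of_real y)"
          using seg far by (intro contour_integrable_continuous_linepath cont) blast
        fix s assume "s \<in> closed_segment (e - of_real x) (e - of_real y)"
        then obtain v where v: "v \<ge> R1" "s = e - of_real v" using seg by blast
        then show "norm (h s) \<le> C * t powr (R1 - M)"
          using e R1 by (intro h_bound) auto
      qed (use C in auto)
      also have "norm ((e - of_real y) - (e - of_real x)) = \<bar>x - y\<bar>"
        by (simp flip: of_real_diff)
      also have "(C * t powr (R1 - M)) * \<bar>x - y\<bar> \<le> (C * t powr (R1 - M)) * 1"
        using xy C by (intro mult_left_mono) auto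
      finally show ?thesis by simp
    qed
    have "norm (contour_integral (linepath (p - of_real R) (p - of_real R1)) h) \<le> C * t powr (R1 - M)"
    proof (rule piece)
      show "\<delta> \<le> dist (p - of_real x) w" if "x \<ge> 0" "w \<in> A \<union> B" for x w
        using \<delta>p(2)[OF that] by (simp add: \<delta>_def)
    qed (use R1 in \<open>auto simp: M_def\<close>)
    moreover have "norm (contour_integral (linepath (q - of_real R1) (q - of_real R)) h) \<le> C * t powr (R1 - M)"
    proof (rule piece)
      show "\<delta> \<le> dist (q - of_real x) w" if "x \<ge> 0" "w \<in> A \<union> B" for x w
        using \<delta>q(2)[OF that] by (simp add: \<delta>_def)
    qed (use R1 in \<open>auto simp: M_def\<close>)
    ultimately show ?thesis
      unfolding R1_def[symmetric] by (metis (no_types, lifting) add_mono mult_2 norm_triangle_le)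
  qed
  have small: "(\<lambda>N. C * t powr (R0 + real N - M)) \<longlonglongrightarrow> 0"
  proof -
    have "(\<lambda>N. C * t powr (R0 - M) * t ^ N) \<longlonglongrightarrow> C * t powr (R0 - M) * 0"
      using t by (intro tendsto_intros LIMSEQ_power_zero) auto
    moreover have "t powr (R0 + real N - M) = t powr (R0 - M) * t ^ N" for N
      using t by (simp add: powr_add powr_diff powr_realpow)
    ultimately show ?thesis by (simp add: mult.assoc)
  qed
  have close_image: "path_image (close (R0 + real N)) \<inter> (A \<union> B) = {}" for N
  proof -
    have "w \<notin> A \<union> B" if "w \<in> closed_segment (q - of_real (R0 + real N)) (p - of_real (R0 + real N))" for w
      using \<delta>0(2)[OF that, of w] \<delta>0(1) by auto
    then show ?thesis unfolding close_def path_image_linepath by blast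
  qed
  have close_lim: "(\<lambda>N. contour_integral (close (R0 + real N)) h) \<longlonglongrightarrow> 0"
  proof (rule Lim_null_comparison)
    show "(\<lambda>N. C * t powr (R0 + real N - M) * norm (p - q)) \<longlonglongrightarrow> 0"
      using tendsto_mult_right[OF small, of "norm (p - q)"] by simp
    have "norm (contour_integral (close (R0 + real N)) h) \<le> C * t powr (R0 + real N - M) * norm (p - q)" for N
    proof -
      define R where "R = R0 + real N"
      have "norm (contour_integral (close R) h) \<le> C * t powr (R - M) * norm ((p - of_real R) - (q - of_real R))"
        unfolding close_def
      proof (rule contour_integral_bound_linepath)
        show "h contour_integrable_on linepath (q - of_real R) (p - of_real R)"
          using close_image[of N] by (intro integrable) (auto simp: close_def R_def)
        fix s assume s: "s \<in> closed_segment (q - of_real R) (p - of_real R)"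
        have "closed_segment (q - of_real R) (p - of_real R) \<subseteq> {z. Re z \<le> M - R}"
          by (intro closed_segment_subset convex_halfspace_Re_le) (auto simp: M_def)
        then have "Re s \<le> M - R" using s by blast
        moreover have "\<delta> \<le> dist s w" if "w \<in> A \<union> B" for w
          using \<delta>0(2)[OF _ that, of s N] s by (simp add: \<delta>_def R_def)
        ultimately show "norm (h s) \<le> C * t powr (R - M)" by (intro h_bound)
      qed (use C in auto)
      then show ?thesis by (simp add: R_def)
    qed
    then show "\<forall>\<^sub>F N in sequentially. norm (contour_integral (close (R0 + real N)) h) \<le> C * t powr (R0 + real N - M) * norm (p - q)"
      by simp
  qed
  define \<gamma> where "\<gamma> = (\<lambda>N. loop_closed g (R0 + real N))"
  have \<gamma>_eq: "\<gamma> N = loop_trunc g (R0 + real N) +++ close (R0 + real N)" for N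
    by (simp add: \<gamma>_def loop_closed_def close_def p_def q_def)
  have valid_trunc: "valid_path (loop_trunc g R)" for R unfolding trunc using g by (simp add: p_def q_def)
  have ends: "pathstart (loop_trunc g R) = p - of_real R" "pathfinish (loop_trunc g R) = q - of_real R"
    "pathstart (close R) = q - of_real R" "pathfinish (close R) = p - of_real R" for R
    by (auto simp: trunc close_def)
  have \<gamma>1: "valid_path (\<gamma> N)" "pathfinish (\<gamma> N) = pathstart (\<gamma> N)" for N
    unfolding \<gamma>_eq using valid_trunc by (simp_all add: ends) (simp add: close_def)
  have \<gamma>2: "path_image (\<gamma> N) \<inter> (A \<union> B) = {}" for N
    using img[of "R0 + real N"] R0 BB close_image[of N] unfolding \<gamma>_eq
    by (subst path_image_join) (auto simp: ends)
  have Rlim: "filterlim (\<lambda>N. R0 + real N) at_top sequentially"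
    by (intro filterlim_tendsto_add_at_top[OF tendsto_const] filterlim_real_sequentially)
  have "compact (Re ` path_image g)" using g(1)
    by (intro compact_continuous_image continuous_intros) (simp add: compact_path_image valid_path_imp_path)
  then have "bounded (Re ` path_image g)" by (rule compact_imp_bounded)
  then obtain m where m: "\<And>z. z \<in> path_image g \<Longrightarrow> \<bar>Re z\<bar> \<le> m" unfolding bounded_iff by auto
  (* from the L-th members on, the progressions lie to the left of g *)
  define L where "L = nat \<lceil>m + 2\<rceil>"
  have wbd: "norm (winding_number (\<gamma> N) (d - of_nat l)) \<le> 2" if d: "d \<in> T" and l: "l \<ge> L" for N d l
  proof -
    define w where "w = d - of_nat l"
    have "m + 2 \<le> real l" using l unfolding L_def by linarith
    then have Rew: "Re w \<le> - m - 1" using Re_T[OF d] by (simp add: w_def)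
    have w: "w \<in> A \<union> B" using d by (auto simp: A_eq w_def)
    have nin: "w \<notin> closed_segment (p - of_real (R0 + real N)) p" "w \<notin> path_image g"
      "w \<notin> closed_segment q (q - of_real (R0 + real N))" "w \<notin> closed_segment (q - of_real (R0 + real N)) (p - of_real (R0 + real N))"
      using avoid[of "R0 + real N"] close_image[of N] R0 w by (auto simp: close_def disjoint_iff simp del: of_real_add)
    have "winding_number (\<gamma> N) w = (winding_number (linepath (p - of_real (R0 + real N)) p) w
        + (winding_number g w + winding_number (linepath q (q - of_real (R0 + real N))) w))
        + winding_number (linepath (q - of_real (R0 + real N)) (p - of_real (R0 + real N))) w"
      unfolding \<gamma>_eq trunc close_def using nin g(1)
      by (subst winding_number_join; simp add: not_in_path_image_join valid_path_imp_path p_def q_def del: of_real_add)+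
    moreover have "\<bar>Re (winding_number g w)\<bar> < 1 / 2"
    proof (rule winding_number_lt_half[OF g(1)])
      show "1 \<bullet> w \<le> - m - 1" using Rew by (simp add: inner_complex_def)
      show "path_image g \<subseteq> {z. - m - 1 < 1 \<bullet> z}"
        using m by (force simp: inner_complex_def abs_le_iff)
    qed
    (* four pieces, each with less than half a turn *)
    ultimately have "\<bar>Re (winding_number (\<gamma> N) w)\<bar> \<le> 2"
      using winding_number_lt_half_linepath[OF nin(1)] winding_number_lt_half_linepath[OF nin(3)]
        winding_number_lt_half_linepath[OF nin(4)] by simp
    moreover have "winding_number (\<gamma> N) w \<in> \<int>"
      using \<gamma>1[of N] \<gamma>2[of N] w by (intro integer_winding_number) (auto simp: valid_path_imp_path)
    ultimately show ?thesis unfolding w_def by (elim Ints_cases) simp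
  qed
  have "(\<lambda>N. contour_integral (\<gamma> N) h) \<longlonglongrightarrow>
    2 * pi * \<i> * ((\<Sum>l. \<Sum>d\<in>T. residue h (d - of_nat l)) + (\<Sum>p\<in>B. 0 * residue h p))"
  proof (rule contour_integrals_tendsto_residue_series[OF finite_T inj_T A_eq finite_B disj hol_h \<gamma>1 \<gamma>2 _ _ wbd])
    fix w assume "w \<in> A"
    then have "\<forall>\<^sub>F N in sequentially. winding_number (\<gamma> N) w = 1"
      using eventually_compose_filterlim[OF wA Rlim] by (simp add: \<gamma>_def)
    then show "(\<lambda>N. winding_number (\<gamma> N) w) \<longlonglongrightarrow> 1" by (rule tendsto_eventually)
  next
    fix w assume "w \<in> B"
    then have "\<forall>\<^sub>F N in sequentially. winding_number (\<gamma> N) w = 0"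
      using eventually_compose_filterlim[OF wB Rlim] BB by (auto simp: \<gamma>_def)
    then show "(\<lambda>N. winding_number (\<gamma> N) w) \<longlonglongrightarrow> 0" by (rule tendsto_eventually)
  next
    fix d assume "d \<in> T"
    then show "summable (\<lambda>l. norm (residue h (d - of_nat l)))"
      unfolding h_def using t by (rule summable_residue_powr)
  qed
  then have lim1: "(\<lambda>N. contour_integral (\<gamma> N) h) \<longlonglongrightarrow> 2 * pi * \<i> * (\<Sum>l. \<Sum>d\<in>T. residue h (d - of_nat l))"
    by simp
  have "contour_integral (\<gamma> N) h = V (R0 + real N) + contour_integral (close (R0 + real N)) h" for N
    unfolding \<gamma>_eq V_def
  proof (rule contour_integral_join)
    show "h contour_integrable_on loop_trunc g (R0 + real N)"
      using img[of "R0 + real N"] R0 BB by (intro integrable valid_trunc) auto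
    show "h contour_integrable_on close (R0 + real N)"
      using close_image by (intro integrable) (auto simp: close_def)
  qed (auto simp: valid_trunc close_def)
  then have "(\<lambda>N. V (R0 + real N)) = (\<lambda>N. contour_integral (\<gamma> N) h - contour_integral (close (R0 + real N)) h)"
    by auto
  moreover have "\<dots> \<longlonglongrightarrow> 2 * pi * \<i> * (\<Sum>l. \<Sum>d\<in>T. residue h (d - of_nat l)) - 0"
    by (intro tendsto_diff lim1 close_lim)
  ultimately have limN: "(\<lambda>N. V (R0 + real N)) \<longlonglongrightarrow> 2 * pi * \<i> * (\<Sum>l. \<Sum>d\<in>T. residue h (d - of_nat l))" by simp
  have "(\<lambda>N. 2 * (C * t powr (R0 + real N - M))) \<longlonglongrightarrow> 0" using tendsto_mult_left[OF small, of 2] by simp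
  with limN have "(V \<longlongrightarrow> 2 * pi * \<i> * (\<Sum>l. \<Sum>d\<in>T. residue h (d - of_nat l))) at_top"
    by (rule tendsto_at_top_from_unit_steps) (use step in auto)
  moreover have "\<forall>\<^sub>F R in at_top. contour_integral (loop_trunc g R) f = V R"
    using eventually_ge_at_top[of "0::real"]
  proof eventually_elim
    case (elim R)
    then show ?case unfolding V_def h_def using img[OF elim] by (intro contour_integral_eq f) auto
  qed
  ultimately have "((\<lambda>R. contour_integral (loop_trunc g R) f) \<longlongrightarrow> 2 * pi * \<i> * (\<Sum>l. \<Sum>d\<in>T. residue h (d - of_nat l))) at_top"
    using tendsto_cong by fastforce
  then show ?thesis unfolding loop_integral_def h_def by (intro tendsto_Lim) auto
qed

end

section \<open>Mellin inversion by residues\<close>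

lemma powr_integrable_unit_interval:
  fixes c :: real
  assumes "c < 1"
  shows "set_integrable lborel {0<..<1} (\<lambda>x::real. x powr (- c))"
    and "(LBINT x:{0<..<1}. x powr (- c)) = 1 / (1 - c)"
proof -
  have "((\<lambda>x. x powr (- c)) has_integral (1 powr (- c + 1) / (- c + 1))) {0..1}"
    using assms by (intro has_integral_powr_from_0) auto
  then have "((\<lambda>x. x powr (- c)) has_integral (1 / (1 - c))) {0<..<1}"
    by (subst (asm) has_integral_Icc_iff_Ioo) (simp add: algebra_simps)
  then have I: "((\<lambda>x. indicator {0<..<1} x * x powr (- c)) has_integral (1 / (1 - c))) UNIV"
  proof (subst (asm) has_integral_restrict_UNIV[symmetric])
    have "(\<lambda>x. if x \<in> {0<..<1} then x powr (- c) else 0) = (\<lambda>x. indicator {0<..<1} x * x powr (- c))"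
      by (auto simp: indicator_def)
    then show "((\<lambda>x. if x \<in> {0<..<1} then x powr (- c) else 0) has_integral 1 / (1 - c)) UNIV \<Longrightarrow> ?thesis" by simp
  qed
  have m: "(\<lambda>x::real. indicator {0<..<1} x * x powr (- c)) \<in> borel_measurable borel" by measurable
  have "(\<integral>\<^sup>+ x. ennreal (indicator {0<..<1} x * x powr (- c)) \<partial>lborel) = ennreal (1 / (1 - c))"
    using m I by (intro nn_integral_has_integral_lborel) auto
  then have "has_bochner_integral lborel (\<lambda>x. indicator {0<..<1} x * x powr (- c)) (1 / (1 - c))"
    using assms m by (intro has_bochner_integral_nn_integral) auto
  then show "set_integrable lborel {0<..<1} (\<lambda>x::real. x powr (- c))"
    and "(LBINT x:{0<..<1}. x powr (- c)) = 1 / (1 - c)"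
    unfolding set_integrable_def set_lebesgue_integral_def
    by (simp_all add: has_bochner_integral_iff)
qed

lemma set_integrable_dominated_powr:
  fixes f :: "real \<Rightarrow> complex" and c M :: real
  assumes c: "c < 1" and cont: "continuous_on {0<..<1} f"
    and bd: "\<And>t. 0 < t \<Longrightarrow> t < 1 \<Longrightarrow> norm (f t) \<le> M * t powr (- c)"
  shows "set_integrable lborel {0<..<1} f"
    and "(LBINT t:{0<..<1}. norm (f t)) \<le> M / (1 - c)"
proof -
  have int: "set_integrable lborel {0<..<1} (\<lambda>t. M * t powr (- c))"
    using powr_integrable_unit_interval(1)[OF c] by simp
  show f: "set_integrable lborel {0<..<1} f"
  proof (rule set_integrable_bound[OF int])
    show "set_borel_measurable lborel {0<..<1} f"
      using borel_measurable_continuous_on_indicator[OF _ cont]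
      by (simp add: set_borel_measurable_def)
    show "AE x\<in>{0<..<1} in lborel. norm (f x) \<le> norm (M * x powr (- c))"
      using bd by (auto intro!: AE_I2 intro: order_trans[OF _ abs_ge_self])
  qed
  have "(LBINT t:{0<..<1}. norm (f t)) \<le> (LBINT t:{0<..<1}. M * t powr (- c))"
    using bd by (intro set_integral_mono set_integrable_norm f int) auto
  also have "\<dots> = M / (1 - c)" using powr_integrable_unit_interval(2)[OF c] by simp
  finally show "(LBINT t:{0<..<1}. norm (f t)) \<le> M / (1 - c)" .
qed


lemma set_integral_unit_interval_limit:
  fixes f :: "real \<Rightarrow> complex"
  assumes f: "set_integrable lborel {0<..<1} f" and cont: "continuous_on {0<..} f"
  shows "(\<lambda>n. integral {1 / (real n + 2)..1} f) \<longlonglongrightarrow> (LBINT t:{0<..<1}. f t)"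
proof -
  define A where "A = (\<lambda>n::nat. {1 / (real n + 2)<..<1::real})"
  have UA: "(\<Union>n. A n) = {0<..<1}"
  proof (intro equalityI subsetI)
    fix x :: real assume x: "x \<in> {0<..<1}"
    then obtain n :: nat where "1 / x < real n" using reals_Archimedean2 by blast
    then have "1 / (real n + 2) < x" using x by (auto simp: field_simps intro: add_strict_increasing2)
    then show "x \<in> (\<Union>n. A n)" using x by (auto simp: A_def)
  next
    fix x assume "x \<in> (\<Union>n. A n)"
    then show "x \<in> {0<..<1}" by (auto simp: A_def intro: less_trans[rotated])
  qed
  have "(\<lambda>n. LBINT t:A n. f t) \<longlonglongrightarrow> (LBINT t:(\<Union>n. A n). f t)"
  proof (rule set_integral_cont_up)
    have le: "1 / (real (Suc n) + 2) \<le> 1 / (real n + 2)" for n by (intro divide_left_mono) auto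
    show "incseq A"
    proof (intro incseq_SucI subsetI)
      fix n x assume "x \<in> A n"
      then show "x \<in> A (Suc n)" using le[of n] unfolding A_def greaterThanLessThan_iff by linarith
    qed
  qed (use f UA in \<open>auto simp: A_def\<close>)
  moreover have "(LBINT t:A n. f t) = integral {1 / (real n + 2)..1} f" for n
  proof -
    let ?a = "1 / (real n + 2)"
    have a: "0 < ?a" "?a \<le> 1" by auto
    have "{?a..1} \<subseteq> {0<..}"
    proof
      fix x assume "x \<in> {?a..1}"
      then show "x \<in> {0<..}" using a(1) unfolding atLeastAtMost_iff greaterThan_iff by linarith
    qed
    then have "set_integrable lborel {?a..1} f"
      using a by (intro borel_integrable_compact[unfolded set_integrable_def[symmetric]] borel_integrable_atLeastAtMost' continuous_on_subset[OF cont])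
    then have "(LBINT t=ereal ?a..ereal 1. f t) = integral {?a..1} f"
      using a by (intro interval_integral_eq_integral)
    moreover have "(LBINT t=ereal ?a..ereal 1. f t) = (LBINT t:A n. f t)"
      using a by (simp add: interval_lebesgue_integral_def A_def einterval_eq)
    ultimately show ?thesis by simp
  qed
  ultimately show ?thesis using UA by simp
qed

context translated_poles
begin

context
  fixes r \<kappa> :: real
  assumes r: "r > 0" and \<kappa>: "\<kappa> < 1" "\<And>u. u \<in> A \<union> B \<Longrightarrow> Re u + 2 * r \<le> \<kappa>"
    and sep: "\<And>u w. u \<in> A \<union> B \<Longrightarrow> w \<in> A \<union> B \<Longrightarrow> u \<noteq> w \<Longrightarrow> 2 * r \<le> dist u w"
begin

lemma sphere_subset: "u \<in> A \<union> B \<Longrightarrow> sphere u r \<subseteq> - (A \<union> B)"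
proof
  fix s assume u: "u \<in> A \<union> B" and s: "s \<in> sphere u r"
  show "s \<in> - (A \<union> B)"
  proof
    assume "s \<in> A \<union> B"
    then have "r \<le> dist s s" using circle_avoids_poles[OF r \<kappa> sep u, of s s] s
      by (simp add: dist_norm norm_minus_commute)
    then show False using r by simp
  qed
qed

lemma residue_powr_contour_integral:
  assumes u: "u \<in> A \<union> B" and w: "w \<notin> \<real>\<^sub>\<le>\<^sub>0"
  shows "2 * pi * \<i> * residue (\<lambda>s. F s * w powr (- s)) u = contour_integral (circlepath u r) (\<lambda>s. F s * w powr (- s))"
  using w by (intro contour_integral_unique[symmetric] residue_circle[OF r \<kappa> sep u] holomorphic_intros) auto

text \<open>The residue is an integral over a fixed circle, and the integrand is continuous in \<open>t\<close> as well.\<close>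

lemma residue_powr_continuous:
  assumes u: "u \<in> A \<union> B"
  shows "continuous_on {0<..} (\<lambda>t::real. residue (\<lambda>s. F s * of_real t powr (- s)) u)"
proof -
  let ?c = "circlepath u r"
  have "continuous_on {0<..} (\<lambda>t::real. integral (cbox 0 1) (\<lambda>x. F (?c x) * of_real t powr (- ?c x) * vector_derivative ?c (at x)))"
  proof (rule integral_continuous_on_param)
    have img: "?c x \<in> sphere u r" if "x \<in> {0..1}" for x
      using that path_image_circlepath_nonneg[of r u] r by (auto simp: path_image_def)
    have contF: "continuous_on (sphere u r) F"
      using sphere_subset[OF u] by (intro continuous_on_subset[OF holomorphic_on_imp_continuous_on[OF hol]])
    have c2: "continuous_on ({0<..} \<times> cbox 0 1) (\<lambda>y :: real \<times> real. ?c (snd y))"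
      unfolding circlepath by (intro continuous_intros)
    have c1: "continuous_on ({0<..} \<times> cbox 0 1) (\<lambda>y :: real \<times> real. F (?c (snd y)))"
      by (rule continuous_on_compose2[OF contF c2]) (use img in auto)
    show "continuous_on ({0<..} \<times> cbox 0 1) (\<lambda>(t, x). F (?c x) * of_real t powr (- ?c x) * vector_derivative ?c (at x))"
      unfolding case_prod_unfold vector_derivative_circlepath
      by (intro continuous_intros c1 c2) auto
  qed
  then have cont: "continuous_on {0<..} (\<lambda>t::real. 1 / (2 * pi * \<i>) * integral (cbox 0 1) (\<lambda>x. F (?c x) * of_real t powr (- ?c x) * vector_derivative ?c (at x)))"
    by (intro continuous_on_mult_left)
  show ?thesis
  proof (rule continuous_on_eq[OF cont])
    fix t :: real assume "t \<in> {0<..}"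
    then have "of_real t \<notin> (\<real>\<^sub>\<le>\<^sub>0 :: complex set)" by auto
    from residue_powr_contour_integral[OF u this]
    show "1 / (2 * pi * \<i>) * integral (cbox 0 1) (\<lambda>x. F (?c x) * of_real t powr (- ?c x) * vector_derivative ?c (at x))
      = residue (\<lambda>s. F s * of_real t powr (- s)) u"
      by (simp add: contour_integral_integral field_simps)
  qed
qed

lemma norm_residue_powr_le_circle:
  assumes u: "u \<in> A \<union> B" and M: "M \<ge> 0" "\<And>s. norm (s - u) = r \<Longrightarrow> norm (F s) \<le> M"
    and t: "0 < t" "t < 1"
  shows "norm (residue (\<lambda>s. F s * of_real t powr (- s)) u) \<le> M * r * t powr (- (Re u + r))"
proof -
  have "norm (residue (\<lambda>s. F s * of_real t powr (- s)) u) \<le> M * t powr (- (Re u + r)) * r"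
  proof (rule norm_residue_le[OF r \<kappa> sep u])
    show "(\<lambda>s. of_real t powr (- s)) holomorphic_on ball u (2 * r)"
      using t by (intro holomorphic_intros) auto
    fix s assume s: "norm (s - u) = r"
    have "Re s - Re u \<le> r" using s complex_Re_le_cmod[of "s - u"] by simp
    then have "t powr (- Re s) \<le> t powr (- (Re u + r))" using t by (intro powr_mono') auto
    then show "norm (F s * of_real t powr (- s)) \<le> M * t powr (- (Re u + r))"
      unfolding norm_mult using M(2)[OF s] M(1) t by (intro mult_mono) (auto simp: norm_powr_real_powr)
  qed (use M in auto)
  then show ?thesis by (simp add: algebra_simps)
qed

text \<open>The integrals over \<open>t\<close> and over a circle around the pole are interchanged on \<open>[\<eta>,1]\<close>, where everything is continuous; the
  inner integral then has an elementary primitive, which is the origin of the factor \<open>1 / (k + 1 - s)\<close>.\<close>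

lemma residue_powr_truncated_mellin:
  fixes k :: nat and \<eta> :: real
  assumes u: "u \<in> A \<union> B" and \<eta>: "0 < \<eta>" "\<eta> < 1"
  shows "2 * pi * \<i> * integral {\<eta>..1} (\<lambda>t. of_real t ^ k * residue (\<lambda>s. F s * of_real t powr (- s)) u) =
    contour_integral (circlepath u r) (\<lambda>s. F s * (1 / (of_nat (Suc k) - s))) -
    contour_integral (circlepath u r) (\<lambda>s. F s * (of_real \<eta> powr (of_nat (Suc k) - s) / (of_nat (Suc k) - s)))"
proof -
  let ?c = "circlepath u r" and ?l = "linepath (of_real \<eta>) 1 :: real \<Rightarrow> complex"
  have seg: "w \<notin> \<real>\<^sub>\<le>\<^sub>0 \<and> w \<noteq> 0" if "w \<in> path_image ?l" for w
  proof -
    have "path_image ?l \<subseteq> {z. Re z \<ge> \<eta>}"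
      unfolding path_image_linepath using \<eta> by (intro closed_segment_subset convex_halfspace_Re_ge) auto
    then have "Re w \<ge> \<eta>" using that by auto
    then show ?thesis using \<eta> by (auto elim!: nonpos_Reals_cases)
  qed
  have img: "path_image ?c = sphere u r" using r by simp
  have contF: "continuous_on (sphere u r) F"
    using sphere_subset[OF u] by (intro continuous_on_subset[OF holomorphic_on_imp_continuous_on[OF hol]])
  have ne: "of_nat (Suc k) - s \<noteq> 0" if "s \<in> sphere u r" for s
  proof -
    have "Re s - Re u \<le> r" using that complex_Re_le_cmod[of "s - u"] by (simp add: dist_norm norm_minus_commute)
    then have "Re s < 1" using \<kappa>(1) \<kappa>(2)[OF u] r by simp
    then show ?thesis by (auto simp: complex_eq_iff)
  qed
  have "2 * pi * \<i> * integral {\<eta>..1} (\<lambda>t. of_real t ^ k * residue (\<lambda>s. F s * of_real t powr (- s)) u)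
      = integral {\<eta>..1} (\<lambda>t. of_real t ^ k * (2 * pi * \<i> * residue (\<lambda>s. F s * of_real t powr (- s)) u))"
    by (subst integral_mult_right[symmetric]) (simp add: algebra_simps)
  also have "\<dots> = contour_integral ?l (\<lambda>w. w ^ k * (2 * pi * \<i> * residue (\<lambda>s. F s * w powr (- s)) u))"
    using \<eta> by (subst contour_integral_linepath_Reals_eq) auto
  also have "\<dots> = contour_integral ?l (\<lambda>w. contour_integral ?c (\<lambda>s. w ^ k * (F s * w powr (- s))))"
  proof (rule contour_integral_cong[OF refl])
    fix w assume w: "w \<in> path_image ?l"
    have "(\<lambda>s. F s * w powr (- s)) contour_integrable_on ?c"
      using seg[OF w] contF img
      by (intro contour_integrable_continuous_circlepath continuous_intros) (auto simp: complex_nonpos_Reals_iff)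
    then show "w ^ k * (2 * pi * \<i> * residue (\<lambda>s. F s * w powr (- s)) u)
        = contour_integral ?c (\<lambda>s. w ^ k * (F s * w powr (- s)))"
      using residue_powr_contour_integral[OF u, of w] seg[OF w] by (simp add: contour_integral_lmul)
  qed
  also have "\<dots> = contour_integral ?c (\<lambda>s. contour_integral ?l (\<lambda>w. w ^ k * (F s * w powr (- s))))"
  proof (rule contour_integral_swap)
    have "continuous_on (path_image ?l \<times> path_image ?c) (\<lambda>y. F (snd y))"
      using img by (intro continuous_on_compose2[OF contF]) (auto intro!: continuous_intros)
    then show "continuous_on (path_image ?l \<times> path_image ?c) (\<lambda>(w, s). w ^ k * (F s * w powr (- s)))"
      unfolding case_prod_unfold using seg by (intro continuous_intros) (auto simp: complex_nonpos_Reals_iff)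
  qed (auto intro!: continuous_intros simp: vector_derivative_circlepath)
  also have "\<dots> = contour_integral ?c (\<lambda>s. F s * (1 / (of_nat (Suc k) - s)) - F s * (of_real \<eta> powr (of_nat (Suc k) - s) / (of_nat (Suc k) - s)))"
  proof (rule contour_integral_cong[OF refl])
    fix s assume s: "s \<in> path_image ?c"
    let ?q = "of_nat (Suc k) - s"
    have q: "?q \<noteq> 0" using ne s img by blast
    have "((\<lambda>w. w ^ k * (F s * w powr (- s))) has_contour_integral
        (F s * (pathfinish ?l powr ?q / ?q) - F s * (pathstart ?l powr ?q / ?q))) ?l"
    proof (rule contour_integral_primitive[where S = "path_image ?l"])
      fix w assume w: "w \<in> path_image ?l"
      have "((\<lambda>w. F s * (w powr ?q / ?q)) has_field_derivative F s * (?q * w powr (?q - 1) / ?q)) (at w within path_image ?l)"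
        using seg[OF w] by (intro DERIV_cmult DERIV_cdivide has_field_derivative_at_within[OF has_field_derivative_powr]) auto
      moreover have "w powr (?q - 1) = w ^ k * w powr (- s)"
      proof -
        have "?q - 1 = of_nat k + - s" by simp
        then show ?thesis using seg[OF w] by (simp only: powr_add) (simp add: powr_nat')
      qed
      ultimately show "((\<lambda>w. F s * (w powr ?q / ?q)) has_field_derivative w ^ k * (F s * w powr (- s))) (at w within path_image ?l)"
        using q by (simp add: mult_ac)
    qed auto
    then have "contour_integral ?l (\<lambda>w. w ^ k * (F s * w powr (- s))) =
        F s * (pathfinish ?l powr ?q / ?q) - F s * (pathstart ?l powr ?q / ?q)" by (rule contour_integral_unique)
    then show "contour_integral ?l (\<lambda>w. w ^ k * (F s * w powr (- s))) = F s * (1 / ?q) - F s * (of_real \<eta> powr ?q / ?q)"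
      by simp
  qed
  also have "\<dots> = contour_integral ?c (\<lambda>s. F s * (1 / (of_nat (Suc k) - s))) -
    contour_integral ?c (\<lambda>s. F s * (of_real \<eta> powr (of_nat (Suc k) - s) / (of_nat (Suc k) - s)))"
    using contF ne img \<eta> by (intro contour_integral_diff contour_integrable_continuous_circlepath continuous_intros) (auto simp del: of_nat_Suc)
  finally show ?thesis .
qed

lemma residue_powr_mellin:
  fixes k :: nat
  assumes u: "u \<in> A \<union> B" and M: "M \<ge> 0" "\<And>s. norm (s - u) = r \<Longrightarrow> norm (F s) \<le> M"
  defines "e \<equiv> (\<lambda>t::real. of_real t ^ k * residue (\<lambda>s. F s * of_real t powr (- s)) u)"
  shows "set_integrable lborel {0<..<1} e"
    and "(LBINT t:{0<..<1}. norm (e t)) \<le> M * r / (1 - (Re u + r))"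
    and "(LBINT t:{0<..<1}. e t) = residue (\<lambda>s. F s * (1 / (of_nat (Suc k) - s))) u"
proof -
  have c: "Re u + r < 1" using \<kappa>(1) \<kappa>(2)[OF u] r by simp
  have cont: "continuous_on {0<..} e" unfolding e_def by (intro continuous_intros residue_powr_continuous u)
  have bd: "norm (e t) \<le> M * r * t powr (- (Re u + r))" if "0 < t" "t < 1" for t
  proof -
    have "norm (e t) \<le> 1 * norm (residue (\<lambda>s. F s * of_real t powr (- s)) u)"
      unfolding e_def norm_mult using that by (intro mult_right_mono) (auto simp: norm_power power_le_one)
    then show ?thesis using norm_residue_powr_le_circle[OF u M that] by simp
  qed
  have cont': "continuous_on {0<..<1} e" by (rule continuous_on_subset[OF cont]) auto
  show int: "set_integrable lborel {0<..<1} e"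
    and "(LBINT t:{0<..<1}. norm (e t)) \<le> M * r / (1 - (Re u + r))"
    by (rule set_integrable_dominated_powr[OF c cont' bd]; assumption)+
  define q where "q = (of_nat (Suc k) :: complex)"
  have Re_q: "Re q \<ge> 1" by (simp add: q_def)
  have Re_s: "Re s \<le> Re u + r" if "norm (s - u) = r" for s
    using that complex_Re_le_cmod[of "s - u"] by simp
  define h where "h = (\<lambda>n. 1 / (real n + 2))"
  have h: "0 < h n" "h n < 1" for n by (auto simp: h_def)
  have h0: "h \<longlonglongrightarrow> 0" unfolding h_def by real_asymp
  define J where "J = (\<lambda>n. contour_integral (circlepath u r) (\<lambda>s. F s * (of_real (h n) powr (q - s) / (q - s))))"
  (* a lower bound for the real part of the exponent of h n, the lower end of the truncated integral *)
  define lam where "lam = 1 - (Re u + r)"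
  have lam: "lam > 0" using c by (simp add: lam_def)
  have "J \<longlonglongrightarrow> 0"
  proof (rule Lim_null_comparison)
    show "(\<lambda>n. M * (h n powr lam / lam) * (2 * pi * r)) \<longlonglongrightarrow> 0"
    proof -
      have "(\<lambda>n. h n powr lam) \<longlonglongrightarrow> 0" using lam unfolding h_def by real_asymp
      then have "(\<lambda>n. M * (h n powr lam / lam) * (2 * pi * r)) \<longlonglongrightarrow> M * (0 / lam) * (2 * pi * r)"
        using lam by (intro tendsto_intros) auto
      then show ?thesis by simp
    qed
    have "norm (J n) \<le> M * (h n powr lam / lam) * (2 * pi * r)" for n
      unfolding J_def
    proof (rule has_contour_integral_bound_circlepath[OF has_contour_integral_integral])
      have "continuous_on (sphere u r) F"
        using sphere_subset[OF u] by (intro continuous_on_subset[OF holomorphic_on_imp_continuous_on[OF hol]])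
      moreover have "q - s \<noteq> 0" if "s \<in> sphere u r" for s
        using Re_s[of s] that c Re_q by (auto simp: dist_norm norm_minus_commute complex_eq_iff)
      ultimately show "(\<lambda>s. F s * (of_real (h n) powr (q - s) / (q - s))) contour_integrable_on circlepath u r"
        using h[of n] r by (intro contour_integrable_continuous_circlepath continuous_intros) auto
      fix s assume s: "norm (s - u) = r"
      have l: "lam \<le> Re (q - s)" using Re_s[OF s] Re_q by (simp add: lam_def)
      have "norm (of_real (h n) powr (q - s) / (q - s)) \<le> h n powr lam / lam"
        unfolding norm_divide
      proof (rule frac_le)
        show "norm (complex_of_real (h n) powr (q - s)) \<le> h n powr lam"
          using h[of n] l by (auto simp: norm_powr_real_powr intro: powr_mono')
        show "lam \<le> norm (q - s)" using l complex_Re_le_cmod[of "q - s"] by linarith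
      qed (use lam in auto)
      then show "norm (F s * (of_real (h n) powr (q - s) / (q - s))) \<le> M * (h n powr lam / lam)"
        unfolding norm_mult by (intro mult_mono M(2) s) (use M lam in auto)
    qed (use M r lam in auto)
    then show "\<forall>\<^sub>F n in sequentially. norm (J n) \<le> M * (h n powr lam / lam) * (2 * pi * r)" by simp
  qed
  have R: "contour_integral (circlepath u r) (\<lambda>s. F s * (1 / (q - s))) = 2 * pi * \<i> * residue (\<lambda>s. F s * (1 / (q - s))) u"
  proof (rule contour_integral_unique[OF residue_circle[OF r \<kappa> sep u]])
    have "q \<notin> ball u (2 * r)"
    proof
      assume "q \<in> ball u (2 * r)"
      then have "Re q - Re u < 2 * r"
        using complex_Re_le_cmod[of "q - u"] by (simp add: dist_norm norm_minus_commute)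
      then show False using \<kappa>(1) \<kappa>(2)[OF u] Re_q by simp
    qed
    then show "(\<lambda>s. 1 / (q - s)) holomorphic_on ball u (2 * r)" by (intro holomorphic_intros) auto
  qed
  have "(\<lambda>n. 2 * pi * \<i> * integral {h n..1} e) \<longlonglongrightarrow> 2 * pi * \<i> * (LBINT t:{0<..<1}. e t)"
    unfolding h_def by (intro tendsto_mult_left set_integral_unit_interval_limit int cont)
  moreover have "2 * pi * \<i> * integral {h n..1} e = 2 * pi * \<i> * residue (\<lambda>s. F s * (1 / (q - s))) u - J n" for n
    unfolding R[symmetric] J_def e_def unfolding q_def by (rule residue_powr_truncated_mellin[OF u h])
  ultimately have "(\<lambda>n. 2 * pi * \<i> * residue (\<lambda>s. F s * (1 / (q - s))) u - J n) \<longlonglongrightarrow> 2 * pi * \<i> * (LBINT t:{0<..<1}. e t)"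
    by (simp only:)
  moreover have "(\<lambda>n. 2 * pi * \<i> * residue (\<lambda>s. F s * (1 / (q - s))) u - J n) \<longlonglongrightarrow> 2 * pi * \<i> * residue (\<lambda>s. F s * (1 / (q - s))) u - 0"
    by (intro tendsto_diff tendsto_const \<open>J \<longlonglongrightarrow> 0\<close>)
  ultimately have "2 * pi * \<i> * (LBINT t:{0<..<1}. e t) = 2 * pi * \<i> * residue (\<lambda>s. F s * (1 / (q - s))) u - 0"
    by (rule LIMSEQ_unique)
  then show "(LBINT t:{0<..<1}. e t) = residue (\<lambda>s. F s * (1 / (of_nat (Suc k) - s))) u"
    by (simp add: q_def)
qed

end

end

lemma summable_shifted_powr:
  assumes "\<epsilon> > (0::real)"
  shows "summable (\<lambda>l. (1 + real l) powr (- \<epsilon> - 1))"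
proof -
  have "summable (\<lambda>n. real n powr (- \<epsilon> - 1))" using assms by (subst summable_real_powr_iff) auto
  then have "summable (\<lambda>n. real (Suc n) powr (- \<epsilon> - 1))" by (subst summable_Suc_iff)
  then show ?thesis by (simp add: add.commute)
qed

text \<open>The standard estimate for the perimeter of a rectangle.\<close>

lemma norm_contour_integral_rectpath_le:
  fixes a c :: complex
  assumes ac: "Re a \<le> Re c" "Im a \<le> Im c" and M: "M \<ge> 0" "\<And>s. s \<in> path_image (rectpath a c) \<Longrightarrow> norm (f s) \<le> M"
    and cont: "continuous_on (path_image (rectpath a c)) f"
  shows "norm (contour_integral (rectpath a c) f) \<le> M * (2 * (Re c - Re a) + 2 * (Im c - Im a))"
proof -
  define b d where "b = Complex (Re c) (Im a)" and "d = Complex (Re a) (Im c)"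
  have rect: "rectpath a c = linepath a b +++ linepath b c +++ linepath c d +++ linepath d a"
    by (simp add: rectpath_def b_def d_def Let_def)
  have image: "path_image (rectpath a c) = closed_segment a b \<union> closed_segment b c \<union> closed_segment c d \<union> closed_segment d a"
    unfolding rect by (simp add: path_image_join Un_assoc)
  have int: "f contour_integrable_on linepath x y" if "closed_segment x y \<subseteq> path_image (rectpath a c)" for x y
    using that by (intro contour_integrable_continuous_linepath continuous_on_subset[OF cont])
  have bd: "norm (contour_integral (linepath x y) f) \<le> M * norm (y - x)" if "closed_segment x y \<subseteq> path_image (rectpath a c)" for x y
    using that M by (intro contour_integral_bound_linepath int) auto
  have sub: "closed_segment a b \<subseteq> path_image (rectpath a c)" "closed_segment b c \<subseteq> path_image (rectpath a c)"
    "closed_segment c d \<subseteq> path_image (rectpath a c)" "closed_segment d a \<subseteq> path_image (rectpath a c)"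
    unfolding image by blast+
  have "contour_integral (rectpath a c) f = contour_integral (linepath a b) f + (contour_integral (linepath b c) f
      + (contour_integral (linepath c d) f + contour_integral (linepath d a) f))"
    unfolding rect using sub by (subst contour_integral_join; simp add: int)+
  also have "norm \<dots> \<le> M * norm (b - a) + (M * norm (c - b) + (M * norm (d - c) + M * norm (a - d)))"
    by (intro norm_triangle_mono bd sub)
  also have "norm (b - a) = Re c - Re a" using ac by (simp add: b_def cmod_def)
  also have "norm (c - b) = Im c - Im a" using ac by (simp add: b_def cmod_def)
  also have "norm (d - c) = Re c - Re a" using ac by (simp add: d_def cmod_def)
  also have "norm (a - d) = Im c - Im a" using ac by (simp add: d_def cmod_def)
  finally show ?thesis by (simp add: algebra_simps)
qed

context translated_poles
begin

text \<open>Both integration over \<open>(0,1)\<close> and division by \<open>q - s\<close> gain a factor of the order \<open>1 / l\<close> at the pole \<open>d - l\<close>. This makes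
  the series over \<open>l\<close> absolutely convergent for every \<open>\<epsilon> > 0\<close>.\<close>

lemma residue_kernel_le:
  fixes k :: nat
  defines "q \<equiv> of_nat (Suc k)"
  obtains K where "K \<ge> 0"
    "\<And>d l. d \<in> T \<Longrightarrow> set_integrable lborel {0<..<1} (\<lambda>t. of_real t ^ k * residue (\<lambda>s. F s * of_real t powr (- s)) (d - of_nat l))"
    "\<And>d l. d \<in> T \<Longrightarrow> (LBINT t:{0<..<1}. norm (of_real t ^ k * residue (\<lambda>s. F s * of_real t powr (- s)) (d - of_nat l))) \<le> K * (1 + real l) powr (- \<epsilon> - 1)"
    "\<And>d l. d \<in> T \<Longrightarrow> norm (residue (\<lambda>s. F s * (1 / (q - s))) (d - of_nat l)) \<le> K * (1 + real l) powr (- \<epsilon> - 1)"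
    "\<And>d l. d \<in> T \<Longrightarrow> (LBINT t:{0<..<1}. of_real t ^ k * residue (\<lambda>s. F s * of_real t powr (- s)) (d - of_nat l)) = residue (\<lambda>s. F s * (1 / (q - s))) (d - of_nat l)"
    "\<And>b. b \<in> B \<Longrightarrow> set_integrable lborel {0<..<1} (\<lambda>t. of_real t ^ k * residue (\<lambda>s. F s * of_real t powr (- s)) b)"
    "\<And>b. b \<in> B \<Longrightarrow> (LBINT t:{0<..<1}. of_real t ^ k * residue (\<lambda>s. F s * of_real t powr (- s)) b) = residue (\<lambda>s. F s * (1 / (q - s))) b"
proof -
  obtain r \<kappa> where sep: "r > 0" "\<kappa> < 1" "\<And>u. u \<in> A \<union> B \<Longrightarrow> Re u + 2 * r \<le> \<kappa>"
    "\<And>u w. u \<in> A \<union> B \<Longrightarrow> w \<in> A \<union> B \<Longrightarrow> u \<noteq> w \<Longrightarrow> 2 * r \<le> dist u w" by (rule separation) blast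
  obtain K where K: "K \<ge> 0" "\<And>d l s. d \<in> T \<Longrightarrow> norm (s - (d - of_nat l)) = r \<Longrightarrow> norm (F s) \<le> K * (1 + real l) powr (- \<epsilon>)"
    by (rule F_on_circles[OF sep]) blast+
  obtain C where C: "C \<ge> 0" "\<And>s. (\<And>w. w \<in> A \<union> B \<Longrightarrow> r \<le> dist s w) \<Longrightarrow> norm (F s) \<le> C"
    using F_bounded[OF sep(1)] by metis
  (* the circles around d - l stay at least c * (1 + l) to the left of 1 *)
  define c where "c = min 1 (1 - \<kappa>)"
  have c: "c > 0" "c \<le> 1" "c \<le> 1 - \<kappa>" using sep(2) by (auto simp: c_def)
  have low: "c * (1 + real l) \<le> 1 - (Re (d - of_nat l) + r)" if "d \<in> T" for d l
  proof -
    have "c * (1 + real l) = c + c * real l" by (simp add: algebra_simps)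
    also have "\<dots> \<le> (1 - \<kappa>) + real l" using c by (intro add_mono mult_left_le_one_le) auto
    also have "\<dots> \<le> 1 - (Re (d - of_nat l) + r)" using sep(1) sep(3)[of d] T_subset_A[OF that] by simp
    finally show ?thesis .
  qed
  have fact_l: "(K * (1 + real l) powr (- \<epsilon>)) * r / x \<le> K * r / c * (1 + real l) powr (- \<epsilon> - 1)"
    if "c * (1 + real l) \<le> x" for l x
  proof -
    have pos: "0 < c * (1 + real l)" using c by simp
    have "(K * (1 + real l) powr (- \<epsilon>)) * r / x \<le> (K * (1 + real l) powr (- \<epsilon>)) * r / (c * (1 + real l))"
      using that pos K sep(1) less_le_trans[OF pos that] by (intro divide_left_mono mult_nonneg_nonneg mult_pos_pos[of x]) auto
    also have "\<dots> = K * r / c * (1 + real l) powr (- \<epsilon> - 1)"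
      by (simp add: powr_diff powr_minus field_simps)
    finally show ?thesis .
  qed
  have dl: "d - of_nat l \<in> A \<union> B" if "d \<in> T" for d l using that by (auto simp: A_eq)
  have M0: "0 \<le> K * (1 + real l) powr (- \<epsilon>)" for l using K by simp
  show ?thesis
  proof (rule that[of "K * r / c"])
    show "K * r / c \<ge> 0" using K sep(1) c by simp
    fix d l assume d: "d \<in> T"
    note m = residue_powr_mellin[OF sep dl[OF d] M0 K(2)[OF d], where k = k]
    show "set_integrable lborel {0<..<1} (\<lambda>t. of_real t ^ k * residue (\<lambda>s. F s * of_real t powr (- s)) (d - of_nat l))"
      by (rule m(1))
    show "(LBINT t:{0<..<1}. norm (of_real t ^ k * residue (\<lambda>s. F s * of_real t powr (- s)) (d - of_nat l))) \<le> K * r / c * (1 + real l) powr (- \<epsilon> - 1)"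
      by (rule order_trans[OF _ fact_l[OF low[OF d]]]) (rule m(2))
    show "(LBINT t:{0<..<1}. of_real t ^ k * residue (\<lambda>s. F s * of_real t powr (- s)) (d - of_nat l)) = residue (\<lambda>s. F s * (1 / (q - s))) (d - of_nat l)"
      unfolding q_def by (rule m(3))
    have "norm (residue (\<lambda>s. F s * (1 / (q - s))) (d - of_nat l)) \<le> K * (1 + real l) powr (- \<epsilon>) / (c * (1 + real l)) * r"
    proof (rule norm_residue_le[OF sep dl[OF d]])
      have "q \<notin> ball (d - of_nat l) (2 * r)"
      proof
        assume "q \<in> ball (d - of_nat l) (2 * r)"
        then have "Re q - Re (d - of_nat l) < 2 * r"
          using complex_Re_le_cmod[of "q - (d - of_nat l)"] by (simp add: dist_norm norm_minus_commute)
        then show False using sep(2) sep(3)[OF dl[OF d], of l] by (simp add: q_def)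
      qed
      then show "(\<lambda>s. 1 / (q - s)) holomorphic_on ball (d - of_nat l) (2 * r)" by (intro holomorphic_intros) auto
      show "0 \<le> K * (1 + real l) powr (- \<epsilon>) / (c * (1 + real l))" using K c by simp
      fix s assume s: "norm (s - (d - of_nat l)) = r"
      have "Re s - Re (d - of_nat l) \<le> r" using s complex_Re_le_cmod[of "s - (d - of_nat l)"] by simp
      then have "c * (1 + real l) \<le> Re (q - s)" using low[OF d, of l] by (simp add: q_def)
      then have "c * (1 + real l) \<le> norm (q - s)" using complex_Re_le_cmod[of "q - s"] by linarith
      then have "norm (F s) / norm (q - s) \<le> K * (1 + real l) powr (- \<epsilon>) / (c * (1 + real l))"
        using K(2)[OF d s] M0 c by (intro frac_le) auto
      then show "norm (F s * (1 / (q - s))) \<le> K * (1 + real l) powr (- \<epsilon>) / (c * (1 + real l))"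
        by (simp add: norm_mult norm_divide)
    qed
    also have "\<dots> = (K * (1 + real l) powr (- \<epsilon>)) * r / (c * (1 + real l))" by simp
    also have "\<dots> \<le> K * r / c * (1 + real l) powr (- \<epsilon> - 1)" by (rule fact_l) simp
    finally show "norm (residue (\<lambda>s. F s * (1 / (q - s))) (d - of_nat l)) \<le> K * r / c * (1 + real l) powr (- \<epsilon> - 1)" .
  next
    fix b assume b: "b \<in> B"
    have bC: "norm (F s) \<le> C" if "norm (s - b) = r" for s
      using circle_avoids_poles[OF sep, of b s] that b by (intro C(2)) auto
    have b': "b \<in> A \<union> B" using b by simp
    note m = residue_powr_mellin[OF sep b' C(1) bC, where k = k]
    show "set_integrable lborel {0<..<1} (\<lambda>t. of_real t ^ k * residue (\<lambda>s. F s * of_real t powr (- s)) b)"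
      by (rule m(1))
    show "(LBINT t:{0<..<1}. of_real t ^ k * residue (\<lambda>s. F s * of_real t powr (- s)) b) = residue (\<lambda>s. F s * (1 / (q - s))) b"
      unfolding q_def by (rule m(3))
  qed
qed

text \<open>All residues of \<open>F s / (q - s)\<close> add up to zero, because the function decays faster than \<open>1 / \<bar>s\<bar>\<close> along suitable
  rectangles that exhaust the plane, and the residue at \<open>q\<close> is \<open>- F q\<close>. The left edge is the delicate one: its abscissa is
  chosen so that no integer translate of it meets the abscissa of a pole.\<close>

lemma residue_sum_kernel:
  fixes k :: nat
  defines "q \<equiv> of_nat (Suc k)"
  assumes summ: "\<And>d. d \<in> T \<Longrightarrow> summable (\<lambda>l. norm (residue (\<lambda>s. F s * (1 / (q - s))) (d - of_nat l)))"
  shows "(\<Sum>l. \<Sum>d\<in>T. residue (\<lambda>s. F s * (1 / (q - s))) (d - of_nat l)) + (\<Sum>b\<in>B. residue (\<lambda>s. F s * (1 / (q - s))) b) = F q"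
proof -
  define f where "f = (\<lambda>s. F s * (1 / (q - s)))"
  have Re_poles: "Re w < 1" if w: "w \<in> A \<union> B" for w
  proof (cases "w \<in> B")
    case False
    then obtain d l where "d \<in> T" "w = d - of_nat l" using w unfolding A_eq by blast
    then show ?thesis using Re_T[of d] by simp
  qed (rule Re_B)
  have q: "q \<notin> A \<union> B" using Re_poles[of q] by (auto simp: q_def)
  define P where "P = insert q B"
  have P: "finite P" "A \<inter> P = {}" using finite_B disj q by (auto simp: P_def)
  have hol_f: "f holomorphic_on - (A \<union> P)"
    unfolding f_def P_def by (intro holomorphic_intros holomorphic_on_subset[OF hol]) auto
  define S where "S = {e + of_int k | e k. e \<in> (\<lambda>u. complex_of_real (Re u)) ` (T \<union> B)}"
  have lfS: "locally_finite_set S"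
    unfolding S_def using finite_T finite_B by (intro integer_translates_locally_finite) auto
  then have "countable (Re ` S)" by (intro countable_image locally_finite_set_countable)
  then obtain x0 where x0: "x0 \<in> {-1<..<0}" "x0 \<notin> Re ` S"
    using real_interval_avoid_countable_set[of "-1" 0 "Re ` S"] by auto
  obtain \<delta>0 where \<delta>0: "\<delta>0 > 0" "\<And>w. w \<in> S \<Longrightarrow> w \<noteq> of_real x0 \<Longrightarrow> \<delta>0 < dist (of_real x0) w"
    using locally_finite_set_isolated[OF lfS] by metis
  have left: "\<delta>0 \<le> \<bar>x0 - real N - Re w\<bar>" if w: "w \<in> A \<union> B" for w N
  proof -
    obtain u k where uk: "u \<in> T \<union> B" "w = u + of_int k" using w poles_subset_translates unfolding pole_translates_def by blast
    define v where "v = (of_real (Re u + of_int (k + int N)) :: complex)"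
    have "v \<in> S" unfolding S_def v_def using uk(1)
      by (intro CollectI exI[of _ "of_real (Re u)"] exI[of _ "k + int N"]) auto
    moreover have "v \<noteq> of_real x0"
    proof
      assume "v = of_real x0"
      then have "x0 = Re v" by simp
      then show False using \<open>v \<in> S\<close> x0(2) by blast
    qed
    ultimately have "\<delta>0 < dist (of_real x0) v" by (rule \<delta>0(2))
    also have "\<dots> = \<bar>x0 - (Re u + of_int (k + int N))\<bar>" unfolding v_def dist_of_real dist_real_def ..
    finally show ?thesis by (simp add: uk algebra_simps)
  qed
  obtain Y where Y: "\<And>d. d \<in> T \<union> B \<Longrightarrow> norm d \<le> Y"
    using finite_imp_bounded[of "T \<union> B"] finite_T finite_B unfolding bounded_iff by blast
  define h where "h = max Y 0 + 1"
  have Im_poles: "\<bar>Im w\<bar> \<le> h - 1" if "w \<in> A \<union> B" for w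
  proof -
    have "\<bar>Im v\<bar> \<le> h - 1" if "v \<in> T \<union> B" for v
      using abs_Im_le_cmod[of v] Y[OF that] by (simp add: h_def)
    then show ?thesis using that unfolding A_eq by force
  qed
  have h: "h \<ge> 1" by (simp add: h_def)
  (* opposite corners of the rectangles; each edge is at least at distance N + 1 from q *)
  define a c where "a = (\<lambda>N::nat. Complex (x0 - real N) (- (h + real N)))" and "c = (\<lambda>N::nat. Complex (Re q + 1 + real N) (h + real N))"
  define \<gamma> where "\<gamma> = (\<lambda>N. rectpath (a N) (c N))"
  have Re_q: "Re q \<ge> 1" by (simp add: q_def)
  have ac: "Re (a N) \<le> Re (c N)" "Im (a N) \<le> Im (c N)" for N
    using x0 Re_q h by (auto simp: a_def c_def)
  have edge: "Re s = x0 - real N \<or> Re s = Re q + 1 + real N \<or> \<bar>Im s\<bar> = h + real N"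
    if "s \<in> path_image (\<gamma> N)" for s N
    using that h unfolding \<gamma>_def path_image_rectpath[OF ac] by (auto simp: a_def c_def)
  define \<delta> where "\<delta> = min \<delta>0 1"
  have dist_poles: "\<delta> \<le> dist s w" if s: "s \<in> path_image (\<gamma> N)" and w: "w \<in> A \<union> B" for s w N
  proof -
    have "\<delta> \<le> \<bar>Re s - Re w\<bar> \<or> \<delta> \<le> \<bar>Im s - Im w\<bar>"
      using edge[OF s] left[OF w, of N] Re_poles[OF w] Im_poles[OF w] Re_q by (auto simp: \<delta>_def)
    then show ?thesis
      using abs_Re_le_cmod[of "s - w"] abs_Im_le_cmod[of "s - w"] by (auto simp: dist_norm)
  qed
  have \<delta>: "\<delta> > 0" using \<delta>0 by (simp add: \<delta>_def)
  have far: "real N + 1 \<le> norm (q - s) \<and> real N \<le> norm s" if s: "s \<in> path_image (\<gamma> N)" for s N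
  proof -
    have "real N + 1 \<le> \<bar>Re q - Re s\<bar> \<or> real N + 1 \<le> \<bar>Im s\<bar>" and "real N \<le> \<bar>Re s\<bar> \<or> real N \<le> \<bar>Im s\<bar>"
      using edge[OF s] x0 Re_q h by auto
    moreover have "Im q = 0" by (simp add: q_def)
    ultimately show ?thesis
      using abs_Re_le_cmod[of "q - s"] abs_Im_le_cmod[of "q - s"] abs_Re_le_cmod[of s] abs_Im_le_cmod[of s] by auto
  qed
  have \<gamma>: "valid_path (\<gamma> N)" "pathfinish (\<gamma> N) = pathstart (\<gamma> N)" for N by (auto simp: \<gamma>_def)
  have \<gamma>_image: "path_image (\<gamma> N) \<inter> (A \<union> P) = {}" for N
  proof -
    have "s \<notin> A \<union> P" if "s \<in> path_image (\<gamma> N)" for s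
      using dist_poles[OF that, of s] far[OF that] \<delta> by (auto simp: P_def)
    then show ?thesis by blast
  qed
  have wn_le: "norm (winding_number (\<gamma> N) w) \<le> 1" if "w \<notin> path_image (\<gamma> N)" for w N
  proof (cases "w \<in> cbox (a N) (c N)")
    case True
    then have "w \<in> box (a N) (c N)" using that unfolding \<gamma>_def path_image_rectpath_cbox_minus_box[OF ac] by blast
    then show ?thesis unfolding \<gamma>_def by (simp add: winding_number_rectpath)
  next
    case False
    then show ?thesis unfolding \<gamma>_def using ac by (simp add: winding_number_rectpath_outside)
  qed
  have wn1: "(\<lambda>N. winding_number (\<gamma> N) w) \<longlonglongrightarrow> 1" for w
  proof (rule tendsto_eventually)
    obtain m :: nat where m: "norm w + 1 \<le> real m" using real_arch_simple by blast
    have "winding_number (\<gamma> N) w = 1" if "N \<ge> m" for N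
    proof -
      have "norm w + 1 \<le> real N" using m that by linarith
      then have "w \<in> box (a N) (c N)"
        using abs_Re_le_cmod[of w] abs_Im_le_cmod[of w] x0 Re_q h by (auto simp: in_box_complex_iff a_def c_def)
      then show ?thesis unfolding \<gamma>_def by (simp add: winding_number_rectpath)
    qed
    then show "\<forall>\<^sub>F N in sequentially. winding_number (\<gamma> N) w = 1" unfolding eventually_sequentially by blast
  qed
  have lim: "(\<lambda>N. contour_integral (\<gamma> N) f) \<longlonglongrightarrow>
    2 * pi * \<i> * ((\<Sum>l. \<Sum>d\<in>T. residue f (d - of_nat l)) + (\<Sum>p\<in>P. 1 * residue f p))"
  proof (rule contour_integrals_tendsto_residue_series[OF finite_T inj_T A_eq P hol_f \<gamma> \<gamma>_image wn1 wn1])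
    show "norm (winding_number (\<gamma> N) (d - of_nat l)) \<le> 1" if "d \<in> T" "l \<ge> 0" for N d l
    proof -
      have "d - of_nat l \<in> A" using that by (auto simp: A_eq)
      then show ?thesis using \<gamma>_image[of N] by (intro wn_le) auto
    qed
    show "summable (\<lambda>l. norm (residue f (d - of_nat l)))" if "d \<in> T" for d using summ[OF that] by (simp add: f_def)
  qed
  have lim0: "(\<lambda>N. contour_integral (\<gamma> N) f) \<longlonglongrightarrow> 0"
  proof -
    obtain C where C: "C \<ge> 0" "\<And>s. (\<forall>w\<in>A \<union> B. \<delta> \<le> dist s w) \<Longrightarrow> norm (F s) \<le> C * (1 + norm s) powr (- \<epsilon>)"
      using bound[OF \<delta>] by blast
    (* D * (N + 1) bounds the perimeter *)
    define D where "D = 2 * (Re q + 4) + 2 * (2 * h + 2)"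
    show ?thesis
    proof (rule Lim_null_comparison)
      show "(\<lambda>N. C * D * (1 + real N) powr (- \<epsilon>)) \<longlonglongrightarrow> 0"
      proof -
        have "(\<lambda>N. (1 + real N) powr (- \<epsilon>)) \<longlonglongrightarrow> 0" using eps by real_asymp
        from tendsto_mult_left[OF this, of "C * D"] show ?thesis by simp
      qed
      have "norm (contour_integral (\<gamma> N) f) \<le> C * D * (1 + real N) powr (- \<epsilon>)" for N
      proof -
        let ?M = "C * (1 + real N) powr (- \<epsilon>) / (real N + 1)"
        have "norm (contour_integral (\<gamma> N) f) \<le> ?M * (2 * (Re (c N) - Re (a N)) + 2 * (Im (c N) - Im (a N)))"
          unfolding \<gamma>_def
        proof (rule norm_contour_integral_rectpath_le[OF ac])
          show "0 \<le> ?M" using C by simp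
          show "continuous_on (path_image (rectpath (a N) (c N))) f"
          proof (rule continuous_on_subset[OF holomorphic_on_imp_continuous_on[OF hol_f]])
            show "path_image (rectpath (a N) (c N)) \<subseteq> - (A \<union> P)"
              using \<gamma>_image[of N] by (simp add: \<gamma>_def disjoint_eq_subset_Compl)
          qed
          fix s assume "s \<in> path_image (rectpath (a N) (c N))"
          then have s: "s \<in> path_image (\<gamma> N)" by (simp add: \<gamma>_def)
          have "norm (F s) \<le> C * (1 + norm s) powr (- \<epsilon>)" using C(2) dist_poles[OF s] by blast
          also have "\<dots> \<le> C * (1 + real N) powr (- \<epsilon>)"
            using far[OF s] C(1) eps by (intro mult_left_mono powr_mono2') auto
          finally have "norm (F s) / norm (q - s) \<le> ?M"
            using far[OF s] C(1) by (intro frac_le) auto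
          then show "norm (f s) \<le> ?M" by (simp add: f_def norm_mult norm_divide)
        qed
        also have "2 * (Re (c N) - Re (a N)) + 2 * (Im (c N) - Im (a N)) \<le> D * (real N + 1)"
        proof -
          have "2 * (Re (c N) - Re (a N)) + 2 * (Im (c N) - Im (a N))
              = 2 * (Re q + 1 - x0) + 4 * h + 8 * real N" by (simp add: a_def c_def)
          also have "\<dots> \<le> D + 8 * real N" using x0 by (simp add: D_def)
          also have "\<dots> \<le> D + D * real N" using Re_q h by (intro add_left_mono mult_right_mono) (auto simp: D_def)
          finally show ?thesis by (simp add: algebra_simps)
        qed
        then have "?M * (2 * (Re (c N) - Re (a N)) + 2 * (Im (c N) - Im (a N))) \<le> ?M * (D * (real N + 1))"
          using C by (intro mult_left_mono) auto
        also have "?M * (D * (real N + 1)) = C * D * (1 + real N) powr (- \<epsilon>)" by (simp add: field_simps)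
        finally show ?thesis by simp
      qed
      then show "\<forall>\<^sub>F N in sequentially. norm (contour_integral (\<gamma> N) f) \<le> C * D * (1 + real N) powr (- \<epsilon>)" by simp
    qed
  qed
  have "residue f q = - F q"
  proof -
    have "open (- (A \<union> B))" using closed_poles by (rule open_Compl)
    moreover have "(\<lambda>s. - F s) holomorphic_on - (A \<union> B)" by (intro holomorphic_intros hol)
    ultimately have "residue (\<lambda>s. - F s / (s - q)) q = - F q" using q by (intro residue_simple) auto
    moreover have "(\<lambda>s. - F s / (s - q)) = f"
      unfolding f_def by (rule ext) (metis (no_types, opaque_lifting) minus_diff_eq minus_divide_divide mult.right_neutral times_divide_eq_right)
    ultimately show ?thesis by simp
  qed
  moreover have "2 * pi * \<i> * ((\<Sum>l. \<Sum>d\<in>T. residue f (d - of_nat l)) + (\<Sum>p\<in>P. 1 * residue f p)) = 0"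
    by (rule LIMSEQ_unique[OF lim lim0])
  then have "(\<Sum>l. \<Sum>d\<in>T. residue f (d - of_nat l)) + (\<Sum>p\<in>P. residue f p) = 0" by simp
  moreover have "(\<Sum>p\<in>P. residue f p) = residue f q + (\<Sum>p\<in>B. residue f p)"
    unfolding P_def using q finite_B by (subst sum.insert) auto
  ultimately show ?thesis unfolding f_def[symmetric] by algebra
qed

text \<open>Mellin inversion at the positive integers. Integrating the residues term by term replaces \<open>F s * t powr (- s)\<close> by
  \<open>F s / (k + 1 - s)\<close>, whose residues have just been summed.\<close>

theorem residue_series_mellin:
  fixes k :: nat
  defines "E \<equiv> (\<lambda>t::real. (\<Sum>l. \<Sum>d\<in>T. residue (\<lambda>s. F s * of_real t powr (- s)) (d - of_nat l))
      + (\<Sum>b\<in>B. residue (\<lambda>s. F s * of_real t powr (- s)) b))"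
  shows "set_integrable lborel {0<..<1} (\<lambda>t. of_real t ^ k * E t)"
    and "(LBINT t:{0<..<1}. of_real t ^ k * E t) = F (of_nat (Suc k))"
proof -
  define q where "q = (of_nat (Suc k) :: complex)"
  define e where "e = (\<lambda>u t. of_real t ^ k * residue (\<lambda>s. F s * of_real t powr (- s)) u)"
  define R where "R = (\<lambda>u. residue (\<lambda>s. F s * (1 / (q - s))) u)"
  obtain K where K: "K \<ge> 0"
    "\<And>d l. d \<in> T \<Longrightarrow> set_integrable lborel {0<..<1} (e (d - of_nat l))"
    "\<And>d l. d \<in> T \<Longrightarrow> (LBINT t:{0<..<1}. norm (e (d - of_nat l) t)) \<le> K * (1 + real l) powr (- \<epsilon> - 1)"
    "\<And>d l. d \<in> T \<Longrightarrow> norm (R (d - of_nat l)) \<le> K * (1 + real l) powr (- \<epsilon> - 1)"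
    "\<And>d l. d \<in> T \<Longrightarrow> (LBINT t:{0<..<1}. e (d - of_nat l) t) = R (d - of_nat l)"
    "\<And>b. b \<in> B \<Longrightarrow> set_integrable lborel {0<..<1} (e b)"
    "\<And>b. b \<in> B \<Longrightarrow> (LBINT t:{0<..<1}. e b t) = R b"
    unfolding e_def R_def q_def by (rule residue_kernel_le[of k]) blast
  define G where "G = (\<lambda>l t. \<Sum>d\<in>T. indicator {0<..<1} t *\<^sub>R e (d - of_nat l) t)"
  have summ: "summable (\<lambda>l. norm (e (d - of_nat l) t))" if "d \<in> T" "0 < t" "t < 1" for d t
    unfolding e_def norm_mult by (intro summable_mult summable_residue_powr that)
  have G_int: "integrable lborel (G l)" for l
    unfolding G_def using K(2) by (intro Bochner_Integration.integrable_sum) (auto simp: set_integrable_def)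
  have G_integral: "integral\<^sup>L lborel (G l) = (\<Sum>d\<in>T. R (d - of_nat l))" for l
    unfolding G_def using K(2,5)
    by (subst Bochner_Integration.integral_sum) (auto simp: set_integrable_def set_lebesgue_integral_def)
  have AE: "AE t in lborel. summable (\<lambda>l. norm (G l t))"
  proof (intro AE_I2)
    fix t :: real
    show "summable (\<lambda>l. norm (G l t))"
    proof (cases "t \<in> {0<..<1}")
      case True
      have "summable (\<lambda>l. \<Sum>d\<in>T. norm (e (d - of_nat l) t))" using True by (intro summable_sum summ) auto
      then show ?thesis
        by (rule summable_comparison_test'[where N = 0]) (use True in \<open>auto simp: G_def intro: sum_norm_le\<close>)
    qed (simp add: G_def)
  qed
  have norms: "summable (\<lambda>l. \<integral>t. norm (G l t) \<partial>lborel)"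
  proof (rule summable_comparison_test'[where N = 0])
    show "summable (\<lambda>l. \<Sum>d\<in>T. K * (1 + real l) powr (- \<epsilon> - 1))"
      using eps by (intro summable_sum summable_mult summable_shifted_powr)
    fix l
    have int: "integrable lborel (\<lambda>t. norm (indicator {0<..<1} t *\<^sub>R e (d - of_nat l) t))" if "d \<in> T" for d
      using K(2)[OF that] by (intro integrable_norm) (simp add: set_integrable_def)
    have "(\<integral>t. norm (G l t) \<partial>lborel) \<le> (\<integral>t. (\<Sum>d\<in>T. norm (indicator {0<..<1} t *\<^sub>R e (d - of_nat l) t)) \<partial>lborel)"
    proof (rule integral_mono)
      show "integrable lborel (\<lambda>t. norm (G l t))" by (intro integrable_norm G_int)
      show "integrable lborel (\<lambda>t. \<Sum>d\<in>T. norm (indicator {0<..<1} t *\<^sub>R e (d - of_nat l) t))"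
        by (intro Bochner_Integration.integrable_sum int)
      show "norm (G l t) \<le> (\<Sum>d\<in>T. norm (indicator {0<..<1} t *\<^sub>R e (d - of_nat l) t))" for t
        unfolding G_def by (rule norm_sum)
    qed
    also have "\<dots> = (\<Sum>d\<in>T. LBINT t:{0<..<1}. norm (e (d - of_nat l) t))"
      using int by (subst Bochner_Integration.integral_sum) (auto simp: set_lebesgue_integral_def)
    also have "\<dots> \<le> (\<Sum>d\<in>T. K * (1 + real l) powr (- \<epsilon> - 1))" by (intro sum_mono K(3))
    finally show "norm (\<integral>t. norm (G l t) \<partial>lborel) \<le> (\<Sum>d\<in>T. K * (1 + real l) powr (- \<epsilon> - 1))" by simp
  qed
  define H where "H = (\<lambda>t. \<Sum>b\<in>B. indicator {0<..<1} t *\<^sub>R e b t)"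
  have H_int: "integrable lborel H"
    unfolding H_def using K(6) by (intro Bochner_Integration.integrable_sum) (auto simp: set_integrable_def)
  have H_integral: "integral\<^sup>L lborel H = (\<Sum>b\<in>B. R b)"
    unfolding H_def using K(6,7)
    by (subst Bochner_Integration.integral_sum) (auto simp: set_integrable_def set_lebesgue_integral_def)
  have eq: "indicator {0<..<1} t *\<^sub>R (of_real t ^ k * E t) = (\<Sum>l. G l t) + H t" for t :: real
  proof (cases "t \<in> {0<..<1}")
    case True
    have "summable (\<lambda>l. \<Sum>d\<in>T. residue (\<lambda>s. F s * of_real t powr (- s)) (d - of_nat l))"
      using True by (intro summable_sum summable_norm_cancel[OF summable_residue_powr]) auto
    then have "of_real t ^ k * (\<Sum>l. \<Sum>d\<in>T. residue (\<lambda>s. F s * of_real t powr (- s)) (d - of_nat l))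
        = (\<Sum>l. of_real t ^ k * (\<Sum>d\<in>T. residue (\<lambda>s. F s * of_real t powr (- s)) (d - of_nat l)))"
      by (rule suminf_mult[symmetric])
    then show ?thesis using True by (simp add: E_def G_def H_def e_def distrib_left sum_distrib_left)
  qed (simp add: G_def H_def)
  show "set_integrable lborel {0<..<1} (\<lambda>t. of_real t ^ k * E t)"
    unfolding set_integrable_def eq by (intro Bochner_Integration.integrable_add integrable_suminf G_int AE norms H_int)
  have "(LBINT t:{0<..<1}. of_real t ^ k * E t) = (\<integral>t. (\<Sum>l. G l t) \<partial>lborel) + integral\<^sup>L lborel H"
    unfolding set_lebesgue_integral_def eq
    by (intro Bochner_Integration.integral_add integrable_suminf G_int AE norms H_int)
  also have "(\<integral>t. (\<Sum>l. G l t) \<partial>lborel) = (\<Sum>l. \<Sum>d\<in>T. R (d - of_nat l))"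
    by (subst integral_suminf[OF G_int AE norms]) (simp add: G_integral)
  also have "(\<Sum>l. \<Sum>d\<in>T. R (d - of_nat l)) + integral\<^sup>L lborel H = F q"
    unfolding H_integral R_def q_def
  proof (rule residue_sum_kernel)
    fix d assume d: "d \<in> T"
    show "summable (\<lambda>l. norm (residue (\<lambda>s. F s * (1 / (of_nat (Suc k) - s))) (d - of_nat l)))"
      by (rule summable_comparison_test'[where N = 0, OF summable_mult[OF summable_shifted_powr[OF eps], of K]])
         (use K(4)[OF d] in \<open>simp add: R_def q_def\<close>)
  qed
  finally show "(LBINT t:{0<..<1}. of_real t ^ k * E t) = F (of_nat (Suc k))" by (simp only: q_def)
qed

end

section \<open>The kernel of the functional\<close>

text \<open>Progressions that start at different components of a parameter vector may overlap. Keeping only the points whose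
  successor is missing gives starting points of disjoint progressions with the same union.\<close>

lemma progression_tops:
  fixes X :: "complex set"
  assumes X: "finite X"
  defines "A \<equiv> {x - of_nat l | x l. x \<in> X}"
  defines "T \<equiv> {w \<in> A. w + 1 \<notin> A}"
  shows "finite T" and "T \<subseteq> X" and "inj_on (\<lambda>(d, l). d - of_nat l) (T \<times> (UNIV :: nat set))"
    and "A = {d - of_nat l | d l. d \<in> T}"
proof -
  have down: "w - of_nat l \<in> A" if w: "w \<in> A" for w l
  proof -
    obtain x j where "x \<in> X" "w = x - of_nat j" using w unfolding A_def by blast
    then show ?thesis unfolding A_def by (intro CollectI exI[of _ x] exI[of _ "j + l"]) auto
  qed
  show TX: "T \<subseteq> X"
  proof
    fix w assume w: "w \<in> T"
    then obtain x l where xl: "x \<in> X" "w = x - of_nat l" unfolding T_def A_def by blast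
    have "l = 0"
    proof (rule ccontr)
      assume "l \<noteq> 0"
      then have "w + 1 = x - of_nat (l - 1)" using xl by (simp add: of_nat_diff)
      then have "w + 1 \<in> A" unfolding A_def using xl by blast
      then show False using w by (simp add: T_def)
    qed
    then show "w \<in> X" using xl by simp
  qed
  then show "finite T" using X finite_subset by blast
  have top: "d = d' \<and> l = l'" if d: "d \<in> T" "d' \<in> T" and eq: "d - of_nat l = d' - of_nat l'" and le: "l \<le> l'" for d d' l l'
  proof -
    have "l' = l"
    proof (rule ccontr)
      assume "l' \<noteq> l"
      then have "d + 1 = d' - of_nat (l' - l - 1)" using eq le by (simp add: of_nat_diff algebra_simps)
      moreover have "d' - of_nat (l' - l - 1) \<in> A" using d by (intro down) (simp add: T_def)
      ultimately show False using d by (simp add: T_def)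
    qed
    then show ?thesis using eq by simp
  qed
  show "inj_on (\<lambda>(d, l). d - of_nat l) (T \<times> (UNIV :: nat set))"
  proof (rule inj_onI, clarify)
    fix d l d' l' assume d: "d \<in> T" "d' \<in> T" and eq: "d - complex_of_nat l = d' - of_nat l'"
    show "d = d' \<and> l = l'"
      using top[OF d eq] top[OF d(2,1) eq[symmetric]] by (cases "l \<le> l'") auto
  qed
  show "A = {d - of_nat l | d l. d \<in> T}"
  proof (intro equalityI subsetI)
    fix w assume w: "w \<in> A"
    define m where "m = Max (Re ` X)"
    (* climb from w to the last point of its class that still belongs to A *)
    define J where "J = {k::nat. w + of_nat k \<in> A}"
    have "J \<subseteq> {..nat \<lceil>m - Re w\<rceil>}"
    proof
      fix k assume "k \<in> J"
      then obtain x l where xl: "x \<in> X" "w + of_nat k = x - of_nat l" unfolding J_def A_def by blast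
      have "Re x \<le> m" unfolding m_def using X xl by (intro Max_ge) auto
      moreover have "Re w + real k = Re x - real l" using arg_cong[OF xl(2), of Re] by simp
      ultimately have "real k \<le> m - Re w" by simp
      then show "k \<in> {..nat \<lceil>m - Re w\<rceil>}" by simp linarith
    qed
    then have "finite J" by (rule finite_subset) simp
    moreover have "0 \<in> J" using w by (simp add: J_def)
    ultimately have mJ: "Max J \<in> J" "\<And>k. k \<in> J \<Longrightarrow> k \<le> Max J" by (auto intro: Max_in)
    have "Suc (Max J) \<notin> J" using mJ(2) by fastforce
    then have "w + of_nat (Max J) \<in> T" using mJ(1) by (simp add: T_def J_def algebra_simps)
    then show "w \<in> {d - of_nat l | d l. d \<in> T}"
      by (intro CollectI exI[of _ "w + of_nat (Max J)"] exI[of _ "Max J"]) auto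
  next
    fix w assume "w \<in> {d - of_nat l | d l. d \<in> T}"
    then obtain d l where "d \<in> T" "w = d - of_nat l" by blast
    then show "w \<in> A" using down[of d l] by (simp add: T_def)
  qed
qed

lemma Gamma_vec_shift_nth: "Gamma_vec (shift a \<mu>) = (\<Prod>i<length a. Gamma (a ! i + \<mu>))"
  unfolding Gamma_vec_def shift_def
  by (simp add: prod.list_conv_set_nth atLeast0LessThan map_map o_def)

lemma poch_vec_nth: "poch_vec a j = (\<Prod>i<length a. pochhammer (a ! i) j)"
  unfolding poch_vec_def by (simp add: prod.list_conv_set_nth atLeast0LessThan)

lemma Gamma_vec_nth: "Gamma_vec a = (\<Prod>i<length a. Gamma (a ! i))"
  unfolding Gamma_vec_def by (simp add: prod.list_conv_set_nth atLeast0LessThan)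

lemma Gamma_vec_shift_of_nat:
  assumes "\<And>x. x \<in> set a \<Longrightarrow> x \<notin> \<int>\<^sub>\<le>\<^sub>0"
  shows "Gamma_vec (shift a (of_nat j)) = Gamma_vec a * poch_vec a j"
proof -
  have "Gamma (a ! i + of_nat j) = Gamma (a ! i) * pochhammer (a ! i) j" if "i < length a" for i
    using assms[of "a ! i"] that by (simp add: pochhammer_Gamma Gamma_eq_zero_iff)
  then show ?thesis
    unfolding Gamma_vec_shift_nth Gamma_vec_nth[of a] poch_vec_nth by (simp flip: prod.distrib)
qed

text \<open>The integrand of the Meijer function without the power of \<open>t\<close>, where \<open>\<Gamma>(1 - n - s) / \<Gamma>(1 - s)\<close> is replaced by
  \<open>(-1)\<^sup>n / (s)\<^sub>n\<close>. In this form the removable singularities at \<open>1, 2, \<dots>\<close> have disappeared.\<close>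

definition mellin_kernel :: "nat \<Rightarrow> complex list \<Rightarrow> complex list \<Rightarrow> complex \<Rightarrow> complex" where
  "mellin_kernel n a b s = (-1) ^ n * Gamma_vec (shift a (of_nat n - 1 + s)) /
     (Gamma_vec (shift b (of_nat n - 1 + s)) * (\<Prod>k<n. s + of_nat k))"

lemma mellin_kernel_nth:
  assumes "length a = length b"
  shows "mellin_kernel n a b s = (-1) ^ n * (\<Prod>i<length a. Gamma (a ! i + (of_nat n - 1 + s)) * rGamma (b ! i + (of_nat n - 1 + s))) *
    (\<Prod>k<n. 1 / (s + of_nat k))"
proof -
  have "(\<Prod>i<length b. rGamma (b ! i + (of_nat n - 1 + s))) = inverse (\<Prod>i<length b. Gamma (b ! i + (of_nat n - 1 + s)))"
    by (simp add: rGamma_inverse_Gamma o_def flip: prod_inversef)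
  moreover have "(\<Prod>k<n. 1 / (s + of_nat k)) = inverse (\<Prod>k<n. s + of_nat k)"
    by (simp add: divide_inverse o_def flip: prod_inversef)
  ultimately show ?thesis
    unfolding mellin_kernel_def Gamma_vec_shift_nth prod.distrib by (simp add: assms divide_inverse)
qed

lemma mellin_kernel_holomorphic:
  assumes len: "length a = length b"
  shows "mellin_kernel n a b holomorphic_on - (G_left_points n a \<union> {- of_nat k | k. k < n})"
proof -
  have "(\<lambda>s. (-1) ^ n * (\<Prod>i<length a. Gamma (a ! i + (of_nat n - 1 + s)) * rGamma (b ! i + (of_nat n - 1 + s))) *
    (\<Prod>k<n. 1 / (s + of_nat k))) holomorphic_on - (G_left_points n a \<union> {- of_nat k | k. k < n})"
  proof (intro holomorphic_intros)
    fix i s assume i: "i \<in> {..<length a}" and s: "s \<in> - (G_left_points n a \<union> {- of_nat k | k. k < n})"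
    show "a ! i + (of_nat n - 1 + s) \<notin> \<int>\<^sub>\<le>\<^sub>0"
    proof
      assume "a ! i + (of_nat n - 1 + s) \<in> \<int>\<^sub>\<le>\<^sub>0"
      then obtain l where "a ! i + (of_nat n - 1 + s) = - of_nat l" by (rule nonpos_Ints_cases')
      then have "s = 1 - a ! i - of_nat n - of_nat l" by (simp add: algebra_simps)
      then show False using s i unfolding G_left_points_def by force
    qed
  next
    fix k s assume "k \<in> {..<n}" "s \<in> - (G_left_points n a \<union> {- of_nat k | k. k < n})"
    then show "s + of_nat k \<noteq> 0" by (auto simp: add_eq_0_iff2)
  qed
  then show ?thesis using mellin_kernel_nth[OF len] by (simp add: fun_eq_iff cong: holomorphic_cong)
qed

text \<open>Each Gamma quotient contributes the exponent \<open>Re (a\<^sub>i - b\<^sub>i)\<close>, and each of the \<open>n\<close> linear factors in the denominator the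
  exponent \<open>-1\<close>.\<close>

lemma mellin_kernel_bound:
  assumes len: "length a = length b" and \<epsilon>: "Re (psi a b) + real n > 0" and \<delta>: "\<delta> > 0"
  shows "\<exists>C\<ge>0. \<forall>s. (\<forall>w\<in>G_left_points n a \<union> {- of_nat k | k. k < n}. \<delta> \<le> dist s w) \<longrightarrow>
    norm (mellin_kernel n a b s) \<le> C * (1 + norm s) powr (- (Re (psi a b) + real n))"
proof -
  define \<epsilon> where "\<epsilon> = Re (psi a b) + real n"
  define \<alpha> \<beta> where "\<alpha> = (\<lambda>i. a ! i + of_nat n - 1)" and "\<beta> = (\<lambda>i. b ! i + of_nat n - 1)"
  have "\<forall>i. \<exists>C>0. \<forall>s. (\<forall>l. \<delta> \<le> norm (\<alpha> i + s + of_nat l)) \<longrightarrow>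
    norm (Gamma (\<alpha> i + s) * rGamma (\<beta> i + s)) \<le> C * msize s powr (Re (\<alpha> i - \<beta> i) / 2)"
    using gamma_ratio_bound[OF \<delta>] by blast
  then obtain C where C: "\<And>i. C i > 0" "\<And>i s. (\<And>l. \<delta> \<le> norm (\<alpha> i + s + of_nat l)) \<Longrightarrow>
    norm (Gamma (\<alpha> i + s) * rGamma (\<beta> i + s)) \<le> C i * msize s powr (Re (\<alpha> i - \<beta> i) / 2)" by metis
  define D where "D = (\<lambda>k::nat. (1 + 2 * real k) / \<delta> + 2)"
  have D: "D k > 0" for k using \<delta> by (simp add: D_def add_pos_pos)
  define K where "K = (\<Prod>i<length a. C i) * (\<Prod>k<n. D k)"
  have K: "K \<ge> 0" unfolding K_def using C(1) D by (intro mult_nonneg_nonneg prod_nonneg) (auto intro: less_imp_le)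
  have "norm (mellin_kernel n a b s) \<le> K * 2 powr \<epsilon> * (1 + norm s) powr (- \<epsilon>)"
    if s: "\<forall>w\<in>G_left_points n a \<union> {- of_nat k | k. k < n}. \<delta> \<le> dist s w" for s
  proof -
    define m where "m = msize s"
    have m: "m \<ge> 1" using msize_ge_1 by (simp add: m_def)
    have left: "\<delta> \<le> norm (\<alpha> i + s + of_nat l)" if "i < length a" for i l
    proof -
      have "1 - a ! i - of_nat n - of_nat l \<in> G_left_points n a" using that unfolding G_left_points_def by force
      then have "\<delta> \<le> dist s (1 - a ! i - of_nat n - of_nat l)" using s by blast
      then show ?thesis by (simp add: dist_norm \<alpha>_def algebra_simps)
    qed
    have right: "norm (1 / (s + of_nat k)) \<le> D k * m powr (- 1 / 2)" if "k < n" for k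
    proof -
      have "- of_nat k \<in> G_left_points n a \<union> {- of_nat k | k. k < n}" using that by blast
      then have "\<delta> \<le> dist s (- of_nat k)" using s by blast
      then have d: "\<delta> \<le> norm (of_nat k + s)" by (simp add: dist_norm add.commute)
      have "sqrt m \<le> D k * norm (of_nat k + s)"
        using sqrt_msize_le[OF \<delta> d] by (simp add: m_def D_def)
      moreover have "norm (of_nat k + s) > 0" "sqrt m > 0" using d \<delta> m by auto
      ultimately have "1 / norm (of_nat k + s) \<le> D k / sqrt m" by (simp add: field_simps)
      moreover have "m powr (- 1 / 2) = 1 / sqrt m"
        using m by (simp add: powr_half_sqrt[symmetric] powr_minus_divide)
      ultimately show ?thesis by (simp add: norm_divide add.commute)
    qed
    have "norm (mellin_kernel n a b s) = (\<Prod>i<length a. norm (Gamma (\<alpha> i + s) * rGamma (\<beta> i + s))) * (\<Prod>k<n. norm (1 / (s + of_nat k)))"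
    proof -
      have e: "a ! i + (of_nat n - 1 + s) = \<alpha> i + s" "b ! i + (of_nat n - 1 + s) = \<beta> i + s" for i
        by (simp_all add: \<alpha>_def \<beta>_def)
      have "norm (mellin_kernel n a b s) = norm ((-1) ^ n :: complex) *
          norm (\<Prod>i<length a. Gamma (\<alpha> i + s) * rGamma (\<beta> i + s)) * norm (\<Prod>k<n. 1 / (s + of_nat k))"
        unfolding mellin_kernel_nth[OF len] e by (simp only: norm_mult)
      also have "norm ((-1) ^ n :: complex) = 1" by (simp add: norm_power)
      finally show ?thesis unfolding prod_norm[symmetric] by (simp only: mult_1)
    qed
    also have "\<dots> \<le> (\<Prod>i<length a. C i * m powr (Re (\<alpha> i - \<beta> i) / 2)) * (\<Prod>k<n. D k * m powr (- 1 / 2))"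
      using left right C D by (intro mult_mono prod_mono prod_nonneg) (auto simp: m_def less_imp_le)
    also have "\<dots> = K * ((\<Prod>i<length a. m powr (Re (\<alpha> i - \<beta> i) / 2)) * (\<Prod>k<n. m powr (- 1 / 2)))"
      by (simp add: K_def prod.distrib)
    also have "(\<Prod>i<length a. m powr (Re (\<alpha> i - \<beta> i) / 2)) = m powr (\<Sum>i<length a. Re (\<alpha> i - \<beta> i) / 2)"
      using m by (simp add: powr_sum)
    also have "(\<Sum>i<length a. Re (\<alpha> i - \<beta> i) / 2) = - Re (psi a b) / 2"
      by (simp add: psi_def \<alpha>_def \<beta>_def sum_subtractf diff_divide_distrib flip: sum_divide_distrib)
    also have "(\<Prod>k<n. m powr (- 1 / 2)) = m powr (- real n / 2)"
      using m by (simp add: powr_power)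
    also have "m powr (- Re (psi a b) / 2) * m powr (- real n / 2) = m powr (- \<epsilon> / 2)"
      by (simp add: \<epsilon>_def field_simps flip: powr_add)
    also have "K * m powr (- \<epsilon> / 2) \<le> K * (2 powr \<epsilon> * (1 + norm s) powr (- \<epsilon>))"
    proof (intro mult_left_mono K)
      have "((1 + norm s) / 2)\<^sup>2 \<le> m"
      proof -
        have "norm s \<le> \<bar>Re s\<bar> + \<bar>Im s\<bar>" by (rule cmod_le)
        then have "(1 + norm s)\<^sup>2 \<le> ((1 + \<bar>Im s\<bar>) + \<bar>Re s\<bar>)\<^sup>2" by (intro power_mono) auto
        also have "\<dots> \<le> 2 * m"
          using zero_le_power2[of "(1 + \<bar>Im s\<bar>) - \<bar>Re s\<bar>"]
          by (simp add: m_def msize_def power2_eq_square algebra_simps)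
        finally show ?thesis using m by (simp add: power_divide)
      qed
      then have "m powr (- \<epsilon> / 2) \<le> (((1 + norm s) / 2)\<^sup>2) powr (- \<epsilon> / 2)"
        using \<epsilon> norm_ge_zero[of s] by (intro powr_mono2' zero_less_power) (auto simp: \<epsilon>_def add_pos_nonneg)
      also have "\<dots> = ((1 + norm s) / 2) powr (- \<epsilon>)"
      proof -
        have "((1 + norm s) / 2)\<^sup>2 = ((1 + norm s) / 2) powr 2"
          by (subst powr_realpow[symmetric]) (auto simp: add_pos_nonneg)
        then show ?thesis by (simp only: powr_powr) simp
      qed
      also have "\<dots> = 2 powr \<epsilon> * (1 + norm s) powr (- \<epsilon>)"
        by (subst powr_divide) (auto simp: powr_minus divide_inverse)
      finally show "m powr (- \<epsilon> / 2) \<le> 2 powr \<epsilon> * (1 + norm s) powr (- \<epsilon>)" .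
    qed
    finally show ?thesis by (simp add: mult.assoc)
  qed
  then show ?thesis unfolding \<epsilon>_def[symmetric] using K by (intro exI[of _ "K * 2 powr \<epsilon>"]) auto
qed

lemma G_integrand_eq:
  assumes "s \<notin> G_right_points n"
  shows "G_integrand n a b t s = mellin_kernel n a b s * of_real t powr (- s)"
proof -
  have np: "1 - of_nat n - s \<notin> \<int>\<^sub>\<le>\<^sub>0"
  proof
    assume "1 - of_nat n - s \<in> \<int>\<^sub>\<le>\<^sub>0"
    then obtain k where "1 - of_nat n - s = - of_nat k" by (rule nonpos_Ints_cases')
    then have "s = 1 - of_nat n + of_nat k" by (simp add: algebra_simps)
    then show False using assms unfolding G_right_points_def by blast
  qed
  have "pochhammer (1 - of_nat n - s) n = Gamma (1 - s) / Gamma (1 - of_nat n - s)"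
    using pochhammer_Gamma[OF np, of n] by simp
  moreover have "pochhammer (1 - of_nat n - s) n = (-1) ^ n * (\<Prod>k<n. s + of_nat k)"
    using pochhammer_minus[of "s + of_nat n - 1" n] by (simp add: pochhammer_prod atLeast0LessThan algebra_simps)
  ultimately have "Gamma (1 - s) = (-1) ^ n * (\<Prod>k<n. s + of_nat k) * Gamma (1 - of_nat n - s)"
    using np by (simp add: Gamma_eq_zero_iff field_simps)
  then have "Gamma (1 - of_nat n - s) / Gamma (1 - s) = (-1) ^ n / (\<Prod>k<n. s + of_nat k)"
    using np by (simp add: Gamma_eq_zero_iff divide_simps)
  then have r: "Gamma (1 - of_nat n - s) / Gamma (1 - s) = (-1) ^ n / (\<Prod>k<n. s + of_nat k)" .
  define Ga Gb where "Ga = Gamma_vec (shift a (of_nat n - 1 + s))" and "Gb = Gamma_vec (shift b (of_nat n - 1 + s))"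
  have "Ga * Gamma (1 - of_nat n - s) / (Gb * Gamma (1 - s)) = Ga / Gb * (Gamma (1 - of_nat n - s) / Gamma (1 - s))"
    by (rule times_divide_times_eq[symmetric])
  also have "\<dots> = (-1) ^ n * Ga / (Gb * (\<Prod>k<n. s + of_nat k))"
    unfolding r by (simp only: times_divide_times_eq mult.commute)
  finally show ?thesis unfolding G_integrand_def mellin_kernel_def Ga_def Gb_def by (simp only:)
qed

lemma mellin_kernel_translated_poles:
  assumes len: "length a = length b" and a: "\<And>x. x \<in> set a \<Longrightarrow> x \<notin> \<int>\<^sub>\<le>\<^sub>0"
    and Re_a: "\<And>x. x \<in> set a \<Longrightarrow> 0 < Re x + real n" and \<epsilon>: "Re (psi a b) + real n > 0"
  obtains T where "translated_poles T (G_left_points n a) {- of_nat k | k. k < n} (mellin_kernel n a b) (Re (psi a b) + real n)"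
proof -
  define X where "X = (\<lambda>x. 1 - x - of_nat n) ` set a"
  have A: "G_left_points n a = {x - of_nat l | x l. x \<in> X}" unfolding G_left_points_def X_def by auto
  have finX: "finite X" by (simp add: X_def)
  define T where "T = {w \<in> G_left_points n a. w + 1 \<notin> G_left_points n a}"
  note tops = progression_tops[OF finX, folded A, folded T_def]
  have "translated_poles T (G_left_points n a) {- of_nat k | k. k < n} (mellin_kernel n a b) (Re (psi a b) + real n)"
  proof
    show "finite T" "inj_on (\<lambda>(d, l). d - of_nat l) (T \<times> (UNIV :: nat set))"
      "G_left_points n a = {d - of_nat l | d l. d \<in> T}" by (fact tops)+
    show "finite {- complex_of_nat k | k. k < n}" by simp
    show "G_left_points n a \<inter> {- of_nat k | k. k < n} = {}"
    proof -
      have False if x: "x \<in> set a" and k: "k < n" and eq: "1 - x - of_nat n - of_nat l = - complex_of_nat k" for x l k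
      proof -
        have "x = - of_nat (n - 1 - k + l)" using eq k by (simp add: of_nat_diff algebra_simps)
        then have "x \<in> \<int>\<^sub>\<le>\<^sub>0" by (simp only: minus_of_nat_in_nonpos_Ints)
        then show False using a[OF x] by blast
      qed
      then show ?thesis unfolding G_left_points_def by blast
    qed
    show "Re d < 1" if "d \<in> T" for d
      using that tops(2) Re_a unfolding X_def by force
    show "Re w < 1" if "w \<in> {- of_nat k | k. k < n}" for w using that by auto
    show "mellin_kernel n a b holomorphic_on - (G_left_points n a \<union> {- of_nat k | k. k < n})"
      by (rule mellin_kernel_holomorphic[OF len])
    show "0 < Re (psi a b) + real n" by (fact \<epsilon>)
    show "\<exists>C\<ge>0. \<forall>s. (\<forall>w\<in>G_left_points n a \<union> {- of_nat k | k. k < n}. \<delta> \<le> dist s w) \<longrightarrow>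
        norm (mellin_kernel n a b s) \<le> C * (1 + norm s) powr (- (Re (psi a b) + real n))" if "\<delta> > 0" for \<delta>
      by (rule mellin_kernel_bound[OF len \<epsilon> that])
  qed
  then show ?thesis by (rule that)
qed

text \<open>The residues at \<open>0, -1, \<dots>, 1 - n\<close> add up to this polynomial times \<open>- \<Gamma>(a)\<close>.\<close>

definition G_poly :: "nat \<Rightarrow> complex list \<Rightarrow> complex list \<Rightarrow> real \<Rightarrow> complex" where
  "G_poly n a b t = (\<Sum>j<n. (-1) ^ j * poch_vec a j / (Gamma_vec (shift b (of_nat j)) * fact j * fact (n - 1 - j)) *
     of_real t ^ (n - 1 - j))"

text \<open>This is the expression that extends the kernel to degenerate parameters.\<close>

lemma G_poly_eq:
  assumes t: "t > 0"
  shows "of_real t ^ (n - 1) / fact (n - 1) *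
    (\<Sum>j<n. pochhammer (1 - of_nat n) j * poch_vec a j / (Gamma_vec (shift b (of_nat j)) * fact j) / of_real t ^ j) = G_poly n a b t"
  unfolding G_poly_def sum_distrib_left
proof (rule sum.cong[OF refl])
  fix j assume "j \<in> {..<n}"
  then have j: "j < n" by simp
  define m where "m = n - 1 - j"
  have n1: "n - 1 = m + j" and n: "of_nat n = (of_nat m + of_nat j + 1 :: complex)" using j by (auto simp: m_def of_nat_diff)
  have P: "pochhammer (1 - complex_of_nat n) j = (-1) ^ j * pochhammer (1 + of_nat m) j"
    using pochhammer_minus[of "of_nat n - 1 :: complex" j] by (simp add: n add.commute)
  have f: "(fact (n - 1) :: complex) = fact m * pochhammer (1 + of_nat m) j"
    unfolding n1 pochhammer_fact by (rule pochhammer_product')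
  then have P0: "pochhammer (1 + of_nat m :: complex) j \<noteq> 0"
    by (metis fact_nonzero mult_zero_right)
  have tn: "complex_of_real t ^ (n - 1) = of_real t ^ m * of_real t ^ j" by (simp only: n1 power_add)
  show "of_real t ^ (n - 1) / fact (n - 1) * (pochhammer (1 - of_nat n) j * poch_vec a j / (Gamma_vec (shift b (of_nat j)) * fact j) / of_real t ^ j)
      = (-1) ^ j * poch_vec a j / (Gamma_vec (shift b (of_nat j)) * fact j * fact (n - 1 - j)) * of_real t ^ (n - 1 - j)"
  proof -
    have cancel: "x * y / (f * p) * (\<sigma> * p * v / (g * h) / y) = \<sigma> * v / (g * h * f) * x"
      if "y \<noteq> 0" "p \<noteq> 0" for x y f p \<sigma> v g h :: complex
      using that by (simp add: mult_ac)
    have "complex_of_real t ^ j \<noteq> 0" using t by simp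
    from cancel[OF this P0] show ?thesis unfolding m_def[symmetric] P f tn by blast
  qed
qed

lemma prod_shifted_except:
  assumes "k < n"
  shows "(\<Prod>i\<in>{..<n} - {k}. of_nat i - of_nat k :: complex) = (-1) ^ k * fact k * fact (n - 1 - k)"
proof -
  have split: "{..<n} - {k} = {..<k} \<union> {Suc k..<n}" using assms by auto
  have "(\<Prod>i\<in>{..<n} - {k}. of_nat i - of_nat k :: complex) =
      (\<Prod>i<k. of_nat i - of_nat k) * (\<Prod>i\<in>{Suc k..<n}. of_nat i - of_nat k)"
    unfolding split by (rule prod.union_disjoint) auto
  also have "(\<Prod>i\<in>{Suc k..<n}. of_nat i - of_nat k :: complex) = fact (n - 1 - k)"
  proof -
    have "(\<Prod>i\<in>{Suc k..<n}. of_nat i - of_nat k :: complex) = (\<Prod>i<n - Suc k. of_nat (Suc i))"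
    proof (rule prod.reindex_bij_witness[of _ "\<lambda>i. i + Suc k" "\<lambda>i. i - Suc k"])
      fix i assume i: "i \<in> {Suc k..<n}"
      then show "of_nat (Suc (i - Suc k)) = (of_nat i - of_nat k :: complex)" by (simp add: Suc_diff_Suc flip: of_nat_diff)
    qed auto
    also have "\<dots> = fact (n - Suc k)" unfolding fact_prod_Suc atLeast0LessThan of_nat_prod[symmetric] ..
    finally show ?thesis by simp
  qed
  also have "(\<Prod>i<k. of_nat i - of_nat k :: complex) = (-1) ^ k * fact k"
  proof -
    have "(\<Prod>i<k. of_nat i - of_nat k :: complex) = pochhammer (- of_nat k) k"
      unfolding pochhammer_prod atLeast0LessThan by (intro prod.cong) auto
    then show ?thesis unfolding pochhammer_same .
  qed
  finally show ?thesis .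
qed

text \<open>The pole at \<open>- k\<close> is simple because the progressions avoid it; the factor \<open>t ^ k\<close> comes from \<open>t powr (- s)\<close>.\<close>

lemma residue_mellin_kernel_right:
  assumes len: "length a = length b" and a: "\<And>x. x \<in> set a \<Longrightarrow> x \<notin> \<int>\<^sub>\<le>\<^sub>0" and k: "k < n" and t: "t > 0"
    and disj: "G_left_points n a \<inter> {- of_nat k | k. k < n} = {}"
  shows "residue (\<lambda>s. mellin_kernel n a b s * of_real t powr (- s)) (- of_nat k) =
    - Gamma_vec a * ((-1) ^ (n - 1 - k) * poch_vec a (n - 1 - k) /
      (Gamma_vec (shift b (of_nat (n - 1 - k))) * fact (n - 1 - k) * fact k) * of_real t ^ k)"
proof -
  define z where "z = (- of_nat k :: complex)"
  define A B where "A = G_left_points n a" and "B = {- complex_of_nat k | k. k < n}"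
  define g where "g = (\<lambda>s. (-1) ^ n * (\<Prod>i<length a. Gamma (a ! i + (of_nat n - 1 + s)) * rGamma (b ! i + (of_nat n - 1 + s))) *
    (\<Prod>i\<in>{..<n} - {k}. 1 / (s + of_nat i)) * of_real t powr (- s))"
  have z: "z \<in> B" "z \<notin> A" using k disj unfolding z_def A_def B_def by blast+
  define S where "S = - (A \<union> (B - {z}))"
  have "finite (B - {z})" unfolding B_def by simp
  have "closed (A \<union> (B - {z}))"
  proof -
    have "closed A"
    proof -
      have "A = {x - of_nat l | x l. x \<in> (\<lambda>x. 1 - x - of_nat n) ` set a}" unfolding A_def G_left_points_def by auto
      also have "\<dots> \<subseteq> {u + of_int j | u j. u \<in> (\<lambda>x. 1 - x - of_nat n) ` set a}"
      proof clarify
        fix x l assume "x \<in> set a"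
        then show "\<exists>u j. 1 - x - complex_of_nat n - complex_of_nat l = u + of_int j \<and> u \<in> (\<lambda>x. 1 - x - of_nat n) ` set a"
          by (intro exI[of _ "1 - x - of_nat n"] exI[of _ "- int l"]) auto
      qed
      finally show ?thesis
        by (intro locally_finite_set_closed locally_finite_set_subset[OF integer_translates_locally_finite]) auto
    qed
    then show ?thesis using finite_imp_closed[OF \<open>finite (B - {z})\<close>] by (rule closed_Un)
  qed
  then have "open S" unfolding S_def by (rule open_Compl)
  have "z \<in> S" using z by (simp add: S_def)
  note S = \<open>open S\<close> \<open>z \<in> S\<close>
  have hol: "g holomorphic_on S"
    unfolding g_def
  proof (intro holomorphic_intros)
    fix i s assume i: "i \<in> {..<length a}" and s: "s \<in> S"
    show "a ! i + (of_nat n - 1 + s) \<notin> \<int>\<^sub>\<le>\<^sub>0"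
    proof
      assume "a ! i + (of_nat n - 1 + s) \<in> \<int>\<^sub>\<le>\<^sub>0"
      then obtain l where "a ! i + (of_nat n - 1 + s) = - of_nat l" by (rule nonpos_Ints_cases')
      then have "s = 1 - a ! i - of_nat n - of_nat l" by (simp add: algebra_simps)
      then have "s \<in> A" using i unfolding A_def G_left_points_def by force
      then show False using s by (simp add: S_def)
    qed
  next
    fix i s assume i: "i \<in> {..<n} - {k}" and s: "s \<in> S"
    show "s + of_nat i \<noteq> 0"
    proof
      assume "s + of_nat i = 0"
      then have "s = - of_nat i" by (simp add: add_eq_0_iff2)
      then have "s \<in> B - {z}" using i unfolding B_def z_def by auto
      then show False using s by (simp add: S_def)
    qed
  qed
  have "(\<lambda>s. mellin_kernel n a b s * of_real t powr (- s)) = (\<lambda>s. g s / (s - z))"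
  proof
    fix s :: complex
    have "(\<Prod>i<n. 1 / (s + of_nat i)) = 1 / (s + of_nat k) * (\<Prod>i\<in>{..<n} - {k}. 1 / (s + of_nat i))"
      using k by (intro prod.remove) auto
    then show "mellin_kernel n a b s * of_real t powr (- s) = g s / (s - z)"
      unfolding mellin_kernel_nth[OF len] g_def z_def by simp
  qed
  then have "residue (\<lambda>s. mellin_kernel n a b s * of_real t powr (- s)) z = g z"
    using residue_simple[OF S hol] by simp
  also have "g z = - Gamma_vec a * ((-1) ^ (n - 1 - k) * poch_vec a (n - 1 - k) /
      (Gamma_vec (shift b (of_nat (n - 1 - k))) * fact (n - 1 - k) * fact k) * of_real t ^ k)"
  proof -
    define j where "j = n - 1 - k"
    have n: "n = Suc (j + k)" using k by (simp add: j_def)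
    have e: "of_nat n - 1 + z = of_nat j" by (simp add: n z_def)
    have "(\<Prod>i<length a. Gamma (a ! i + of_nat j) * rGamma (b ! i + of_nat j)) = Gamma_vec a * poch_vec a j / Gamma_vec (shift b (of_nat j))"
    proof -
      have "(\<Prod>i<length a. Gamma (a ! i + of_nat j)) = Gamma_vec a * poch_vec a j"
        using Gamma_vec_shift_of_nat[of a j] a unfolding Gamma_vec_shift_nth by blast
      then show ?thesis
        unfolding prod.distrib Gamma_vec_shift_nth by (simp add: len rGamma_inverse_Gamma o_def divide_inverse flip: prod_inversef)
    qed
    moreover have "(\<Prod>i\<in>{..<n} - {k}. 1 / (z + of_nat i)) = 1 / ((-1) ^ k * fact k * fact j)"
    proof -
      have "(\<Prod>i\<in>{..<n} - {k}. 1 / (z + of_nat i)) = 1 / (\<Prod>i\<in>{..<n} - {k}. of_nat i - of_nat k)"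
        by (simp add: z_def prod_dividef)
      then show ?thesis unfolding prod_shifted_except[OF k] j_def by simp
    qed
    moreover have "of_real t powr (- z) = of_real t ^ k" using t by (simp add: z_def powr_nat')
    moreover have "(-1) ^ n / (-1) ^ k = (- ((-1) ^ j) :: complex)"
      by (simp add: n power_add)
    ultimately have "g z = (-1) ^ n * (Gamma_vec a * poch_vec a j / Gamma_vec (shift b (of_nat j))) * (1 / ((-1) ^ k * fact k * fact j)) * of_real t ^ k"
      unfolding g_def e by (simp only:)
    also have "\<dots> = ((-1) ^ n / (-1) ^ k) * (Gamma_vec a * (poch_vec a j / (Gamma_vec (shift b (of_nat j)) * fact j * fact k) * of_real t ^ k))"
      by (simp add: mult_ac)
    also have "(-1) ^ n / (-1) ^ k = (- ((-1) ^ j) :: complex)" by (simp add: n power_add)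
    finally show ?thesis unfolding j_def[symmetric] by simp
  qed
  finally show ?thesis unfolding z_def .
qed

text \<open>If no component of \<open>a\<close> is a non-positive integer, the difference is \<open>1 / \<Gamma>(a)\<close> times the full residue sum, so its moments are
  values of \<open>mellin_kernel\<close>. Otherwise the kernel is the polynomial itself; a component \<open>- m\<close> of \<open>a\<close> satisfies \<open>m < n\<close>, and the
  Pochhammer symbols on the right vanish.\<close>

lemma G_hat_reg_moments:
  assumes len: "length a = length b"
    and Re_a: "\<And>x. x \<in> set a \<Longrightarrow> 0 < Re x + real n" and \<epsilon>: "Re (psi a b) + real n > 0"
  shows "set_integrable lborel {0<..<1} (\<lambda>t. G_hat_reg n a b t - G_poly n a b t)"
    and "(LBINT t:{0<..<1}. of_real t ^ k * (G_hat_reg n a b t - G_poly n a b t)) =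
      (-1) ^ n * poch_vec a (n + k) * fact k / (Gamma_vec (shift b (of_nat (n + k))) * fact (n + k))"
proof -
  let ?e = "\<lambda>t. G_hat_reg n a b t - G_poly n a b t"
  have "set_integrable lborel {0<..<1} ?e \<and> (LBINT t:{0<..<1}. of_real t ^ k * ?e t) =
      (-1) ^ n * poch_vec a (n + k) * fact k / (Gamma_vec (shift b (of_nat (n + k))) * fact (n + k))" for k
  proof (cases "\<forall>x\<in>set a. x \<notin> \<int>\<^sub>\<le>\<^sub>0")
    case False
    then obtain x m where x: "x \<in> set a" "x = - of_nat m" by (auto elim!: nonpos_Ints_cases')
    have "m < n" using Re_a[OF x(1)] x(2) by simp
    then have "pochhammer x (n + k) = 0" unfolding x(2) by (intro pochhammer_of_nat_eq_0_lemma) simp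
    then have "poch_vec a (n + k) = 0" using x(1) unfolding poch_vec_def by (auto simp: prod_list_zero_iff)
    moreover have e0: "?e t = 0" if "t \<in> {0<..<1}" for t
    proof -
      have "G_hat_reg n a b t = G_poly n a b t"
        using False that G_poly_eq[of t n a b] unfolding G_hat_reg_def by (auto simp: G_poly_def)
      then show ?thesis by simp
    qed
    moreover have "set_integrable lborel {0<..<1} ?e"
    proof -
      have "(\<lambda>t. indicat_real {0<..<1} t *\<^sub>R ?e t) = (\<lambda>_. 0)" using e0 by (auto simp: fun_eq_iff indicator_def)
      then show ?thesis unfolding set_integrable_def by simp
    qed
    moreover have "(LBINT t:{0<..<1}. of_real t ^ k * ?e t) = 0"
    proof -
      have "(\<lambda>t. indicat_real {0<..<1} t *\<^sub>R (of_real t ^ k * ?e t)) = (\<lambda>_. 0)"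
        using e0 by (auto simp: fun_eq_iff indicator_def)
      then show ?thesis unfolding set_lebesgue_integral_def by simp
    qed
    ultimately show ?thesis by simp
  next
    case True
    then have a: "\<And>x. x \<in> set a \<Longrightarrow> x \<notin> \<int>\<^sub>\<le>\<^sub>0" by blast
    define A B where "A = G_left_points n a" and "B = {- complex_of_nat k | k. k < n}"
    obtain T where "translated_poles T A B (mellin_kernel n a b) (Re (psi a b) + real n)"
      unfolding A_def B_def by (rule mellin_kernel_translated_poles[OF len a Re_a \<epsilon>])
    then interpret translated_poles T A B "mellin_kernel n a b" "Re (psi a b) + real n" .
    have G0: "Gamma_vec a \<noteq> 0" unfolding Gamma_vec_def by (auto simp: prod_list_zero_iff Gamma_eq_zero_iff dest: a)
    define E where "E = (\<lambda>t::real. (\<Sum>l. \<Sum>d\<in>T. residue (\<lambda>s. mellin_kernel n a b s * of_real t powr (- s)) (d - of_nat l))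
      + (\<Sum>b'\<in>B. residue (\<lambda>s. mellin_kernel n a b s * of_real t powr (- s)) b'))"
    have "\<exists>g. left_loop g A (G_right_points n)"
    proof (rule left_loop_exists[OF finite_T A_eq])
      show "- real n < Re w" if "w \<in> G_right_points n" for w using that unfolding G_right_points_def by auto
      have "A \<union> G_right_points n \<subseteq> {u + of_int k | u k. u \<in> insert 0 T}"
      proof
        fix w assume "w \<in> A \<union> G_right_points n"
        then consider d l where "d \<in> T" "w = d - of_nat l" | k where "w = 1 - of_nat n + of_nat k"
          unfolding A_eq G_right_points_def by blast
        then show "w \<in> {u + of_int k | u k. u \<in> insert 0 T}"
        proof cases
          case 1
          then show ?thesis by (intro CollectI exI[of _ d] exI[of _ "- int l"]) auto
        next
          case 2
          then show ?thesis by (intro CollectI exI[of _ 0] exI[of _ "1 - int n + int k"]) auto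
        qed
      qed
      then show "locally_finite_set (A \<union> G_right_points n)"
        using finite_T by (intro locally_finite_set_subset[OF integer_translates_locally_finite[of "insert 0 T"]]) auto
      have False if x: "x \<in> set a" and eq: "1 - x - of_nat n - of_nat l = 1 - complex_of_nat n + of_nat k" for x l k
      proof -
        have "x = - of_nat (l + k)" unfolding of_nat_add using eq by algebra
        then have "x \<in> \<int>\<^sub>\<le>\<^sub>0" by (simp only: minus_of_nat_in_nonpos_Ints)
        then show False using a[OF x] by blast
      qed
      then show "A \<inter> G_right_points n = {}" unfolding A_def G_left_points_def G_right_points_def by blast
    qed
    then have loop: "left_loop (SOME g. left_loop g A (G_right_points n)) A (G_right_points n)" by (rule someI_ex)
    have BB: "B \<subseteq> G_right_points n"
    proof
      fix w assume "w \<in> B"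
      then obtain k where "k < n" "w = - of_nat k" unfolding B_def by blast
      then show "w \<in> G_right_points n" unfolding G_right_points_def
        by (intro CollectI exI[of _ "n - 1 - k"]) (auto simp: of_nat_diff)
    qed
    have sumB: "(\<Sum>b'\<in>B. residue (\<lambda>s. mellin_kernel n a b s * of_real t powr (- s)) b') = - Gamma_vec a * G_poly n a b t" if t: "t > 0" for t
    proof -
      have "B = (\<lambda>j. - of_nat (n - 1 - j)) ` {..<n}"
      proof -
        have "\<exists>j\<in>{..<n}. k = n - 1 - j" if "k < n" for k using that by (intro bexI[of _ "n - 1 - k"]) auto
        then show ?thesis unfolding B_def by force
      qed
      moreover have "inj_on (\<lambda>j. - complex_of_nat (n - 1 - j)) {..<n}" by (auto simp: inj_on_def)
      ultimately have "(\<Sum>b'\<in>B. residue (\<lambda>s. mellin_kernel n a b s * of_real t powr (- s)) b') =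
          (\<Sum>j<n. residue (\<lambda>s. mellin_kernel n a b s * of_real t powr (- s)) (- of_nat (n - 1 - j)))"
        by (simp only: sum.reindex o_def)
      also have "\<dots> = (\<Sum>j<n. - Gamma_vec a * ((-1) ^ j * poch_vec a j / (Gamma_vec (shift b (of_nat j)) * fact j * fact (n - 1 - j)) * of_real t ^ (n - 1 - j)))"
      proof (rule sum.cong[OF refl])
        fix j assume "j \<in> {..<n}"
        then have j: "n - 1 - j < n" "n - 1 - (n - 1 - j) = j" by auto
        show "residue (\<lambda>s. mellin_kernel n a b s * of_real t powr (- s)) (- of_nat (n - 1 - j)) =
          - Gamma_vec a * ((-1) ^ j * poch_vec a j / (Gamma_vec (shift b (of_nat j)) * fact j * fact (n - 1 - j)) * of_real t ^ (n - 1 - j))"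
          using residue_mellin_kernel_right[OF len a j(1) t] disj unfolding A_def B_def j(2) by simp
      qed
      finally show ?thesis unfolding G_poly_def sum_distrib_left .
    qed
    have E_eq: "?e t = E t / Gamma_vec a" if t: "t \<in> {0<..<1}" for t
    proof -
      have "loop_integral (SOME g. left_loop g A (G_right_points n)) (G_integrand n a b t) = 2 * pi * \<i> *
        (\<Sum>l. \<Sum>d\<in>T. residue (\<lambda>s. mellin_kernel n a b s * of_real t powr (- s)) (d - of_nat l))"
        using t by (intro loop_integral_eq_residue_series[OF loop BB] G_integrand_eq) auto
      then have "G_hat n a b t = (\<Sum>l. \<Sum>d\<in>T. residue (\<lambda>s. mellin_kernel n a b s * of_real t powr (- s)) (d - of_nat l))"
        unfolding G_hat_def A_def[symmetric] by simp
      then have "E t = G_hat n a b t - Gamma_vec a * G_poly n a b t"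
        using t by (simp add: E_def sumB)
      then show ?thesis using True G0 by (simp add: G_hat_reg_def field_simps)
    qed
    have int_k: "set_integrable lborel {0<..<1} (\<lambda>t. of_real t ^ k * E t)" for k
      unfolding E_def by (rule residue_series_mellin(1))
    have "set_integrable lborel {0<..<1} (\<lambda>t. E t / Gamma_vec a)" using int_k[of 0] by simp
    then have "set_integrable lborel {0<..<1} ?e"
      by (subst set_integrable_cong[OF refl refl E_eq]) auto
    moreover have "(LBINT t:{0<..<1}. of_real t ^ k * ?e t) = (LBINT t:{0<..<1}. of_real t ^ k * E t / Gamma_vec a)"
      by (intro set_lebesgue_integral_cong) (auto simp: E_eq)
    moreover have "(LBINT t:{0<..<1}. of_real t ^ k * E t / Gamma_vec a) = mellin_kernel n a b (of_nat (Suc k)) / Gamma_vec a"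
      using residue_series_mellin(2)[of k] unfolding E_def by simp
    moreover have "mellin_kernel n a b (of_nat (Suc k)) / Gamma_vec a =
        (-1) ^ n * poch_vec a (n + k) * fact k / (Gamma_vec (shift b (of_nat (n + k))) * fact (n + k))"
    proof -
      have e: "of_nat n - 1 + of_nat (Suc k) = (of_nat (n + k) :: complex)" by simp
      have "(fact (n + k) :: complex) = fact k * pochhammer (1 + of_nat k) n"
        unfolding pochhammer_fact add.commute[of n] by (rule pochhammer_product')
      moreover have "(\<Prod>i<n. of_nat (Suc k) + of_nat i :: complex) = pochhammer (1 + of_nat k) n"
        by (simp add: pochhammer_prod atLeast0LessThan add.commute)
      ultimately have "(fact (n + k) :: complex) = fact k * (\<Prod>i<n. of_nat (Suc k) + of_nat i)" by simp
      then show ?thesis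
        unfolding mellin_kernel_def e using G0 by (simp add: Gamma_vec_shift_of_nat[OF a] del: of_nat_Suc of_nat_add)
    qed
    ultimately show ?thesis by (simp only: simp_thms)
  qed
  then show "set_integrable lborel {0<..<1} ?e"
    and "(LBINT t:{0<..<1}. of_real t ^ k * ?e t) =
      (-1) ^ n * poch_vec a (n + k) * fact k / (Gamma_vec (shift b (of_nat (n + k))) * fact (n + k))" by auto
qed

section \<open>The functional on smooth functions\<close>

text \<open>A sequence of successive one-sided derivatives on \<open>[0,1]\<close>. The iterated derivatives in the definition of the functional
  are arbitrary outside the interval and are therefore replaced by such a family.\<close>

definition derivative_family :: "(nat \<Rightarrow> real \<Rightarrow> complex) \<Rightarrow> bool" where
  "derivative_family D \<longleftrightarrow> (\<forall>k. \<forall>t\<in>{0..1}. (D k has_vector_derivative D (Suc k) t) (at t within {0..1}))"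

lemma derivative_family_continuous: "derivative_family D \<Longrightarrow> continuous_on {0..1} (D k)"
  unfolding derivative_family_def by (intro continuous_on_vector_derivative) blast

lemma deriv01_funpow_eq:
  assumes D: "derivative_family D" and \<phi>: "\<And>t. t \<in> {0..1} \<Longrightarrow> \<phi> t = D 0 t" and t: "t \<in> {0..1}"
  shows "(deriv01 ^^ k) \<phi> t = D k t"
  using t
proof (induction k arbitrary: t)
  case (Suc k)
  have h: "(D k has_vector_derivative D (Suc k) t) (at t within {0..1})"
    using D Suc.prems unfolding derivative_family_def by blast
  have "((deriv01 ^^ k) \<phi> has_vector_derivative D (Suc k) t) (at t within {0..1})"
    by (rule has_vector_derivative_transform[OF Suc.prems _ h]) (rule Suc.IH)
  then have "deriv01 ((deriv01 ^^ k) \<phi>) t = D (Suc k) t"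
    unfolding deriv01_def using Suc.prems by (intro vector_derivative_within_closed_interval) auto
  then show ?case by simp
qed (use \<phi> in simp)

lemma CB_infty_derivative_family:
  assumes D: "derivative_family D" and \<phi>: "\<And>t. t \<in> {0..1} \<Longrightarrow> \<phi> t = D 0 t"
  shows "\<phi> \<in> CB_infty"
  unfolding CB_infty_def
proof (intro CollectI allI conjI)
  fix k
  note eq = deriv01_funpow_eq[OF D \<phi>]
  show "(deriv01 ^^ k) \<phi> differentiable_on {0..1}"
    unfolding differentiable_on_def
  proof
    fix t :: real assume t: "t \<in> {0..1}"
    have h: "(D k has_vector_derivative D (Suc k) t) (at t within {0..1})"
      using D t unfolding derivative_family_def by blast
    have "((deriv01 ^^ k) \<phi> has_vector_derivative D (Suc k) t) (at t within {0..1})"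
      by (rule has_vector_derivative_transform[OF t _ h]) (rule eq)
    then show "(deriv01 ^^ k) \<phi> differentiable at t within {0..1}" by (rule differentiableI_vector)
  qed
  have "(deriv01 ^^ k) \<phi> ` {0..1} = D k ` {0..1}" by (intro image_cong refl eq)
  moreover have "compact (D k ` {0..1})"
    by (intro compact_continuous_image derivative_family_continuous D) simp
  ultimately show "bounded ((deriv01 ^^ k) \<phi> ` {0..1})" by (simp add: compact_imp_bounded)
qed

lemma derivative_family_holomorphic:
  assumes "f holomorphic_on S" "open S" "of_real ` {0..1} \<subseteq> S"
  shows "derivative_family (\<lambda>k t. (deriv ^^ k) f (of_real t))"
  unfolding derivative_family_def
proof (intro allI ballI)
  fix k :: nat and t :: real assume "t \<in> {0..1}"
  then have "of_real t \<in> S" using assms(3) by blast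
  moreover have "(deriv ^^ k) f holomorphic_on S" using assms by (intro holomorphic_higher_deriv)
  ultimately have "((deriv ^^ k) f has_field_derivative deriv ((deriv ^^ k) f) (of_real t)) (at (of_real t))"
    using assms(2) by (auto intro: holomorphic_derivI)
  then show "((\<lambda>t. (deriv ^^ k) f (of_real t)) has_vector_derivative (deriv ^^ Suc k) f (of_real t)) (at t within {0..1})"
    using has_vector_derivative_real_field by fastforce
qed

text \<open>Repeated integration by parts, carried out by differentiating the sum of the boundary terms.\<close>

lemma integral_power_times_derivative:
  assumes D: "derivative_family D" and qm: "q \<le> m"
  shows "((\<lambda>t. (t ^ q / fact q) *\<^sub>R D (Suc m) t) has_integral
    (\<Sum>i\<le>q. (-1) ^ i / fact (q - i) * D (m - i) 1) - (-1) ^ q * D (m - q) 0) {0..1}"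
proof -
  define \<Phi> where "\<Phi> = (\<lambda>q m t. \<Sum>i\<le>q. ((-1) ^ i * t ^ (q - i) / fact (q - i)) *\<^sub>R D (m - i) t)"
  have "((\<Phi> q m) has_vector_derivative (t ^ q / fact q) *\<^sub>R D (Suc m) t) (at t within {0..1})"
    if t: "t \<in> {0..1}" for t
    using qm
  proof (induction q arbitrary: m)
    case 0
    have "(D m has_vector_derivative D (Suc m) t) (at t within {0..1})"
      using D t unfolding derivative_family_def by blast
    then show ?case by (simp add: \<Phi>_def)
  next
    case (Suc q)
    then obtain m' where m: "m = Suc m'" "q \<le> m'" by (cases m) auto
    have Dm: "(D m has_vector_derivative D (Suc m) t) (at t within {0..1})"
      using D t unfolding derivative_family_def by blast
    have p: "((\<lambda>t. t ^ Suc q / fact (Suc q)) has_field_derivative t ^ q / fact q) (at t within {0..1})"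
    proof -
      have "((\<lambda>t. t ^ Suc q / fact (Suc q)) has_field_derivative real (Suc q) * t ^ (Suc q - Suc 0) / fact (Suc q)) (at t within {0..1})"
        by (intro DERIV_cdivide DERIV_pow)
      moreover have "real (Suc q) * t ^ (Suc q - Suc 0) / fact (Suc q) = t ^ q / fact q"
        by (simp add: fact_Suc del: of_nat_Suc)
      ultimately show ?thesis by simp
    qed
    have "((\<lambda>t. (t ^ Suc q / fact (Suc q)) *\<^sub>R D m t - \<Phi> q m' t) has_vector_derivative
        ((t ^ Suc q / fact (Suc q)) *\<^sub>R D (Suc m) t + (t ^ q / fact q) *\<^sub>R D m t) - (t ^ q / fact q) *\<^sub>R D (Suc m') t) (at t within {0..1})"
      by (intro has_vector_derivative_diff has_vector_derivative_scaleR p Dm Suc.IH m(2))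
    moreover have "\<Phi> (Suc q) m = (\<lambda>t. (t ^ Suc q / fact (Suc q)) *\<^sub>R D m t - \<Phi> q m' t)"
      unfolding \<Phi>_def by (rule ext, subst sum.atMost_Suc_shift) (simp add: m sum_negf[symmetric] del: sum.atMost_Suc)
    ultimately show ?case by (simp add: m)
  qed
  then have "((\<lambda>t. (t ^ q / fact q) *\<^sub>R D (Suc m) t) has_integral \<Phi> q m 1 - \<Phi> q m 0) {0..1}"
    by (intro fundamental_theorem_of_calculus) auto
  moreover have "\<Phi> q m 1 = (\<Sum>i\<le>q. (-1) ^ i / fact (q - i) * D (m - i) 1)"
    unfolding \<Phi>_def by (simp add: scaleR_conv_of_real)
  moreover have "\<Phi> q m 0 = (-1) ^ q * D (m - q) 0"
  proof -
    have "\<Phi> q m 0 = (\<Sum>i\<in>{q}. ((-1) ^ i * 0 ^ (q - i) / fact (q - i)) *\<^sub>R D (m - i) 0)"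
      unfolding \<Phi>_def by (rule sum.mono_neutral_right) (auto simp: power_0_left)
    then show ?thesis by (simp add: scaleR_conv_of_real)
  qed
  ultimately show ?thesis by simp
qed

lemma continuous_unit_interval_integral:
  fixes g :: "real \<Rightarrow> complex"
  assumes "continuous_on {0..1} g"
  shows "set_integrable lborel {0<..<1} g" and "(LBINT t:{0<..<1}. g t) = integral {0..1} g"
proof -
  have "set_integrable lborel {0..1} g" unfolding set_integrable_def using borel_integrable_atLeastAtMost'[OF assms] by (simp add: set_integrable_def)
  then show i: "set_integrable lborel {0<..<1} g" by (rule set_integrable_subset) auto
  show "(LBINT t:{0<..<1}. g t) = integral {0..1} g"
    using set_borel_integral_eq_integral(2)[OF i] by (simp add: integral_open_interval_real)
qed

lemma set_integrable_mult_continuous: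
  fixes e g :: "real \<Rightarrow> complex"
  assumes e: "set_integrable lborel {0<..<1} e" and g: "continuous_on {0..1} g"
  shows "set_integrable lborel {0<..<1} (\<lambda>t. e t * g t)"
proof -
  have "bounded (g ` {0..1})" using g by (intro compact_imp_bounded compact_continuous_image) auto
  then obtain M where M: "\<And>t. t \<in> {0..1} \<Longrightarrow> norm (g t) \<le> M" unfolding bounded_iff by blast
  have gm: "(\<lambda>t. indicat_real {0<..<1} t *\<^sub>R g t) \<in> borel_measurable lborel"
    using continuous_on_subset[OF g, of "{0<..<1}"] borel_measurable_continuous_on_indicator[of "{0<..<1}" g] by (auto simp: subset_iff)
  have em: "integrable lborel (\<lambda>t. indicat_real {0<..<1} t *\<^sub>R e t)" using e by (simp add: set_integrable_def)
  have eq: "(\<lambda>t. indicat_real {0<..<1} t *\<^sub>R (e t * g t)) = (\<lambda>t. (indicat_real {0<..<1} t *\<^sub>R e t) * (indicat_real {0<..<1} t *\<^sub>R g t))"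
    by (auto simp: indicator_def)
  show ?thesis
    unfolding set_integrable_def
  proof (rule Bochner_Integration.integrable_bound)
    show "integrable lborel (\<lambda>t. M * norm (indicat_real {0<..<1} t *\<^sub>R e t))"
      using em by (intro integrable_mult_right integrable_norm)
    show "(\<lambda>t. indicat_real {0<..<1} t *\<^sub>R (e t * g t)) \<in> borel_measurable lborel"
      unfolding eq by (intro borel_measurable_times gm borel_measurable_integrable em)
    show "AE t in lborel. norm (indicat_real {0<..<1} t *\<^sub>R (e t * g t)) \<le> norm (M * norm (indicat_real {0<..<1} t *\<^sub>R e t))"
    proof (intro AE_I2)
      fix t :: real
      show "norm (indicat_real {0<..<1} t *\<^sub>R (e t * g t)) \<le> norm (M * norm (indicat_real {0<..<1} t *\<^sub>R e t))"
      proof (cases "t \<in> {0<..<1}")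
        case True
        then have "norm (g t) \<le> \<bar>M\<bar>" using M[of t] by auto
        then have "norm (e t) * norm (g t) \<le> norm (e t) * \<bar>M\<bar>" by (rule mult_left_mono) simp
        then show ?thesis using True by (simp add: norm_mult abs_mult mult.commute)
      qed simp
    qed
  qed
qed

lemma pochhammer_neg_of_nat:
  assumes "j \<le> k"
  shows "pochhammer (- of_nat k :: complex) j = (-1) ^ j * fact k / fact (k - j)"
proof -
  have k: "of_nat k = (of_nat (k - j) + of_nat j :: complex)" using assms by (simp add: of_nat_diff)
  have "(fact k :: complex) = fact (k - j) * pochhammer (1 + of_nat (k - j)) j"
    using pochhammer_product'[of "1::complex" "k - j" j] assms by (simp add: pochhammer_fact)
  moreover have "pochhammer (- of_nat k :: complex) j = (-1) ^ j * pochhammer (1 + of_nat (k - j)) j"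
    using pochhammer_minus[of "of_nat k :: complex" j] by (simp add: k add.commute)
  ultimately show ?thesis by simp
qed

text \<open>The coefficients in the definition of the functional are finite sums, as \<open>(-k)\<^sub>j\<close> vanishes for \<open>j > k\<close>.\<close>

lemma hyp_series_terminating:
  "hyp_series (a @ [- of_nat k]) b 1 = (\<Sum>j\<le>k. poch_vec a j / poch_vec b j * ((-1) ^ j * fact k / fact (k - j)) / fact j)"
proof -
  have p: "poch_vec (a @ [- of_nat k]) j = poch_vec a j * pochhammer (- of_nat k) j" for j by (simp add: poch_vec_def)
  have "hyp_series (a @ [- of_nat k]) b 1 = (\<Sum>j. poch_vec a j * pochhammer (- of_nat k) j / poch_vec b j / fact j)"
    unfolding hyp_series_def p by simp
  also have "\<dots> = (\<Sum>j\<le>k. poch_vec a j * pochhammer (- of_nat k) j / poch_vec b j / fact j)"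
    by (rule suminf_finite) (auto simp: pochhammer_of_nat_eq_0_lemma)
  also have "\<dots> = (\<Sum>j\<le>k. poch_vec a j / poch_vec b j * ((-1) ^ j * fact k / fact (k - j)) / fact j)"
    by (rule sum.cong[OF refl]) (simp add: pochhammer_neg_of_nat)
  finally show ?thesis .
qed

lemma Gamma_vec_nonzero:
  assumes "\<And>x. x \<in> set b \<Longrightarrow> x \<notin> \<int>\<^sub>\<le>\<^sub>0"
  shows "Gamma_vec b \<noteq> 0"
  unfolding Gamma_vec_def using assms by (auto simp: prod_list_zero_iff Gamma_eq_zero_iff)

lemma sum_triangle:
  fixes f :: "nat \<Rightarrow> nat \<Rightarrow> complex"
  shows "(\<Sum>k<n. \<Sum>j\<le>k. f j k) = (\<Sum>j<n. \<Sum>k\<in>{j..<n}. f j k)"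
proof -
  have "(\<Sum>k<n. \<Sum>j\<le>k. f j k) = (\<Sum>k<n. \<Sum>j<n. if j \<le> k then f j k else 0)"
    by (intro sum.cong[OF refl] sum.mono_neutral_cong_left) auto
  also have "\<dots> = (\<Sum>j<n. \<Sum>k<n. if j \<le> k then f j k else 0)" by (rule sum.swap)
  also have "\<dots> = (\<Sum>j<n. \<Sum>k\<in>{j..<n}. f j k)"
    by (intro sum.cong[OF refl] sum.mono_neutral_cong_right) auto
  finally show ?thesis .
qed

text \<open>Integration by parts of the polynomial part of the kernel produces boundary terms at both ends. Those at \<open>1\<close> cancel the
  finite sum in the definition of the functional, and those at \<open>0\<close> form a Taylor polynomial.\<close>

lemma G1_pairing_eq:
  assumes b: "\<And>x. x \<in> set b \<Longrightarrow> x \<notin> \<int>\<^sub>\<le>\<^sub>0"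
    and D: "derivative_family D" and \<phi>: "\<And>t. t \<in> {0..1} \<Longrightarrow> \<phi> t = D 0 t"
    and int: "set_integrable lborel {0<..<1} (\<lambda>t. G_hat_reg n a b t - G_poly n a b t)"
  shows "G1_pairing n a b \<phi> = (\<Sum>j<n. poch_vec a j / poch_vec b j * D j 0 / fact j) +
    (-1) ^ n * Gamma_vec b * (LBINT t:{0<..<1}. (G_hat_reg n a b t - G_poly n a b t) * D n t)"
proof -
  define e where "e = (\<lambda>t. G_hat_reg n a b t - G_poly n a b t)"
  define c where "c = (\<lambda>j. poch_vec a j / poch_vec b j / fact j)"
  have G0: "Gamma_vec b \<noteq> 0" by (rule Gamma_vec_nonzero[OF b])
  have contD: "continuous_on {0..1} (D k)" for k by (rule derivative_family_continuous[OF D])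
  have contP: "continuous_on {0..1} (\<lambda>t. G_poly n a b t * D n t)"
    unfolding G_poly_def by (intro continuous_intros contD)
  have "(LBINT t:{0<..<1}. G_hat_reg n a b t * (deriv01 ^^ n) \<phi> t) = (LBINT t:{0<..<1}. e t * D n t + G_poly n a b t * D n t)"
    using deriv01_funpow_eq[OF D \<phi>]
    by (intro set_lebesgue_integral_cong) (auto simp: e_def algebra_simps)
  also have "\<dots> = (LBINT t:{0<..<1}. e t * D n t) + (LBINT t:{0<..<1}. G_poly n a b t * D n t)"
    unfolding e_def by (intro set_integral_add set_integrable_mult_continuous int contD continuous_unit_interval_integral contP)
  finally have split: "(LBINT t:{0<..<1}. G_hat_reg n a b t * (deriv01 ^^ n) \<phi> t)
      = (LBINT t:{0<..<1}. e t * D n t) + integral {0..1} (\<lambda>t. G_poly n a b t * D n t)"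
    using continuous_unit_interval_integral(2)[OF contP] by simp
  have poly: "(-1) ^ n * Gamma_vec b * integral {0..1} (\<lambda>t. G_poly n a b t * D n t)
      = (\<Sum>j<n. c j * D j 0) - (\<Sum>j<n. \<Sum>k\<in>{j..<n}. (-1) ^ (j + k) * c j * D k 1 / fact (k - j))"
  proof -
    define I where "I = (\<lambda>j. (\<Sum>i\<le>n - 1 - j. (-1) ^ i / fact (n - 1 - j - i) * D (n - 1 - i) 1) - (-1) ^ (n - 1 - j) * D j 0)"
    define \<gamma> where "\<gamma> = (\<lambda>j. (-1) ^ j * poch_vec a j / (Gamma_vec (shift b (of_nat j)) * fact j))"
    have "((\<lambda>t. \<Sum>j<n. \<gamma> j * ((t ^ (n - 1 - j) / fact (n - 1 - j)) *\<^sub>R D n t)) has_integral (\<Sum>j<n. \<gamma> j * I j)) {0..1}"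
    proof (intro has_integral_sum has_integral_mult_right)
      fix j assume "j \<in> {..<n}"
      then have j: "n - 1 - j \<le> n - 1" "Suc (n - 1) = n" "n - 1 - (n - 1 - j) = j" by auto
      show "((\<lambda>t. (t ^ (n - 1 - j) / fact (n - 1 - j)) *\<^sub>R D n t) has_integral I j) {0..1}"
        using integral_power_times_derivative[OF D j(1)] unfolding j(2,3) I_def .
    qed auto
    moreover have "(\<lambda>t. \<Sum>j<n. \<gamma> j * ((t ^ (n - 1 - j) / fact (n - 1 - j)) *\<^sub>R D n t)) = (\<lambda>t. G_poly n a b t * D n t)"
      unfolding G_poly_def sum_distrib_right \<gamma>_def by (intro ext sum.cong refl) (simp add: scaleR_conv_of_real mult_ac)
    ultimately have "integral {0..1} (\<lambda>t. G_poly n a b t * D n t) = (\<Sum>j<n. \<gamma> j * I j)"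
      by (simp add: integral_unique)
    then have "(-1) ^ n * Gamma_vec b * integral {0..1} (\<lambda>t. G_poly n a b t * D n t)
        = (\<Sum>j<n. (-1) ^ n * (Gamma_vec b * \<gamma> j) * I j)" by (simp add: sum_distrib_left mult_ac)
    also have "\<dots> = (\<Sum>j<n. c j * D j 0 - (\<Sum>k\<in>{j..<n}. (-1) ^ (j + k) * c j * D k 1 / fact (k - j)))"
    proof (rule sum.cong[OF refl])
      fix j assume "j \<in> {..<n}"
      then have j: "j < n" by simp
      define q where "q = n - 1 - j"
      have n: "n = Suc (j + q)" using j by (simp add: q_def)
      have g: "Gamma_vec b * \<gamma> j = (-1) ^ j * c j"
      proof -
        have "Gamma_vec (shift b (of_nat j)) = Gamma_vec b * poch_vec b j"
          by (rule Gamma_vec_shift_of_nat) (rule b)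
        then show ?thesis unfolding \<gamma>_def c_def using G0 by simp
      qed
      have "(\<Sum>i\<le>q. (-1) ^ i / fact (q - i) * D (n - 1 - i) 1) = (\<Sum>k\<in>{j..<n}. (-1) ^ (n - 1 - k) / fact (k - j) * D k 1)"
        by (rule sum.reindex_bij_witness[of _ "\<lambda>k. n - 1 - k" "\<lambda>i. n - 1 - i"]) (auto simp: n)
      then have "(-1) ^ n * (Gamma_vec b * \<gamma> j) * I j = (\<Sum>k\<in>{j..<n}. (-1) ^ n * ((-1) ^ j * c j) * ((-1) ^ (n - 1 - k) / fact (k - j) * D k 1))
          - (-1) ^ n * ((-1) ^ j * c j) * ((-1) ^ q * D j 0)"
        unfolding g I_def q_def[symmetric] by (simp add: right_diff_distrib sum_distrib_left)
      also have "(-1) ^ n * ((-1) ^ j * c j) * ((-1) ^ q * D j 0) = - (c j * D j 0)"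
      proof -
        have nn: "n + j + q = Suc (2 * (j + q))" by (simp add: n)
        have "(-1) ^ n * (-1) ^ j * (-1) ^ q = (-1 :: complex) ^ (n + j + q)" by (simp only: power_add)
        also have "\<dots> = -1" unfolding nn by (simp only: power_Suc power_mult) simp
        finally show ?thesis by (metis (no_types, opaque_lifting) mult.assoc mult.left_commute mult_minus1)
      qed
      also have "(\<Sum>k\<in>{j..<n}. (-1) ^ n * ((-1) ^ j * c j) * ((-1) ^ (n - 1 - k) / fact (k - j) * D k 1))
          = (\<Sum>k\<in>{j..<n}. - ((-1) ^ (j + k) * c j * D k 1 / fact (k - j)))"
      proof (rule sum.cong[OF refl])
        fix k assume k: "k \<in> {j..<n}"
        define l where "l = n - 1 - k"
        have "n = Suc (k + l)" using k by (auto simp: l_def)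
        then have "(-1) ^ n * (-1) ^ l = (- ((-1) ^ k) :: complex)" by (simp add: power_add)
        then show "(-1) ^ n * ((-1) ^ j * c j) * ((-1) ^ (n - 1 - k) / fact (k - j) * D k 1) = - ((-1) ^ (j + k) * c j * D k 1 / fact (k - j))"
          unfolding l_def[symmetric] by (simp add: power_add mult_ac)
      qed
      finally show "(-1) ^ n * (Gamma_vec b * \<gamma> j) * I j = c j * D j 0 - (\<Sum>k\<in>{j..<n}. (-1) ^ (j + k) * c j * D k 1 / fact (k - j))"
        by (simp add: sum_negf)
    qed
    finally show ?thesis by (simp add: sum_subtractf)
  qed
  have d1: "(deriv01 ^^ k) \<phi> 1 = D k 1" for k by (rule deriv01_funpow_eq[OF D \<phi>]) auto
  have "(\<Sum>k<n. (-1) ^ k * (deriv01 ^^ k) \<phi> 1 / fact k * hyp_series (a @ [- of_nat k]) b 1)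
      = (\<Sum>k<n. \<Sum>j\<le>k. (-1) ^ (j + k) * c j * D k 1 / fact (k - j))"
    unfolding hyp_series_terminating sum_distrib_left c_def
    by (intro sum.cong refl) (simp add: d1 power_add mult_ac)
  also have "\<dots> = (\<Sum>j<n. \<Sum>k\<in>{j..<n}. (-1) ^ (j + k) * c j * D k 1 / fact (k - j))" by (rule sum_triangle)
  finally show ?thesis
    unfolding G1_pairing_def split distrib_left poly e_def by (simp add: c_def)
qed

section \<open>Power series and holomorphic parameters\<close>

text \<open>On \<open>[0,1]\<close> the Taylor series of the \<open>n\<close>-th derivative converges absolutely and uniformly, so it may be integrated against the
  kernel term by term. The moments supply the coefficients with \<open>m \<ge> n\<close>, and the Taylor polynomial in \<open>G1_pairing_eq\<close> those
  with \<open>m < n\<close>.\<close>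

lemma G1_pairing_power_series:
  assumes len: "length a = length b" and b: "\<And>x. x \<in> set b \<Longrightarrow> x \<notin> \<int>\<^sub>\<le>\<^sub>0"
    and Re_a: "\<And>x. x \<in> set a \<Longrightarrow> 0 < Re x + real n" and \<epsilon>: "Re (psi a b) + real n > 0"
    and f: "f holomorphic_on ball 0 R" and R: "R > 1" and \<phi>: "\<And>t. t \<in> {0..1} \<Longrightarrow> \<phi> t = f (of_real t)"
  shows "(\<lambda>m. poch_vec a m / poch_vec b m * (deriv ^^ m) f 0 / fact m) sums G1_pairing n a b \<phi>"
proof -
  define e where "e = (\<lambda>t. G_hat_reg n a b t - G_poly n a b t)"
  define D where "D = (\<lambda>k (t::real). (deriv ^^ k) f (of_real t))"
  have sub: "of_real ` {0..1} \<subseteq> (ball 0 R :: complex set)" using R by auto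
  have D: "derivative_family D" unfolding D_def by (rule derivative_family_holomorphic[OF f open_ball sub])
  have int: "set_integrable lborel {0<..<1} e"
    unfolding e_def by (rule G_hat_reg_moments(1)[OF len Re_a \<epsilon>])
  have pair: "G1_pairing n a b \<phi> = (\<Sum>j<n. poch_vec a j / poch_vec b j * D j 0 / fact j) +
    (-1) ^ n * Gamma_vec b * (LBINT t:{0<..<1}. e t * D n t)"
    unfolding e_def using int \<phi> by (intro G1_pairing_eq[OF b D]) (auto simp: D_def e_def)
  define g where "g = (deriv ^^ n) f"
  define c where "c = (\<lambda>k. (deriv ^^ k) g 0 / fact k)"
  have g: "g holomorphic_on ball 0 R" unfolding g_def by (intro holomorphic_higher_deriv f) auto
  have c_sums: "(\<lambda>k. c k * w ^ k) sums g w" if "w \<in> ball 0 R" for w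
    using holomorphic_power_series[OF g that] by (simp add: c_def)
  (* convergence at a point beyond 1 gives absolute convergence at 1 *)
  define x where "x = (1 + R) / 2"
  have x: "1 < x" "x < R" using R by (auto simp: x_def)
  then have "summable (\<lambda>k. c k * of_real x ^ k)" by (intro sums_summable[OF c_sums]) auto
  then have "summable (\<lambda>k. norm (c k * 1 ^ k))" by (rule powser_insidea) (use x in auto)
  then have c_abs: "summable (\<lambda>k. norm (c k))" by simp
  define h where "h = (\<lambda>k t. indicat_real {0<..<1} t *\<^sub>R (c k * (of_real t ^ k * e t)))"
  have ie: "integrable lborel (\<lambda>t. indicat_real {0<..<1} t *\<^sub>R e t)" using int by (simp add: set_integrable_def)
  have te: "set_integrable lborel {0<..<1} (\<lambda>t. of_real t ^ k * e t)" for k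
    using set_integrable_mult_continuous[OF int, of "\<lambda>t. of_real t ^ k"] by (simp add: mult.commute continuous_intros)
  have h_int: "integrable lborel (h k)" for k
    unfolding h_def using set_integrable_mult_right[OF te[of k], of "c k"] by (simp add: set_integrable_def)
  have h_le: "norm (h k t) \<le> norm (c k) * norm (indicat_real {0<..<1} t *\<^sub>R e t)" for k t
  proof (cases "t \<in> {0<..<1}")
    case True
    then have "t ^ k \<le> 1" by (intro power_le_one) auto
    then have "norm (c k) * (t ^ k * norm (e t)) \<le> norm (c k) * (1 * norm (e t))"
      by (intro mult_left_mono mult_right_mono) auto
    then show ?thesis using True by (simp add: h_def norm_mult norm_power)
  qed (simp add: h_def)
  have AE: "AE t in lborel. summable (\<lambda>k. norm (h k t))"
  proof (intro AE_I2)
    fix t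
    show "summable (\<lambda>k. norm (h k t))"
      by (rule summable_comparison_test'[where N = 0, OF summable_mult2[OF c_abs, of "norm (indicat_real {0<..<1} t *\<^sub>R e t)"]])
         (use h_le in simp)
  qed
  have norms: "summable (\<lambda>k. \<integral>t. norm (h k t) \<partial>lborel)"
  proof (rule summable_comparison_test'[where N = 0])
    show "summable (\<lambda>k. norm (c k) * (\<integral>t. norm (indicat_real {0<..<1} t *\<^sub>R e t) \<partial>lborel))"
      by (rule summable_mult2[OF c_abs])
    fix k
    have "(\<integral>t. norm (h k t) \<partial>lborel) \<le> (\<integral>t. norm (c k) * norm (indicat_real {0<..<1} t *\<^sub>R e t) \<partial>lborel)"
      using h_le by (intro integral_mono integrable_norm h_int integrable_mult_right ie)
    then show "norm (\<integral>t. norm (h k t) \<partial>lborel) \<le> norm (c k) * (\<integral>t. norm (indicat_real {0<..<1} t *\<^sub>R e t) \<partial>lborel)"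
      by simp
  qed
  have sum_h: "(\<Sum>k. h k t) = indicat_real {0<..<1} t *\<^sub>R (e t * D n t)" for t
  proof (cases "t \<in> {0<..<1}")
    case True
    then have "(\<lambda>k. c k * of_real t ^ k) sums D n t" using R c_sums[of "of_real t"] by (simp add: D_def g_def)
    then have "(\<lambda>k. c k * of_real t ^ k * e t) sums (D n t * e t)" by (rule sums_mult2)
    then show ?thesis using True by (simp add: h_def sums_iff mult_ac)
  qed (simp add: h_def)
  have h_integral: "integral\<^sup>L lborel (h k) = c k * ((-1) ^ n * poch_vec a (n + k) * fact k / (Gamma_vec (shift b (of_nat (n + k))) * fact (n + k)))" for k
  proof -
    have "integral\<^sup>L lborel (h k) = (LBINT t:{0<..<1}. c k * (of_real t ^ k * e t))"
      by (simp only: h_def set_lebesgue_integral_def)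
    also have "\<dots> = c k * (LBINT t:{0<..<1}. of_real t ^ k * e t)" by simp
    also have "(LBINT t:{0<..<1}. of_real t ^ k * e t) = (-1) ^ n * poch_vec a (n + k) * fact k / (Gamma_vec (shift b (of_nat (n + k))) * fact (n + k))"
      unfolding e_def by (rule G_hat_reg_moments(2)[OF len Re_a \<epsilon>])
    finally show ?thesis .
  qed
  have "(\<lambda>k. integral\<^sup>L lborel (h k)) sums (\<integral>t. (\<Sum>k. h k t) \<partial>lborel)" by (rule sums_integral[OF h_int AE norms])
  then have "(\<lambda>k. (-1) ^ n * Gamma_vec b * integral\<^sup>L lborel (h k)) sums ((-1) ^ n * Gamma_vec b * (LBINT t:{0<..<1}. e t * D n t))"
    unfolding sum_h set_lebesgue_integral_def by (rule sums_mult)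
  moreover have "(-1) ^ n * Gamma_vec b * integral\<^sup>L lborel (h k) =
      poch_vec a (k + n) / poch_vec b (k + n) * (deriv ^^ (k + n)) f 0 / fact (k + n)" for k
  proof -
    have G0: "Gamma_vec b \<noteq> 0" by (rule Gamma_vec_nonzero[OF b])
    have sh: "Gamma_vec (shift b (of_nat (n + k))) = Gamma_vec b * poch_vec b (n + k)"
      by (rule Gamma_vec_shift_of_nat) (rule b)
    have cc: "c k = (deriv ^^ (k + n)) f 0 / fact k" by (simp add: c_def g_def funpow_add)
    have "(-1) ^ n * Gamma_vec b * (x / fact k * ((-1) ^ n * p * fact k / (Gamma_vec b * q * y))) = p / q * x / y" for x p q y :: complex
    proof -
      have "(-1) ^ n * Gamma_vec b * (x / fact k * ((-1) ^ n * p * fact k / (Gamma_vec b * q * y)))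
          = ((-1) ^ n * (-1) ^ n) * (p / q * x / y)" using G0 by (simp add: mult_ac)
      also have "(-1) ^ n * (-1) ^ n = (1::complex)" by (simp flip: power_mult_distrib)
      finally show ?thesis by simp
    qed
    then show ?thesis unfolding h_integral sh cc by (simp only: add.commute)
  qed
  ultimately have "(\<lambda>k. poch_vec a (k + n) / poch_vec b (k + n) * (deriv ^^ (k + n)) f 0 / fact (k + n)) sums
      ((-1) ^ n * Gamma_vec b * (LBINT t:{0<..<1}. e t * D n t))" by simp
  then have "(\<lambda>m. poch_vec a m / poch_vec b m * (deriv ^^ m) f 0 / fact m) sums
      ((-1) ^ n * Gamma_vec b * (LBINT t:{0<..<1}. e t * D n t) + (\<Sum>j<n. poch_vec a j / poch_vec b j * (deriv ^^ j) f 0 / fact j))"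
    by (subst (asm) sums_iff_shift)
  then show ?thesis unfolding pair D_def by (simp add: add.commute)
qed

lemma higher_deriv_eq_family:
  assumes S: "open S" and F0: "\<And>w. w \<in> S \<Longrightarrow> f w = F 0 w"
    and F: "\<And>k w. w \<in> S \<Longrightarrow> (F k has_field_derivative F (Suc k) w) (at w)" and w: "w \<in> S"
  shows "(deriv ^^ k) f w = F k w"
  using w
proof (induction k arbitrary: w)
  case (Suc k)
  have "((deriv ^^ k) f has_field_derivative F (Suc k) w) (at w)"
    by (rule has_field_derivative_transform_within_open[OF F[OF Suc.prems] S Suc.prems]) (rule Suc.IH[symmetric])
  then show ?case by (simp add: DERIV_imp_deriv)
qed (use F0 in simp)

text \<open>Differentiation under the integral sign against a merely integrable weight: the difference quotients of the kernel
  are bounded by the mean value inequality, so dominated convergence applies.\<close>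

lemma holomorphic_set_integral_param:
  fixes e :: "real \<Rightarrow> complex" and k k' :: "complex \<Rightarrow> real \<Rightarrow> complex"
  assumes U: "open U" and e: "set_integrable lborel {0<..<1} e"
    and k: "\<And>u t. u \<in> U \<Longrightarrow> t \<in> {0..1} \<Longrightarrow> ((\<lambda>u. k u t) has_field_derivative k' u t) (at u)"
    and k_cont: "\<And>u. u \<in> U \<Longrightarrow> continuous_on {0..1} (k u)"
    and k'_cont: "continuous_on (U \<times> {0..1}) (\<lambda>(u, t). k' u t)"
  shows "(\<lambda>u. LBINT t:{0<..<1}. e t * k u t) holomorphic_on U"
proof (rule holomorphic_onI, rule field_differentiable_at_within)
  fix u0 assume u0: "u0 \<in> U"
  define I where "I = (\<lambda>u. LBINT t:{0<..<1}. e t * k u t)"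
  obtain r where r: "r > 0" "cball u0 r \<subseteq> U" using U u0 open_contains_cball by blast
  have "compact ((\<lambda>(u, t). k' u t) ` (cball u0 r \<times> {0..1}))"
    using r by (intro compact_continuous_image continuous_on_subset[OF k'_cont] compact_Times) auto
  then have "bounded ((\<lambda>(u, t). k' u t) ` (cball u0 r \<times> {0..1}))" by (rule compact_imp_bounded)
  then obtain M where M: "\<And>u t. u \<in> cball u0 r \<Longrightarrow> t \<in> {0..1} \<Longrightarrow> norm (k' u t) \<le> M"
    unfolding bounded_iff by fastforce
  have k_int: "set_integrable lborel {0<..<1} (\<lambda>t. e t * k u t)" if "u \<in> U" for u
    by (rule set_integrable_mult_continuous[OF e k_cont[OF that]])
  have "((\<lambda>u. (I u - I u0) / (u - u0)) \<longlongrightarrow> (LBINT t:{0<..<1}. e t * k' u0 t)) (at u0 within cball u0 r)"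
    unfolding tendsto_at_iff_sequentially
  proof (intro allI impI)
    fix X :: "nat \<Rightarrow> complex" assume X: "\<forall>i. X i \<in> cball u0 r - {u0}" and lim: "X \<longlonglongrightarrow> u0"
    have XU: "X i \<in> U" for i using X r by blast
    define q where "q = (\<lambda>i t. indicat_real {0<..<1} t *\<^sub>R (e t * ((k (X i) t - k u0 t) / (X i - u0))))"
    have q_int: "integrable lborel (q i)" for i
    proof -
      have "set_integrable lborel {0<..<1} (\<lambda>t. e t * ((k (X i) t - k u0 t) / (X i - u0)))"
        using X by (intro set_integrable_mult_continuous[OF e] continuous_intros k_cont XU u0) auto
      then show ?thesis by (simp add: q_def set_integrable_def)
    qed
    have q_lim: "(\<lambda>i. q i t) \<longlonglongrightarrow> indicat_real {0<..<1} t *\<^sub>R (e t * k' u0 t)" for t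
    proof (cases "t \<in> {0<..<1}")
      case True
      then have "((\<lambda>u. (k u t - k u0 t) / (u - u0)) \<longlongrightarrow> k' u0 t) (at u0)"
        using k[OF u0, of t] by (simp add: has_field_derivative_iff)
      then have "(\<lambda>i. (k (X i) t - k u0 t) / (X i - u0)) \<longlonglongrightarrow> k' u0 t"
        using X lim unfolding tendsto_at_iff_sequentially by (simp add: o_def)
      then show ?thesis unfolding q_def by (intro tendsto_intros)
    qed (simp add: q_def)
    have "(\<lambda>i. integral\<^sup>L lborel (q i)) \<longlonglongrightarrow> integral\<^sup>L lborel (\<lambda>t. indicat_real {0<..<1} t *\<^sub>R (e t * k' u0 t))"
    proof (rule integral_dominated_convergence[where w = "\<lambda>t. M * norm (indicat_real {0<..<1} t *\<^sub>R e t)"])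
      show "q i \<in> borel_measurable lborel" for i by (rule borel_measurable_integrable[OF q_int])
      show "(\<lambda>t. indicat_real {0<..<1} t *\<^sub>R (e t * k' u0 t)) \<in> borel_measurable lborel"
        by (rule borel_measurable_LIMSEQ_metric[OF borel_measurable_integrable[OF q_int] q_lim])
      show "integrable lborel (\<lambda>t. M * norm (indicat_real {0<..<1} t *\<^sub>R e t))"
        using e by (intro integrable_mult_right integrable_norm) (simp add: set_integrable_def)
      show "AE t in lborel. (\<lambda>i. q i t) \<longlonglongrightarrow> indicat_real {0<..<1} t *\<^sub>R (e t * k' u0 t)" using q_lim by simp
      show "AE t in lborel. norm (q i t) \<le> M * norm (indicat_real {0<..<1} t *\<^sub>R e t)" for i
      proof (intro AE_I2)
        fix t
        show "norm (q i t) \<le> M * norm (indicat_real {0<..<1} t *\<^sub>R e t)"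
        proof (cases "t \<in> {0<..<1}")
          case True
          have "norm (k (X i) t - k u0 t) \<le> M * norm (X i - u0)"
          proof (rule field_differentiable_bound[where S = "cball u0 r"])
            fix u assume u: "u \<in> cball u0 r"
            show "((\<lambda>u. k u t) has_field_derivative k' u t) (at u within cball u0 r)"
              using True u r by (intro has_field_derivative_at_within[OF k]) auto
            show "norm (k' u t) \<le> M" using True u by (intro M) auto
          qed (use X r in auto)
          moreover have "norm (X i - u0) > 0" using X by auto
          ultimately have "norm ((k (X i) t - k u0 t) / (X i - u0)) \<le> M" by (simp add: norm_divide divide_simps)
          then have "norm (e t) * norm ((k (X i) t - k u0 t) / (X i - u0)) \<le> norm (e t) * M" by (rule mult_left_mono) simp
          then show ?thesis using True by (simp add: q_def norm_mult norm_divide mult.commute)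
        qed (simp add: q_def)
      qed
    qed
    moreover have "integral\<^sup>L lborel (q i) = ((\<lambda>u. (I u - I u0) / (u - u0)) \<circ> X) i" for i
    proof -
      have "integral\<^sup>L lborel (q i) = (LBINT t:{0<..<1}. (e t * k (X i) t - e t * k u0 t) / (X i - u0))"
        unfolding q_def set_lebesgue_integral_def by (simp add: right_diff_distrib)
      also have "\<dots> = (LBINT t:{0<..<1}. e t * k (X i) t - e t * k u0 t) / (X i - u0)" by simp
      also have "(LBINT t:{0<..<1}. e t * k (X i) t - e t * k u0 t) = I (X i) - I u0"
        unfolding I_def by (intro set_integral_diff k_int XU u0)
      finally show ?thesis by simp
    qed
    ultimately show "((\<lambda>u. (I u - I u0) / (u - u0)) \<circ> X) \<longlonglongrightarrow> (LBINT t:{0<..<1}. e t * k' u0 t)"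
      by (simp add: set_lebesgue_integral_def o_def)
  qed
  moreover have "at u0 within cball u0 r = at u0" using r by (intro at_within_interior) auto
  ultimately have "(I has_field_derivative (LBINT t:{0<..<1}. e t * k' u0 t)) (at u0)"
    by (simp add: has_field_derivative_iff)
  then show "(\<lambda>u. LBINT t:{0<..<1}. e t * k u t) field_differentiable at u0"
    unfolding I_def[symmetric] using field_differentiable_def by blast
qed

section \<open>The three test functions\<close>

lemma pairing_exp:
  assumes len: "length a = length b" and b: "\<And>x. x \<in> set b \<Longrightarrow> x \<notin> \<int>\<^sub>\<le>\<^sub>0"
    and Re_a: "\<And>x. x \<in> set a \<Longrightarrow> 0 < Re x + real n" and \<epsilon>: "Re (psi a b) + real n > 0"
  shows "(\<lambda>t. exp (- z * of_real t)) \<in> CB_infty"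
    and "G1_pairing n a b (\<lambda>t. exp (- z * of_real t)) = hyp_series a b (- z)"
proof -
  define f where "f = (\<lambda>w. exp (- z * w))"
  have f: "f holomorphic_on S" for S unfolding f_def by (intro holomorphic_intros)
  show "(\<lambda>t. exp (- z * of_real t)) \<in> CB_infty"
    by (rule CB_infty_derivative_family[OF derivative_family_holomorphic[OF f open_UNIV]]) (auto simp: f_def)
  have "(deriv ^^ m) f 0 = (- z) ^ m" for m
  proof -
    have "(deriv ^^ m) f 0 = (- z) ^ m * exp (- z * 0)"
      by (rule higher_deriv_eq_family[OF open_UNIV, where F = "\<lambda>m w. (- z) ^ m * exp (- z * w)"])
        (auto simp: f_def intro!: derivative_eq_intros)
    then show ?thesis by simp
  qed
  moreover have "(\<lambda>m. poch_vec a m / poch_vec b m * (deriv ^^ m) f 0 / fact m) sums G1_pairing n a b (\<lambda>t. exp (- z * of_real t))"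
    by (rule G1_pairing_power_series[OF len b Re_a \<epsilon> f, where R = 2]) (auto simp: f_def)
  ultimately show "G1_pairing n a b (\<lambda>t. exp (- z * of_real t)) = hyp_series a b (- z)"
    unfolding hyp_series_def by (simp add: sums_iff)
qed

text \<open>The cosine is even, so the branch of the square root does not matter and the function is entire. Its coefficients
  contain \<open>(2m)! = 4\<^sup>m (1/2)\<^sub>m m!\<close>, and the symbol \<open>(1/2)\<^sub>m\<close> is what cancels the last component of \<open>a\<close>.\<close>

lemma cos_sqrt_power_series:
  fixes z :: complex
  defines "f \<equiv> (\<lambda>w. cos (2 * csqrt (z * w)))"
  shows "f holomorphic_on UNIV" and "(deriv ^^ m) f 0 = (- z) ^ m / pochhammer (1 / 2) m"
proof -
  define c where "c = (\<lambda>m. (- 4 * z) ^ m / fact (2 * m))"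
  have sums: "(\<lambda>m. c m * w ^ m) sums f w" for w
  proof -
    define v where "v = 2 * csqrt (z * w)"
    have v2: "v ^ 2 = 4 * (z * w)" by (simp add: v_def power_mult_distrib)
    have "(\<lambda>m. cos_coeff (2 * m) *\<^sub>R v ^ (2 * m)) sums cos v"
    proof (rule sums_mono_reindex[of "\<lambda>m. 2 * m" "\<lambda>n. cos_coeff n *\<^sub>R v ^ n", THEN iffD2])
      show "strict_mono (\<lambda>m::nat. 2 * m)" by (simp add: strict_mono_def)
      show "cos_coeff n *\<^sub>R v ^ n = 0" if "n \<notin> range (\<lambda>m. 2 * m)" for n
      proof -
        have "odd n" using that by (auto elim!: evenE)
        then show ?thesis by (simp add: cos_coeff_def)
      qed
      show "(\<lambda>n. cos_coeff n *\<^sub>R v ^ n) sums cos v" by (rule cos_converges)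
    qed
    moreover have "cos_coeff (2 * m) *\<^sub>R v ^ (2 * m) = c m * w ^ m" for m
    proof -
      have "cos_coeff (2 * m) *\<^sub>R v ^ (2 * m) = (-1) ^ m / fact (2 * m) * (4 * (z * w)) ^ m"
        by (simp add: cos_coeff_def scaleR_conv_of_real power_mult v2)
      also have "\<dots> = ((-1) * (4 * z)) ^ m * w ^ m / fact (2 * m)"
        by (simp only: power_mult_distrib times_divide_eq_left mult.assoc)
      finally show ?thesis by (simp add: c_def)
    qed
    ultimately show ?thesis by (simp add: f_def v_def)
  qed
  define P where "P = Abs_fps c"
  have radius: "fps_conv_radius P = \<infinity>"
    unfolding fps_conv_radius_def P_def fps_nth_Abs_fps
    by (rule conv_radius_inftyI'') (rule sums_summable[OF sums])
  have eval: "eval_fps P = f"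
    unfolding eval_fps_def P_def fps_nth_Abs_fps using sums by (intro ext) (simp add: sums_iff)
  show "f holomorphic_on UNIV"
    unfolding eval[symmetric] by (intro holomorphic_on_eval_fps) (simp add: radius)
  have "fps_nth P m = (deriv ^^ m) f 0 / fact m"
    unfolding eval[symmetric] by (rule fps_nth_conv_deriv) (simp add: radius)
  then have "(deriv ^^ m) f 0 = c m * fact m" by (simp add: P_def field_simps)
  also have "\<dots> = (- z) ^ m / pochhammer (1 / 2) m"
  proof -
    have "(fact (2 * m) :: complex) = 4 ^ m * pochhammer (1 / 2) m * fact m"
      using fact_double[of m, where ?'a = complex] by (simp add: power_mult)
    moreover have "(- 4 * z) ^ m = 4 ^ m * (- z) ^ m" by (simp flip: power_mult_distrib)
    ultimately show ?thesis by (simp add: c_def)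
  qed
  finally show "(deriv ^^ m) f 0 = (- z) ^ m / pochhammer (1 / 2) m" .
qed

lemma pairing_cos_sqrt:
  assumes len: "length a = length b" and b: "\<And>x. x \<in> set b \<Longrightarrow> x \<notin> \<int>\<^sub>\<le>\<^sub>0"
    and Re_a: "\<And>x. x \<in> set a \<Longrightarrow> 0 < Re x + real n" and \<epsilon>: "Re (psi a b) + real n > 0"
    and a': "a = a' @ [1 / 2]"
  shows "(\<lambda>t. cos (2 * csqrt (z * of_real t))) \<in> CB_infty"
    and "G1_pairing n a b (\<lambda>t. cos (2 * csqrt (z * of_real t))) = hyp_series a' b (- z)"
proof -
  define f where "f = (\<lambda>w. cos (2 * csqrt (z * w)))"
  have f: "f holomorphic_on S" for S
    using cos_sqrt_power_series(1)[of z] unfolding f_def by (rule holomorphic_on_subset) auto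
  show "(\<lambda>t. cos (2 * csqrt (z * of_real t))) \<in> CB_infty"
    by (rule CB_infty_derivative_family[OF derivative_family_holomorphic[OF f open_UNIV]]) (auto simp: f_def)
  have d: "(deriv ^^ m) f 0 = (- z) ^ m / pochhammer (1 / 2) m" for m
    unfolding f_def by (rule cos_sqrt_power_series(2))
  have s: "(\<lambda>m. poch_vec a m / poch_vec b m * (deriv ^^ m) f 0 / fact m) sums G1_pairing n a b (\<lambda>t. cos (2 * csqrt (z * of_real t)))"
    by (rule G1_pairing_power_series[OF len b Re_a \<epsilon> f, where R = 2]) (auto simp: f_def)
  have eq: "poch_vec a m / poch_vec b m * (deriv ^^ m) f 0 / fact m = poch_vec a' m / poch_vec b m * (- z) ^ m / fact m" for m
  proof -
    have "pochhammer (1 / 2 :: complex) m \<noteq> 0"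
    proof
      assume "pochhammer (1 / 2 :: complex) m = 0"
      then obtain k where "(1 / 2 :: complex) = - of_nat k" by (auto simp: pochhammer_eq_0_iff)
      then have "(1 / 2 :: real) = - real k" using arg_cong[of "1 / 2 :: complex" "- of_nat k" Re] by simp
      then show False by simp
    qed
    moreover have "poch_vec a m = poch_vec a' m * pochhammer (1 / 2) m" by (simp add: a' poch_vec_def)
    ultimately show ?thesis by (simp add: d)
  qed
  show "G1_pairing n a b (\<lambda>t. cos (2 * csqrt (z * of_real t))) = hyp_series a' b (- z)"
    unfolding hyp_series_def by (rule sums_unique) (use s in \<open>simp only: eq\<close>)
qed

text \<open>For a constant exponent it suffices that the base avoids the branch cut of the logarithm.\<close>

lemma continuous_on_powr_off_cut:
  fixes f :: "'a::topological_space \<Rightarrow> complex"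
  assumes "continuous_on S f" "\<And>x. x \<in> S \<Longrightarrow> f x \<notin> \<real>\<^sub>\<le>\<^sub>0"
  shows "continuous_on S (\<lambda>x. f x powr c)"
proof (rule continuous_on_eq)
  show "continuous_on S (\<lambda>x. exp (c * Ln (f x)))" using assms by (intro continuous_intros)
  show "exp (c * Ln (f x)) = f x powr c" if "x \<in> S" for x
    using assms(2)[OF that] by (auto simp: powr_def)
qed

text \<open>If \<open>u t\<close> were real and at least \<open>1\<close> for some \<open>t\<close> in \<open>[0,1]\<close>, so would be \<open>u\<close>. This keeps the base of the power off its
  branch cut, and also shows that the cut plane is starlike.\<close>

lemma hyp_cut_plane_line:
  assumes "u \<in> hyp_cut_plane" "t \<in> {0..1}"
  shows "1 - u * of_real t \<notin> \<real>\<^sub>\<le>\<^sub>0"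
proof
  assume "1 - u * of_real t \<in> \<real>\<^sub>\<le>\<^sub>0"
  then obtain x where x: "1 - u * of_real t = of_real x" "x \<le> 0" by (rule nonpos_Reals_cases)
  then have ut: "u * of_real t = of_real (1 - x)" by (simp add: algebra_simps)
  then have t: "t > 0" using x(2) assms(2) by (cases "t = 0") auto
  then have "u = of_real ((1 - x) / t)" using ut by (simp add: field_simps)
  moreover have "1 \<le> (1 - x) / t" using x(2) t assms(2) by simp
  ultimately have "u \<in> of_real ` {1..}" by blast
  then show False using assms(1) by (simp add: hyp_cut_plane_def)
qed

lemma hyp_cut_plane_open_connected: "open hyp_cut_plane" "connected hyp_cut_plane" "0 \<in> hyp_cut_plane"
proof -
  have "closed (of_real ` {1..} :: complex set)"
  proof -
    have "(of_real ` {1..} :: complex set) = {z. Im z = 0 \<and> 1 \<le> Re z}"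
    proof (intro equalityI subsetI)
      fix z :: complex assume "z \<in> {z. Im z = 0 \<and> 1 \<le> Re z}"
      then have "z = of_real (Re z)" "Re z \<in> {1..}" by (auto simp: complex_eq_iff)
      then show "z \<in> of_real ` {1..}" by (rule image_eqI)
    qed auto
    moreover have "closed {z. Im z = 0 \<and> 1 \<le> Re z}"
      by (intro closed_Collect_conj closed_Collect_eq closed_Collect_le continuous_intros)
    ultimately show ?thesis by metis
  qed
  then show "open hyp_cut_plane" unfolding hyp_cut_plane_def by (rule open_Compl)
  show 0: "0 \<in> hyp_cut_plane" by (auto simp: hyp_cut_plane_def)
  have "starlike hyp_cut_plane"
    unfolding starlike_def
  proof (intro bexI[OF _ 0] ballI)
    fix u assume u: "u \<in> hyp_cut_plane"
    show "closed_segment 0 u \<subseteq> hyp_cut_plane"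
    proof
      fix v assume "v \<in> closed_segment 0 u"
      then obtain t where t: "t \<in> {0..1}" "v = u * of_real t" by (auto simp: in_segment scaleR_conv_of_real mult.commute)
      show "v \<in> hyp_cut_plane"
      proof (rule ccontr)
        assume "v \<notin> hyp_cut_plane"
        then obtain x where x: "v = of_real x" "x \<ge> 1" by (auto simp: hyp_cut_plane_def)
        have "1 - u * of_real t = of_real (1 - x)" using t(2) x(1) by simp
        then have "1 - u * of_real t \<in> \<real>\<^sub>\<le>\<^sub>0" using x(2) by (simp del: of_real_diff)
        then show False using hyp_cut_plane_line[OF u t(1)] by blast
      qed
    qed
  qed
  then show "connected hyp_cut_plane" by (rule starlike_imp_connected)
qed

text \<open>A holomorphic function that agrees with the series in the disc proves that the continuation exists, and the identity
  theorem proves that it is the chosen one.\<close>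

lemma hyp_cont_eqI:
  assumes H: "H holomorphic_on hyp_cut_plane" and eq: "\<And>z. z \<in> ball 0 1 \<Longrightarrow> H z = hyp_series a b z"
    and u: "u \<in> hyp_cut_plane"
  shows "hyp_cont a b u = H u"
proof -
  have "\<exists>f. f holomorphic_on hyp_cut_plane \<and> (\<forall>z\<in>ball 0 1. f z = hyp_series a b z)" using H eq by blast
  from someI_ex[OF this]
  have f: "hyp_cont a b holomorphic_on hyp_cut_plane" "\<And>z. z \<in> ball 0 1 \<Longrightarrow> hyp_cont a b z = hyp_series a b z"
    unfolding hyp_cont_def[symmetric] by blast+
  have ball: "ball 0 1 \<subseteq> hyp_cut_plane"
  proof
    fix z :: complex assume "z \<in> ball 0 1"
    then show "z \<in> hyp_cut_plane" by (auto simp: hyp_cut_plane_def)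
  qed
  show ?thesis
  proof (rule analytic_continuation_open[of "ball 0 1" hyp_cut_plane "hyp_cont a b" H])
    show "hyp_cont a b z = H z" if "z \<in> ball 0 1" for z using f(2) eq that by simp
  qed (use hyp_cut_plane_open_connected ball f(1) H u in auto)
qed

text \<open>With \<open>u = - z\<close>. Both sides are holomorphic in \<open>u\<close>; in the unit disc the binomial series in \<open>t\<close> has a radius of convergence
  greater than \<open>1\<close>.\<close>

lemma pairing_binomial:
  assumes len: "length a = length b" and b: "\<And>x. x \<in> set b \<Longrightarrow> x \<notin> \<int>\<^sub>\<le>\<^sub>0"
    and Re_a: "\<And>x. x \<in> set a \<Longrightarrow> 0 < Re x + real n" and \<epsilon>: "Re (psi a b) + real n > 0"
    and u: "u \<in> hyp_cut_plane"
  shows "(\<lambda>t. (1 - u * of_real t) powr (- \<sigma>)) \<in> CB_infty"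
    and "G1_pairing n a b (\<lambda>t. (1 - u * of_real t) powr (- \<sigma>)) = hyp_cont (\<sigma> # a) b u"
proof -
  define F where "F = (\<lambda>u m w. pochhammer \<sigma> m * u ^ m * (1 - u * w) powr (- \<sigma> - of_nat m))"
  have F: "(F u m has_field_derivative F u (Suc m) w) (at w)" if "1 - u * w \<notin> \<real>\<^sub>\<le>\<^sub>0" for u w m
  proof -
    have e: "- \<sigma> - of_nat m - 1 = - \<sigma> - of_nat (Suc m)" by simp
    have "((\<lambda>w. (1 - u * w) powr (- \<sigma> - of_nat m)) has_field_derivative
        (- \<sigma> - of_nat m) * (1 - u * w) powr (- \<sigma> - of_nat m - 1) * (- u)) (at w)"
      using that by (intro DERIV_chain2[OF has_field_derivative_powr]) (auto intro!: derivative_eq_intros)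
    then have "(F u m has_field_derivative pochhammer \<sigma> m * u ^ m * ((- \<sigma> - of_nat m) * (1 - u * w) powr (- \<sigma> - of_nat m - 1) * (- u))) (at w)"
      unfolding F_def by (rule DERIV_cmult)
    moreover have "pochhammer \<sigma> m * u ^ m * ((- \<sigma> - of_nat m) * (1 - u * w) powr (- \<sigma> - of_nat m - 1) * (- u)) = F u (Suc m) w"
      unfolding F_def e pochhammer_Suc power_Suc by (simp add: algebra_simps)
    ultimately show ?thesis by simp
  qed
  have D: "derivative_family (\<lambda>k t. F u k (of_real t))" if "u \<in> hyp_cut_plane" for u
    unfolding derivative_family_def
  proof (intro allI ballI)
    fix k and t :: real assume "t \<in> {0..1}"
    then show "((\<lambda>t. F u k (of_real t)) has_vector_derivative F u (Suc k) (of_real t)) (at t within {0..1})"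
      by (intro has_vector_derivative_real_field F hyp_cut_plane_line that)
  qed
  have \<phi>: "(1 - u * of_real t) powr (- \<sigma>) = F u 0 (of_real t)" for u and t :: real by (simp add: F_def)
  show "(\<lambda>t. (1 - u * of_real t) powr (- \<sigma>)) \<in> CB_infty"
    by (rule CB_infty_derivative_family[OF D[OF u] \<phi>])
  define e where "e = (\<lambda>t. G_hat_reg n a b t - G_poly n a b t)"
  have int: "set_integrable lborel {0<..<1} e"
    unfolding e_def by (rule G_hat_reg_moments(1)[OF len Re_a \<epsilon>])
  define H where "H = (\<lambda>u. G1_pairing n a b (\<lambda>t. (1 - u * of_real t) powr (- \<sigma>)))"
  have H_eq: "H u = (\<Sum>j<n. poch_vec a j / poch_vec b j * (pochhammer \<sigma> j * u ^ j) / fact j) +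
      (-1) ^ n * Gamma_vec b * (pochhammer \<sigma> n * u ^ n * (LBINT t:{0<..<1}. e t * (1 - u * of_real t) powr (- \<sigma> - of_nat n)))"
    if u: "u \<in> hyp_cut_plane" for u
  proof -
    have "H u = (\<Sum>j<n. poch_vec a j / poch_vec b j * F u j (of_real 0) / fact j) +
      (-1) ^ n * Gamma_vec b * (LBINT t:{0<..<1}. e t * F u n (of_real t))"
      unfolding H_def e_def by (rule G1_pairing_eq[OF b D[OF u] \<phi> int[unfolded e_def]])
    also have "(LBINT t:{0<..<1}. e t * F u n (of_real t)) =
        (LBINT t:{0<..<1}. pochhammer \<sigma> n * u ^ n * (e t * (1 - u * of_real t) powr (- \<sigma> - of_nat n)))"
      by (simp add: F_def mult_ac)
    also have "\<dots> = pochhammer \<sigma> n * u ^ n * (LBINT t:{0<..<1}. e t * (1 - u * of_real t) powr (- \<sigma> - of_nat n))"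
      by (rule set_integral_mult_right)
    finally show ?thesis by (simp add: F_def)
  qed
  have "(\<lambda>u. LBINT t:{0<..<1}. e t * (1 - u * of_real t) powr (- \<sigma> - of_nat n)) holomorphic_on hyp_cut_plane"
  proof (rule holomorphic_set_integral_param[OF hyp_cut_plane_open_connected(1) int,
        where k' = "\<lambda>u t. (- \<sigma> - of_nat n) * (1 - u * of_real t) powr (- \<sigma> - of_nat n - 1) * (- of_real t)"])
    fix u and t :: real assume ut: "u \<in> hyp_cut_plane" "t \<in> {0..1}"
    show "((\<lambda>u. (1 - u * of_real t) powr (- \<sigma> - of_nat n)) has_field_derivative
        (- \<sigma> - of_nat n) * (1 - u * of_real t) powr (- \<sigma> - of_nat n - 1) * (- of_real t)) (at u)"
      using hyp_cut_plane_line[OF ut] by (intro DERIV_chain2[OF has_field_derivative_powr]) (auto intro!: derivative_eq_intros)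
  next
    fix u assume u: "u \<in> hyp_cut_plane"
    show "continuous_on {0..1} (\<lambda>t. (1 - u * of_real t) powr (- \<sigma> - of_nat n))"
      by (intro continuous_on_powr_off_cut continuous_intros hyp_cut_plane_line[OF u])
  next
    have "1 - fst y * of_real (snd y) \<notin> \<real>\<^sub>\<le>\<^sub>0" if "y \<in> hyp_cut_plane \<times> {0..1}" for y :: "complex \<times> real"
      using that hyp_cut_plane_line[of "fst y" "snd y"] by auto
    then show "continuous_on (hyp_cut_plane \<times> {0..1}) (\<lambda>(u, t). (- \<sigma> - of_nat n) * (1 - u * of_real t) powr (- \<sigma> - of_nat n - 1) * (- of_real t))"
      unfolding case_prod_unfold
      by (intro continuous_on_mult continuous_on_const continuous_on_powr_off_cut continuous_intros)
  qed
  then have "(\<lambda>u. (\<Sum>j<n. poch_vec a j / poch_vec b j * (pochhammer \<sigma> j * u ^ j) / fact j) +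
      (-1) ^ n * Gamma_vec b * (pochhammer \<sigma> n * u ^ n * (LBINT t:{0<..<1}. e t * (1 - u * of_real t) powr (- \<sigma> - of_nat n)))) holomorphic_on hyp_cut_plane"
    by (intro holomorphic_intros) auto
  then have "H holomorphic_on hyp_cut_plane"
    by (rule holomorphic_transform) (simp add: H_eq)
  moreover have "H v = hyp_series (\<sigma> # a) b v" if v: "v \<in> ball 0 1" for v
  proof -
    (* a radius between 1 and 1 / norm v *)
    define R where "R = 2 / (1 + norm v)"
    have nv: "norm v < 1" using v by simp
    have "1 + norm v > 0" using norm_ge_zero[of v] by linarith
    then have R: "R > 1" "norm v * R < 1" using nv by (simp_all add: R_def less_divide_eq divide_less_eq)
    define f where "f = (\<lambda>w. (1 - v * w) powr (- \<sigma>))"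
    have np: "1 - v * w \<notin> \<real>\<^sub>\<le>\<^sub>0" if "w \<in> ball 0 R" for w
    proof -
      have "norm (v * w) \<le> norm v * R" unfolding norm_mult using that by (intro mult_left_mono) auto
      then have "Re (v * w) < 1" using R(2) complex_Re_le_cmod[of "v * w"] by linarith
      then show ?thesis by (auto elim!: nonpos_Reals_cases simp: complex_eq_iff)
    qed
    have hol_f: "f holomorphic_on ball 0 R" unfolding f_def by (intro holomorphic_intros np)
    have s: "(\<lambda>m. poch_vec a m / poch_vec b m * (deriv ^^ m) f 0 / fact m) sums H v"
      unfolding H_def by (rule G1_pairing_power_series[OF len b Re_a \<epsilon> hol_f R(1)]) (auto simp: f_def)
    have "(deriv ^^ m) f 0 = pochhammer \<sigma> m * v ^ m" for m
    proof -
      have "(deriv ^^ m) f 0 = F v m 0"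
        by (rule higher_deriv_eq_family[OF open_ball[of 0 R]]) (use R F np in \<open>auto simp: f_def F_def\<close>)
      then show ?thesis by (simp add: F_def)
    qed
    then have eq: "poch_vec a m / poch_vec b m * (deriv ^^ m) f 0 / fact m = poch_vec (\<sigma> # a) m / poch_vec b m * v ^ m / fact m" for m
      by (simp add: poch_vec_def)
    show ?thesis unfolding hyp_series_def by (rule sums_unique) (use s in \<open>simp only: eq\<close>)
  qed
  ultimately show "G1_pairing n a b (\<lambda>t. (1 - u * of_real t) powr (- \<sigma>)) = hyp_cont (\<sigma> # a) b u"
    using hyp_cont_eqI[of H "\<sigma> # a" b u] u by (simp add: H_def)
qed

theorem corollary5:
  fixes p n :: nat and a b :: "complex list"
  assumes "p \<ge> 1" and "length a = p" and "length b = p"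
    and "\<forall>x\<in>set b. x \<notin> \<int>\<^sub>\<le>\<^sub>0"
    and "real n > - min (Min (Re ` set a)) (Re (psi a b))"
  shows "(\<forall>z \<sigma>. z \<notin> of_real ` {..-1} \<longrightarrow>
           (\<lambda>t. (1 + z * of_real t) powr (- \<sigma>)) \<in> CB_infty \<and>
           G1_pairing n a b (\<lambda>t. (1 + z * of_real t) powr (- \<sigma>)) = hyp_cont (\<sigma> # a) b (- z)) \<and>
         (\<forall>z. (\<lambda>t. exp (- z * of_real t)) \<in> CB_infty \<and>
           G1_pairing n a b (\<lambda>t. exp (- z * of_real t)) = hyp_series a b (- z)) \<and>
         (\<forall>a'. a = a' @ [1 / 2] \<longrightarrow>
           (\<forall>z. (\<lambda>t. cos (2 * csqrt (z * of_real t))) \<in> CB_infty \<and>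
             G1_pairing n a b (\<lambda>t. cos (2 * csqrt (z * of_real t))) = hyp_series a' b (- z)))"
proof -
  have len: "length a = length b" using assms(2,3) by simp
  have b: "x \<notin> \<int>\<^sub>\<le>\<^sub>0" if "x \<in> set b" for x using assms(4) that by blast
  have Re_a: "0 < Re x + real n" if "x \<in> set a" for x
  proof -
    have "Min (Re ` set a) \<le> Re x" using that by (intro Min_le) auto
    then show ?thesis using assms(5) by linarith
  qed
  have \<epsilon>: "Re (psi a b) + real n > 0" using assms(5) by linarith
  have cut: "- z \<in> hyp_cut_plane" if "z \<notin> of_real ` {..-1}" for z
  proof (rule ccontr)
    assume "- z \<notin> hyp_cut_plane"
    then obtain x where "- z = of_real x" "x \<ge> 1" by (auto simp: hyp_cut_plane_def)
    then have "z = of_real (- x)" "- x \<in> {..-1}" by (auto simp flip: \<open>- z = of_real x\<close>)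
    then show False using that by blast
  qed
  have one: "(\<lambda>t. (1 + z * of_real t) powr (- \<sigma>)) \<in> CB_infty \<and>
      G1_pairing n a b (\<lambda>t. (1 + z * of_real t) powr (- \<sigma>)) = hyp_cont (\<sigma> # a) b (- z)"
    if "z \<notin> of_real ` {..-1}" for z \<sigma>
    using pairing_binomial[OF len b Re_a \<epsilon> cut[OF that], of \<sigma>] by simp
  have two: "(\<lambda>t. exp (- z * of_real t)) \<in> CB_infty \<and>
      G1_pairing n a b (\<lambda>t. exp (- z * of_real t)) = hyp_series a b (- z)" for z
    using pairing_exp[OF len b Re_a \<epsilon>, of z] by simp
  have three: "(\<lambda>t. cos (2 * csqrt (z * of_real t))) \<in> CB_infty \<and>
      G1_pairing n a b (\<lambda>t. cos (2 * csqrt (z * of_real t))) = hyp_series a' b (- z)" if "a = a' @ [1 / 2]" for a' z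
    using pairing_cos_sqrt[OF len b Re_a \<epsilon> that, of z] by simp
  show ?thesis using one two three by blast
qed

end
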